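(* For every integer $d\ge1$, the functor $B_d:\mathfrak B^d_{\mathbb F}\to K^b_{\mathfrak A_X}(\mathfrak B_X)$ (defined in the context) is fully faithful.
   Context: **Setting.** $X$ is a topological space stratified by $\Sigma=\{C,U\}$, where $i:C\to X$ is a closed immersion and $j:U=X\setminus C\to X$ is the complementary dense open immersion. $\mathcal O_X$ is a sheaf of rings on $X$, $\mathcal O_U=j^*\mathcal O_X$, $\mathcal O_C=i^*\mathcal O_X$. For $*\in\{X,U,C\}$, $\mathfrak B_*$ is the abelian category of sheaves of $\mathcal O_*$-modules and $\mathfrak A_*\subset\mathfrak B_*$ is a full abelian subcategory stable under kernels, cokernels and extensions. $\mathcal D_*:=D^+_{\mathfrak A_*}(\mathfrak B_* )$ is the full triangulated subcategory of the derived category $D(\mathfrak B_* )$ of bounded below complexes with cohomology in $\mathfrak A_*$. It is assumed that the usual functors $i_*=i_!$, $i^*$, $\mathbf R i^!$, $\mathbf R j_*$, $j_!$, $j^*=j^!$ induce functors between $\mathcal D_C,\mathcal D_X,\mathcal D_U$, so that one is in the conditions (Beilinson–Bernstein–Deligne) for gluing $t$-structures on $\mathcal D_U$ and $\mathcal D_C$. $K^b_{\mathfrak A_X}(\mathfrak B_X)$ denotes the category of bounded complexes in $\mathfrak B_X$ with cohomology in $\mathfrak A_X$, with morphisms up to homotopy. **The functors $\mathbb F$, $\mathbb Q$.** Fix an abelian category $\mathcal A'$ and adjoint additive functors $G:\mathfrak B_U\to\mathcal A'$ (left adjoint, exact) and $F:\mathcal A'\to\mathfrak B_U$ (right adjoint,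 left exact) whose adjunction morphism $\alpha:\mathrm{Id}\to FG$ is injective. Put $\mathbb F=FG$ and let $(\mathbb Q,q)=\mathrm{coker}\,\alpha$, with $q:\mathbb F\to\mathbb Q$. Assume $\mathbb F(\mathfrak A_U)\subset\mathfrak A_U$, $\mathbb F|_{\mathfrak A_U}$ is exact, and for $A\in\mathfrak A_U$: $(\mathbf R^m j_* )(\mathbb F A)=0$ for $m>0$ and $j_*\mathbb F A\simeq \mathbf R(j_*\mathbb F)A$. (Then $\mathbb Q|_{\mathfrak A_U}$ is exact.) For $m\ge0$ put $q^m=q\mathbb Q^m:\mathbb F\mathbb Q^m\to\mathbb Q^{m+1}$, $\alpha^m=\alpha\mathbb Q^m:\mathbb Q^m\to\mathbb F\mathbb Q^m$, $g^m=\alpha^{m+1}\circ q^m:\mathbb F\mathbb Q^m\to\mathbb F\mathbb Q^{m+1}$. **The category $\mathfrak B^d_{\mathbb F}$ ($d\ge1$).** Objects are $(\mathcal L,\mathcal F,u,\sigma)$ with $\mathcal L\in\mathfrak A_U$, $\mathcal F\in\mathfrak A_X$, a morphism $u:j_*\mathbb F\mathbb Q^{d-1}\mathcal L\to\mathcal F$ and an isomorphism $\sigma:\mathbb Q^d\mathcal L\xrightarrow{\sim}j^*\mathcal F$ such that $u\circ j_*g^{d-2}_{\mathcal L}=0$ (if $d\ge2$) and $\sigma\circ q^{d-1}_{\mathcal L}=j^*u$. Morphisms $(\mathcal L,\mathcal F,u,\sigma)\to(\mathcal L',\mathcal F',u',\sigma')$ are pairs $(f:\mathcal L\to\mathcal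 L',\,g:\mathcal F\to\mathcal F')$ with $u'\circ(j_*\mathbb F\mathbb Q^{d-1}f)=g\circ u$. **The functor $B_d$.** $$B_d(\mathcal L,\mathcal F,u,\sigma)=\left(j_*\mathbb F\mathcal L\xrightarrow{j_*g^0_{\mathcal L}}j_*\mathbb F\mathbb Q\mathcal L\xrightarrow{j_*g^1_{\mathcal L}}\cdots\xrightarrow{j_*g^{d-2}_{\mathcal L}}j_*\mathbb F\mathbb Q^{d-1}\mathcal L\xrightarrow{u}\mathcal F\right)$$ placed in degrees $[0,d]$, and $B_d(f,g)$ is the (homotopy class of the) morphism equal to $j_*\mathbb F\mathbb Q^mf$ in degree $m<d$ and to $g$ in degree $d$. *)

theory Defs
  imports "HOL-Algebra.Module" "HOL-Analysis.Abstract_Topology"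
begin

section \<open>Categories and functors\<close>

text \<open>
  Arrows know their source and target. Equality of objects is equality of the underlying data,
  but every notion used below is invariant under isomorphism.
\<close>

record ('o, 'f) arrow =
  Src :: 'o
  Tgt :: 'o
  Fun :: 'f

record ('o, 'a) cat =
  Obj :: "'o set"
  Arr :: "'a set"
  Dom :: "'a \<Rightarrow> 'o"
  Cod :: "'a \<Rightarrow> 'o"
  Ident :: "'o \<Rightarrow> 'a"
  Comp :: "'a \<Rightarrow> 'a \<Rightarrow> 'a"  \<comment> \<open>\<open>Comp C g f\<close> is \<open>g\<close> after \<open>f\<close>\<close>

record ('o, 'a) add_cat = "('o, 'a) cat" +
  Add :: "'a \<Rightarrow> 'a \<Rightarrow> 'a"
  Zer :: "'o \<Rightarrow> 'o \<Rightarrow> 'a"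

record ('o1, 'a1, 'o2, 'a2) functr =
  OMap :: "'o1 \<Rightarrow> 'o2"
  AMap :: "'a1 \<Rightarrow> 'a2"

definition Hom :: "('o, 'a, 'z) cat_scheme \<Rightarrow> 'o \<Rightarrow> 'o \<Rightarrow> 'a set" where
  "Hom C x y = {f \<in> Arr C. Dom C f = x \<and> Cod C f = y}"

definition category :: "('o, 'a, 'z) cat_scheme \<Rightarrow> bool" where
  "category C \<longleftrightarrow>
     (\<forall>f \<in> Arr C. Dom C f \<in> Obj C \<and> Cod C f \<in> Obj C) \<and>
     (\<forall>x \<in> Obj C. Ident C x \<in> Hom C x x) \<and>
     (\<forall>x y z f g. f \<in> Hom C x y \<and> g \<in> Hom C y z \<longrightarrow> Comp C g f \<in> Hom C x z) \<and>
     (\<forall>x y. \<forall>f \<in> Hom C x y. Comp C f (Ident C x) = f \<and> Comp C (Ident C y) f = f) \<and>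
     (\<forall>w x y z f g h. f \<in> Hom C w x \<and> g \<in> Hom C x y \<and> h \<in> Hom C y z \<longrightarrow>
        Comp C h (Comp C g f) = Comp C (Comp C h g) f)"

definition preadditive :: "('o, 'a, 'z) add_cat_scheme \<Rightarrow> bool" where
  "preadditive C \<longleftrightarrow> category C \<and>
     (\<forall>x \<in> Obj C. \<forall>y \<in> Obj C.
        comm_group \<lparr>carrier = Hom C x y, monoid.mult = Add C, one = Zer C x y\<rparr>) \<and>
     (\<forall>x y z f f' g. f \<in> Hom C x y \<and> f' \<in> Hom C x y \<and> g \<in> Hom C y z \<longrightarrow>
        Comp C g (Add C f f') = Add C (Comp C g f) (Comp C g f')) \<and>
     (\<forall>x y z f g g'. f \<in> Hom C x y \<and> g \<in> Hom C y z \<and> g' \<in> Hom C y z \<longrightarrow>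
        Comp C (Add C g g') f = Add C (Comp C g f) (Comp C g' f))"

definition is_iso :: "('o, 'a, 'z) cat_scheme \<Rightarrow> 'a \<Rightarrow> bool" where
  "is_iso C f \<longleftrightarrow> f \<in> Arr C \<and>
     (\<exists>g \<in> Hom C (Cod C f) (Dom C f).
        Comp C g f = Ident C (Dom C f) \<and> Comp C f g = Ident C (Cod C f))"

definition is_mono :: "('o, 'a, 'z) cat_scheme \<Rightarrow> 'a \<Rightarrow> bool" where
  "is_mono C f \<longleftrightarrow> f \<in> Arr C \<and>
     (\<forall>x. \<forall>g \<in> Hom C x (Dom C f). \<forall>h \<in> Hom C x (Dom C f). Comp C f g = Comp C f h \<longrightarrow> g = h)"

definition is_epi :: "('o, 'a, 'z) cat_scheme \<Rightarrow> 'a \<Rightarrow> bool" where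
  "is_epi C f \<longleftrightarrow> f \<in> Arr C \<and>
     (\<forall>x. \<forall>g \<in> Hom C (Cod C f) x. \<forall>h \<in> Hom C (Cod C f) x. Comp C g f = Comp C h f \<longrightarrow> g = h)"

definition is_zero_obj :: "('o, 'a, 'z) cat_scheme \<Rightarrow> 'o \<Rightarrow> bool" where
  "is_zero_obj C z \<longleftrightarrow> z \<in> Obj C \<and>
     (\<forall>x \<in> Obj C. (\<exists>!f. f \<in> Hom C x z) \<and> (\<exists>!f. f \<in> Hom C z x))"

definition zero_obj :: "('o, 'a, 'z) cat_scheme \<Rightarrow> 'o" where
  "zero_obj C = (SOME z. is_zero_obj C z)"

definition is_kernel :: "('o, 'a, 'z) add_cat_scheme \<Rightarrow> 'a \<Rightarrow> 'a \<Rightarrow> bool" where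
  "is_kernel C f k \<longleftrightarrow> f \<in> Arr C \<and> k \<in> Arr C \<and> Cod C k = Dom C f \<and>
     Comp C f k = Zer C (Dom C k) (Cod C f) \<and>
     (\<forall>x. \<forall>h \<in> Hom C x (Dom C f). Comp C f h = Zer C x (Cod C f) \<longrightarrow>
        (\<exists>!e. e \<in> Hom C x (Dom C k) \<and> Comp C k e = h))"

definition is_cokernel :: "('o, 'a, 'z) add_cat_scheme \<Rightarrow> 'a \<Rightarrow> 'a \<Rightarrow> bool" where
  "is_cokernel C f c \<longleftrightarrow> f \<in> Arr C \<and> c \<in> Arr C \<and> Dom C c = Cod C f \<and>
     Comp C c f = Zer C (Dom C f) (Cod C c) \<and>
     (\<forall>x. \<forall>h \<in> Hom C (Cod C f) x. Comp C h f = Zer C (Dom C f) x \<longrightarrow>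
        (\<exists>!e. e \<in> Hom C (Cod C c) x \<and> Comp C e c = h))"

definition has_biproduct :: "('o, 'a, 'z) add_cat_scheme \<Rightarrow> 'o \<Rightarrow> 'o \<Rightarrow> bool" where
  "has_biproduct C x y \<longleftrightarrow>
     (\<exists>s \<in> Obj C. \<exists>i1 \<in> Hom C x s. \<exists>i2 \<in> Hom C y s. \<exists>p1 \<in> Hom C s x. \<exists>p2 \<in> Hom C s y.
        Comp C p1 i1 = Ident C x \<and> Comp C p2 i2 = Ident C y \<and>
        Comp C p2 i1 = Zer C x y \<and> Comp C p1 i2 = Zer C y x \<and>
        Add C (Comp C i1 p1) (Comp C i2 p2) = Ident C s)"

definition abelian_category :: "('o, 'a, 'z) add_cat_scheme \<Rightarrow> bool" where
  "abelian_category C \<longleftrightarrow> preadditive C \<and>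
     (\<exists>z. is_zero_obj C z) \<and>
     (\<forall>x \<in> Obj C. \<forall>y \<in> Obj C. has_biproduct C x y) \<and>
     (\<forall>f \<in> Arr C. (\<exists>k. is_kernel C f k) \<and> (\<exists>c. is_cokernel C f c)) \<and>
     (\<forall>m. is_mono C m \<longrightarrow> (\<exists>f. is_kernel C f m)) \<and>
     (\<forall>e. is_epi C e \<longrightarrow> (\<exists>f. is_cokernel C f e))"

definition full_subcat :: "('o, 'a, 'z) add_cat_scheme \<Rightarrow> 'o set \<Rightarrow> ('o, 'a, 'z) add_cat_scheme" where
  "full_subcat C S = C\<lparr>Obj := Obj C \<inter> S, Arr := {f \<in> Arr C. Dom C f \<in> S \<and> Cod C f \<in> S}\<rparr>"

text \<open>
  The closure conditions refer to all kernels, cokernels and extensions in \<open>C\<close>, so \<open>S\<close> is in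
  particular closed under isomorphism.
\<close>

definition stable_abelian_subcat :: "('o, 'a, 'z) add_cat_scheme \<Rightarrow> 'o set \<Rightarrow> bool" where
  "stable_abelian_subcat C S \<longleftrightarrow> S \<subseteq> Obj C \<and> abelian_category (full_subcat C S) \<and>
     (\<forall>f k. is_kernel C f k \<and> Dom C f \<in> S \<and> Cod C f \<in> S \<longrightarrow> Dom C k \<in> S) \<and>
     (\<forall>f c. is_cokernel C f c \<and> Dom C f \<in> S \<and> Cod C f \<in> S \<longrightarrow> Cod C c \<in> S) \<and>
     (\<forall>f g. is_kernel C g f \<and> is_cokernel C f g \<and> Dom C f \<in> S \<and> Cod C g \<in> S \<longrightarrow> Cod C f \<in> S)"

definition is_functor ::
  "('o1, 'a1, 'z1) cat_scheme \<Rightarrow> ('o2, 'a2, 'z2) cat_scheme \<Rightarrow> ('o1, 'a1, 'o2, 'a2) functr \<Rightarrow> bool" where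
  "is_functor C D T \<longleftrightarrow>
     (\<forall>x \<in> Obj C. OMap T x \<in> Obj D \<and> AMap T (Ident C x) = Ident D (OMap T x)) \<and>
     (\<forall>x y. \<forall>f \<in> Hom C x y. AMap T f \<in> Hom D (OMap T x) (OMap T y)) \<and>
     (\<forall>x y z f g. f \<in> Hom C x y \<and> g \<in> Hom C y z \<longrightarrow>
        AMap T (Comp C g f) = Comp D (AMap T g) (AMap T f))"

definition fully_faithful ::
  "('o1, 'a1, 'z1) cat_scheme \<Rightarrow> ('o2, 'a2, 'z2) cat_scheme \<Rightarrow> ('o1, 'a1, 'o2, 'a2) functr \<Rightarrow> bool" where
  "fully_faithful C D T \<longleftrightarrow>
     (\<forall>x \<in> Obj C. \<forall>y \<in> Obj C. bij_betw (AMap T) (Hom C x y) (Hom D (OMap T x) (OMap T y)))"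

definition additive_functor ::
  "('o1, 'a1, 'z1) add_cat_scheme \<Rightarrow> ('o2, 'a2, 'z2) add_cat_scheme \<Rightarrow>
    ('o1, 'a1, 'o2, 'a2) functr \<Rightarrow> bool" where
  "additive_functor C D T \<longleftrightarrow> is_functor C D T \<and>
     (\<forall>x y. \<forall>f \<in> Hom C x y. \<forall>g \<in> Hom C x y. AMap T (Add C f g) = Add D (AMap T f) (AMap T g))"

definition left_exact ::
  "('o1, 'a1, 'z1) add_cat_scheme \<Rightarrow> ('o2, 'a2, 'z2) add_cat_scheme \<Rightarrow>
    ('o1, 'a1, 'o2, 'a2) functr \<Rightarrow> bool" where
  "left_exact C D T \<longleftrightarrow> additive_functor C D T \<and>
     (\<forall>f k. is_kernel C f k \<longrightarrow> is_kernel D (AMap T f) (AMap T k))"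

definition exact_functor ::
  "('o1, 'a1, 'z1) add_cat_scheme \<Rightarrow> ('o2, 'a2, 'z2) add_cat_scheme \<Rightarrow>
    ('o1, 'a1, 'o2, 'a2) functr \<Rightarrow> bool" where
  "exact_functor C D T \<longleftrightarrow> left_exact C D T \<and>
     (\<forall>f c. is_cokernel C f c \<longrightarrow> is_cokernel D (AMap T f) (AMap T c))"

definition id_functor :: "('o, 'a, 'o, 'a) functr" where
  "id_functor = \<lparr>OMap = (\<lambda>x. x), AMap = (\<lambda>f. f)\<rparr>"

definition comp_functor ::
  "('o2, 'a2, 'o3, 'a3) functr \<Rightarrow> ('o1, 'a1, 'o2, 'a2) functr \<Rightarrow> ('o1, 'a1, 'o3, 'a3) functr" where
  "comp_functor T S = \<lparr>OMap = OMap T \<circ> OMap S, AMap = AMap T \<circ> AMap S\<rparr>"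

definition pow_functor :: "('o, 'a, 'o, 'a) functr \<Rightarrow> nat \<Rightarrow> ('o, 'a, 'o, 'a) functr" where
  "pow_functor T m = \<lparr>OMap = OMap T ^^ m, AMap = AMap T ^^ m\<rparr>"

definition nat_trans ::
  "('o1, 'a1, 'z1) cat_scheme \<Rightarrow> ('o2, 'a2, 'z2) cat_scheme \<Rightarrow>
    ('o1, 'a1, 'o2, 'a2) functr \<Rightarrow> ('o1, 'a1, 'o2, 'a2) functr \<Rightarrow> ('o1 \<Rightarrow> 'a2) \<Rightarrow> bool" where
  "nat_trans C D S T \<tau> \<longleftrightarrow>
     (\<forall>x \<in> Obj C. \<tau> x \<in> Hom D (OMap S x) (OMap T x)) \<and>
     (\<forall>x y. \<forall>f \<in> Hom C x y. Comp D (\<tau> y) (AMap S f) = Comp D (AMap T f) (\<tau> x))"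

text \<open>\<open>G\<close> is left adjoint to \<open>F\<close>, with unit \<open>\<alpha>\<close> and counit \<open>\<beta>\<close>.\<close>

definition adjunction ::
  "('o1, 'a1, 'z1) cat_scheme \<Rightarrow> ('o2, 'a2, 'z2) cat_scheme \<Rightarrow>
    ('o1, 'a1, 'o2, 'a2) functr \<Rightarrow> ('o2, 'a2, 'o1, 'a1) functr \<Rightarrow>
    ('o1 \<Rightarrow> 'a1) \<Rightarrow> ('o2 \<Rightarrow> 'a2) \<Rightarrow> bool" where
  "adjunction C D G F \<alpha> \<beta> \<longleftrightarrow> is_functor C D G \<and> is_functor D C F \<and>
     nat_trans C C id_functor (comp_functor F G) \<alpha> \<and>
     nat_trans D D (comp_functor G F) id_functor \<beta> \<and>
     (\<forall>x \<in> Obj C. Comp D (\<beta> (OMap G x)) (AMap G (\<alpha> x)) = Ident D (OMap G x)) \<and>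
     (\<forall>y \<in> Obj D. Comp C (AMap F (\<beta> y)) (\<alpha> (OMap F y)) = Ident C (OMap F y))"


section \<open>Complexes\<close>

record ('o, 'a) cplx =
  Cob :: "int \<Rightarrow> 'o"
  Cdf :: "int \<Rightarrow> 'a"

definition is_complex :: "('o, 'a, 'z) add_cat_scheme \<Rightarrow> ('o, 'a) cplx \<Rightarrow> bool" where
  "is_complex C K \<longleftrightarrow>
     (\<forall>n. Cob K n \<in> Obj C \<and> Cdf K n \<in> Hom C (Cob K n) (Cob K (n + 1))) \<and>
     (\<forall>n. Comp C (Cdf K (n + 1)) (Cdf K n) = Zer C (Cob K n) (Cob K (n + 1 + 1)))"

definition chain_map ::
  "('o, 'a, 'z) add_cat_scheme \<Rightarrow> ('o, 'a) cplx \<Rightarrow> ('o, 'a) cplx \<Rightarrow> (int \<Rightarrow> 'a) \<Rightarrow> bool" where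
  "chain_map C K L \<phi> \<longleftrightarrow>
     (\<forall>n. \<phi> n \<in> Hom C (Cob K n) (Cob L n)) \<and>
     (\<forall>n. Comp C (\<phi> (n + 1)) (Cdf K n) = Comp C (Cdf L n) (\<phi> n))"

definition homotopic ::
  "('o, 'a, 'z) add_cat_scheme \<Rightarrow> ('o, 'a) cplx \<Rightarrow> ('o, 'a) cplx \<Rightarrow>
    (int \<Rightarrow> 'a) \<Rightarrow> (int \<Rightarrow> 'a) \<Rightarrow> bool" where
  "homotopic C K L \<phi> \<psi> \<longleftrightarrow>
     (\<exists>h. (\<forall>n. h n \<in> Hom C (Cob K n) (Cob L (n - 1))) \<and>
          (\<forall>n. \<psi> n = Add C (\<phi> n)
                       (Add C (Comp C (Cdf L (n - 1)) (h n)) (Comp C (h (n + 1)) (Cdf K n)))))"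

text \<open>
  \<open>H\<close> is the \<open>n\<close>-th cohomology of \<open>K\<close>: \<open>k : Z \<rightarrow> K\<^sup>n\<close> is a kernel of the outgoing differential,
  \<open>b\<close> is the factorisation of the incoming one through \<open>Z\<close>, and \<open>c : Z \<rightarrow> H\<close> is a cokernel of \<open>b\<close>.
\<close>

definition cohomology_data ::
  "('o, 'a, 'z) add_cat_scheme \<Rightarrow> ('o, 'a) cplx \<Rightarrow> int \<Rightarrow> 'a \<Rightarrow> 'a \<Rightarrow> bool" where
  "cohomology_data C K n k c \<longleftrightarrow> is_kernel C (Cdf K n) k \<and>
     (\<exists>b \<in> Hom C (Cob K (n - 1)) (Dom C k). Comp C k b = Cdf K (n - 1) \<and> is_cokernel C b c)"

definition is_cohomology ::
  "('o, 'a, 'z) add_cat_scheme \<Rightarrow> ('o, 'a) cplx \<Rightarrow> int \<Rightarrow> 'o \<Rightarrow> bool" where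
  "is_cohomology C K n H \<longleftrightarrow> (\<exists>k c. cohomology_data C K n k c \<and> Cod C c = H)"

definition cohomology_in ::
  "('o, 'a, 'z) add_cat_scheme \<Rightarrow> 'o set \<Rightarrow> ('o, 'a) cplx \<Rightarrow> bool" where
  "cohomology_in C S K \<longleftrightarrow> (\<forall>n. \<exists>H \<in> S. is_cohomology C K n H)"

definition quasi_iso ::
  "('o, 'a, 'z) add_cat_scheme \<Rightarrow> ('o, 'a) cplx \<Rightarrow> ('o, 'a) cplx \<Rightarrow> (int \<Rightarrow> 'a) \<Rightarrow> bool" where
  "quasi_iso C K L \<phi> \<longleftrightarrow> chain_map C K L \<phi> \<and>
     (\<forall>n k c k' c' z h.
        cohomology_data C K n k c \<and> cohomology_data C L n k' c' \<and>
        z \<in> Hom C (Dom C k) (Dom C k') \<and> Comp C k' z = Comp C (\<phi> n) k \<and>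
        h \<in> Hom C (Cod C c) (Cod C c') \<and> Comp C h c = Comp C c' z \<longrightarrow> is_iso C h)"

definition bounded_below :: "('o, 'a, 'z) add_cat_scheme \<Rightarrow> ('o, 'a) cplx \<Rightarrow> bool" where
  "bounded_below C K \<longleftrightarrow> (\<exists>a. \<forall>n<a. is_zero_obj C (Cob K n))"

definition bounded_above :: "('o, 'a, 'z) add_cat_scheme \<Rightarrow> ('o, 'a) cplx \<Rightarrow> bool" where
  "bounded_above C K \<longleftrightarrow> (\<exists>b. \<forall>n>b. is_zero_obj C (Cob K n))"

text \<open>The objects of \<open>D\<^sup>+\<^sub>S(C)\<close>.\<close>

definition in_Dplus :: "('o, 'a, 'z) add_cat_scheme \<Rightarrow> 'o set \<Rightarrow> ('o, 'a) cplx \<Rightarrow> bool" where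
  "in_Dplus C S K \<longleftrightarrow> is_complex C K \<and> bounded_below C K \<and> cohomology_in C S K"

definition map_cplx :: "('o1, 'a1, 'o2, 'a2) functr \<Rightarrow> ('o1, 'a1) cplx \<Rightarrow> ('o2, 'a2) cplx" where
  "map_cplx T K = \<lparr>Cob = (\<lambda>n. OMap T (Cob K n)), Cdf = (\<lambda>n. AMap T (Cdf K n))\<rparr>"

text \<open>The object \<open>x\<close> as a complex in degree 0.\<close>

definition conc_cplx :: "('o, 'a, 'z) add_cat_scheme \<Rightarrow> 'o \<Rightarrow> ('o, 'a) cplx" where
  "conc_cplx C x =
     (let K = (\<lambda>n::int. if n = 0 then x else zero_obj C)
      in \<lparr>Cob = K, Cdf = (\<lambda>n. Zer C (K n) (K (n + 1)))\<rparr>)"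

definition injective_obj :: "('o, 'a, 'z) cat_scheme \<Rightarrow> 'o \<Rightarrow> bool" where
  "injective_obj C I \<longleftrightarrow> I \<in> Obj C \<and>
     (\<forall>m. is_mono C m \<longrightarrow>
        (\<forall>f \<in> Hom C (Dom C m) I. \<exists>g \<in> Hom C (Cod C m) I. Comp C g m = f))"

text \<open>
  \<open>\<rho> : K \<rightarrow> I\<close> is an injective resolution of the bounded below complex \<open>K\<close>. As usual, \<open>I\<close> starts
  in no lower degree than \<open>K\<close>.
\<close>

definition injective_resolution ::
  "('o, 'a, 'z) add_cat_scheme \<Rightarrow> ('o, 'a) cplx \<Rightarrow> ('o, 'a) cplx \<Rightarrow> (int \<Rightarrow> 'a) \<Rightarrow> bool" where
  "injective_resolution C K I \<rho> \<longleftrightarrow> is_complex C I \<and> bounded_below C I \<and>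
     (\<forall>n. injective_obj C (Cob I n)) \<and> quasi_iso C K I \<rho> \<and>
     (\<forall>a. (\<forall>n<a. is_zero_obj C (Cob K n)) \<longrightarrow> (\<forall>n<a. is_zero_obj C (Cob I n)))"

text \<open>
  The functor induced by an exact functor on complexes, respectively the right derived functor
  \<open>\<^bold>R T K = T I\<close> of a left exact one (\<open>I\<close> an injective resolution of \<open>K\<close>), is defined on
  \<open>D\<^sup>+\<^sub>S(C)\<close> and takes values in \<open>D\<^sup>+\<^sub>S\<^sub>'(D)\<close>. Two injective resolutions of \<open>K\<close> are homotopy
  equivalent, so it does not matter which one is used.
\<close>

definition induces_Dplus ::
  "('o1, 'a1, 'z1) add_cat_scheme \<Rightarrow> 'o1 set \<Rightarrow> ('o2, 'a2, 'z2) add_cat_scheme \<Rightarrow> 'o2 set \<Rightarrow>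
    ('o1, 'a1, 'o2, 'a2) functr \<Rightarrow> bool" where
  "induces_Dplus C S D S' T \<longleftrightarrow> (\<forall>K. in_Dplus C S K \<longrightarrow> in_Dplus D S' (map_cplx T K))"

definition derived_induces_Dplus ::
  "('o1, 'a1, 'z1) add_cat_scheme \<Rightarrow> 'o1 set \<Rightarrow> ('o2, 'a2, 'z2) add_cat_scheme \<Rightarrow> 'o2 set \<Rightarrow>
    ('o1, 'a1, 'o2, 'a2) functr \<Rightarrow> bool" where
  "derived_induces_Dplus C S D S' T \<longleftrightarrow>
     (\<forall>K. in_Dplus C S K \<longrightarrow>
        (\<exists>I \<rho>. injective_resolution C K I \<rho> \<and> in_Dplus D S' (map_cplx T I)))"

text \<open>\<open>\<^bold>R\<^sup>m T x = 0\<close> for all \<open>m > 0\<close>.\<close>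

definition acyclic_for ::
  "('o1, 'a1, 'z1) add_cat_scheme \<Rightarrow> ('o2, 'a2, 'z2) add_cat_scheme \<Rightarrow>
    ('o1, 'a1, 'o2, 'a2) functr \<Rightarrow> 'o1 \<Rightarrow> bool" where
  "acyclic_for C D T x \<longleftrightarrow>
     (\<exists>I \<rho>. injective_resolution C (conc_cplx C x) I \<rho> \<and>
        (\<forall>m>0. \<exists>H. is_cohomology D (map_cplx T I) m H \<and> is_zero_obj D H))"

text \<open>The canonical morphism \<open>T x \<rightarrow> \<^bold>R T x\<close> is an isomorphism in the derived category.\<close>

definition equals_derived_at ::
  "('o1, 'a1, 'z1) add_cat_scheme \<Rightarrow> ('o2, 'a2, 'z2) add_cat_scheme \<Rightarrow>
    ('o1, 'a1, 'o2, 'a2) functr \<Rightarrow> 'o1 \<Rightarrow> bool" where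
  "equals_derived_at C D T x \<longleftrightarrow>
     (\<exists>I \<rho>. injective_resolution C (conc_cplx C x) I \<rho> \<and>
        quasi_iso D (map_cplx T (conc_cplx C x)) (map_cplx T I) (\<lambda>n. AMap T (\<rho> n)))"

text \<open>
  \<open>K\<^sup>b\<^sub>S(C)\<close>: the arrows are homotopy classes, represented by the set of all chain maps in the class.
\<close>

definition htpy_class ::
  "('o, 'a, 'z) add_cat_scheme \<Rightarrow> ('o, 'a) cplx \<Rightarrow> ('o, 'a) cplx \<Rightarrow> (int \<Rightarrow> 'a) \<Rightarrow>
    (('o, 'a) cplx, (int \<Rightarrow> 'a) set) arrow" where
  "htpy_class C K L \<phi> = \<lparr>Src = K, Tgt = L, Fun = {\<psi>. chain_map C K L \<psi> \<and> homotopic C K L \<phi> \<psi>}\<rparr>"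

definition Kb ::
  "('o, 'a, 'z) add_cat_scheme \<Rightarrow> 'o set \<Rightarrow>
    (('o, 'a) cplx, (('o, 'a) cplx, (int \<Rightarrow> 'a) set) arrow) cat" where
  "Kb C S =
    (let Ob = {K. is_complex C K \<and> bounded_below C K \<and> bounded_above C K \<and> cohomology_in C S K}
     in \<lparr>Obj = Ob,
         Arr = {htpy_class C K L \<phi> | K L \<phi>. K \<in> Ob \<and> L \<in> Ob \<and> chain_map C K L \<phi>},
         Dom = Src,
         Cod = Tgt,
         Ident = (\<lambda>K. htpy_class C K K (\<lambda>n. Ident C (Cob K n))),
         Comp = (\<lambda>\<Psi> \<Phi>. htpy_class C (Src \<Phi>) (Tgt \<Psi>)
            (\<lambda>n. Comp C ((SOME \<psi>. \<psi> \<in> Fun \<Psi>) n) ((SOME \<phi>. \<phi> \<in> Fun \<Phi>) n)))\<rparr>)"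


section \<open>Sheaves of modules\<close>

text \<open>Rings are unital but not necessarily commutative; modules are left modules.\<close>

locale left_module = R?: ring R + M?: abelian_group M
  for R (structure) and M (structure) +
  assumes smult_closed [simp, intro]:
      "\<lbrakk>a \<in> carrier R; x \<in> carrier M\<rbrakk> \<Longrightarrow> a \<odot>\<^bsub>M\<^esub> x \<in> carrier M"
    and smult_l_distr:
      "\<lbrakk>a \<in> carrier R; b \<in> carrier R; x \<in> carrier M\<rbrakk> \<Longrightarrow>
        (a \<oplus>\<^bsub>R\<^esub> b) \<odot>\<^bsub>M\<^esub> x = a \<odot>\<^bsub>M\<^esub> x \<oplus>\<^bsub>M\<^esub> b \<odot>\<^bsub>M\<^esub> x"
    and smult_r_distr:
      "\<lbrakk>a \<in> carrier R; x \<in> carrier M; y \<in> carrier M\<rbrakk> \<Longrightarrow>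
        a \<odot>\<^bsub>M\<^esub> (x \<oplus>\<^bsub>M\<^esub> y) = a \<odot>\<^bsub>M\<^esub> x \<oplus>\<^bsub>M\<^esub> a \<odot>\<^bsub>M\<^esub> y"
    and smult_assoc1:
      "\<lbrakk>a \<in> carrier R; b \<in> carrier R; x \<in> carrier M\<rbrakk> \<Longrightarrow>
        (a \<otimes>\<^bsub>R\<^esub> b) \<odot>\<^bsub>M\<^esub> x = a \<odot>\<^bsub>M\<^esub> (b \<odot>\<^bsub>M\<^esub> x)"
    and smult_one: "x \<in> carrier M \<Longrightarrow> \<one>\<^bsub>R\<^esub> \<odot>\<^bsub>M\<^esub> x = x"

text \<open>
  Presheaves are given by their sections over the open sets; values on other sets are junk.
  \<open>RRes \<O> W V\<close> and \<open>MRes M W V\<close> are the restriction maps from \<open>W\<close> to \<open>V \<subseteq> W\<close>. The fields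
  \<open>mult\<close> and \<open>one\<close> of \<open>MSec M V\<close>, which HOL-Algebra's module record inherits from rings, are unused.
\<close>

record ('p, 'r) ring_psh =
  RSec :: "'p set \<Rightarrow> 'r ring"
  RRes :: "'p set \<Rightarrow> 'p set \<Rightarrow> 'r \<Rightarrow> 'r"

record ('p, 'r, 'm) mod_psh =
  MSec :: "'p set \<Rightarrow> ('r, 'm) module"
  MRes :: "'p set \<Rightarrow> 'p set \<Rightarrow> 'm \<Rightarrow> 'm"

definition sheaf_of_sets ::
  "'p topology \<Rightarrow> ('p set \<Rightarrow> 's set) \<Rightarrow> ('p set \<Rightarrow> 'p set \<Rightarrow> 's \<Rightarrow> 's) \<Rightarrow> bool" where
  "sheaf_of_sets X S res \<longleftrightarrow>
     (\<forall>V W. openin X V \<and> openin X W \<and> V \<subseteq> W \<longrightarrow> res W V \<in> S W \<rightarrow> S V) \<and>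
     (\<forall>V. openin X V \<longrightarrow> (\<forall>s \<in> S V. res V V s = s)) \<and>
     (\<forall>T V W. openin X T \<and> openin X V \<and> openin X W \<and> T \<subseteq> V \<and> V \<subseteq> W \<longrightarrow>
        (\<forall>s \<in> S W. res V T (res W V s) = res W T s)) \<and>
     (\<forall>\<V> \<sigma>. (\<forall>V \<in> \<V>. openin X V \<and> \<sigma> V \<in> S V) \<and>
        (\<forall>V \<in> \<V>. \<forall>W \<in> \<V>. res V (V \<inter> W) (\<sigma> V) = res W (V \<inter> W) (\<sigma> W)) \<longrightarrow>
        (\<exists>!s. s \<in> S (\<Union>\<V>) \<and> (\<forall>V \<in> \<V>. res (\<Union>\<V>) V s = \<sigma> V)))"

definition sheaf_of_rings :: "'p topology \<Rightarrow> ('p, 'r) ring_psh \<Rightarrow> bool" where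
  "sheaf_of_rings X \<O> \<longleftrightarrow>
     sheaf_of_sets X (\<lambda>V. carrier (RSec \<O> V)) (RRes \<O>) \<and>
     (\<forall>V. openin X V \<longrightarrow> ring (RSec \<O> V)) \<and>
     (\<forall>V W. openin X V \<and> openin X W \<and> V \<subseteq> W \<longrightarrow> RRes \<O> W V \<in> ring_hom (RSec \<O> W) (RSec \<O> V))"

definition sheaf_of_modules ::
  "'p topology \<Rightarrow> ('p, 'r) ring_psh \<Rightarrow> ('p, 'r, 'm) mod_psh \<Rightarrow> bool" where
  "sheaf_of_modules X \<O> M \<longleftrightarrow>
     sheaf_of_sets X (\<lambda>V. carrier (MSec M V)) (MRes M) \<and>
     (\<forall>V. openin X V \<longrightarrow> left_module (RSec \<O> V) (MSec M V)) \<and>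
     (\<forall>V W. openin X V \<and> openin X W \<and> V \<subseteq> W \<longrightarrow>
        (\<forall>s \<in> carrier (MSec M W). \<forall>t \<in> carrier (MSec M W).
           MRes M W V (s \<oplus>\<^bsub>MSec M W\<^esub> t) = MRes M W V s \<oplus>\<^bsub>MSec M V\<^esub> MRes M W V t) \<and>
        (\<forall>a \<in> carrier (RSec \<O> W). \<forall>s \<in> carrier (MSec M W).
           MRes M W V (a \<odot>\<^bsub>MSec M W\<^esub> s) = RRes \<O> W V a \<odot>\<^bsub>MSec M V\<^esub> MRes M W V s))"

text \<open>The two sheaves may have sections in different types.\<close>

definition shmod_hom ::
  "'p topology \<Rightarrow> ('p, 'r) ring_psh \<Rightarrow> ('p, 'r, 'm) mod_psh \<Rightarrow> ('p, 'r, 'n) mod_psh \<Rightarrow>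
    ('p set \<Rightarrow> 'm \<Rightarrow> 'n) \<Rightarrow> bool" where
  "shmod_hom X \<O> M N \<phi> \<longleftrightarrow>
     (\<forall>V. openin X V \<longrightarrow>
        \<phi> V \<in> carrier (MSec M V) \<rightarrow> carrier (MSec N V) \<and>
        (\<forall>s \<in> carrier (MSec M V). \<forall>t \<in> carrier (MSec M V).
           \<phi> V (s \<oplus>\<^bsub>MSec M V\<^esub> t) = \<phi> V s \<oplus>\<^bsub>MSec N V\<^esub> \<phi> V t) \<and>
        (\<forall>a \<in> carrier (RSec \<O> V). \<forall>s \<in> carrier (MSec M V).
           \<phi> V (a \<odot>\<^bsub>MSec M V\<^esub> s) = a \<odot>\<^bsub>MSec N V\<^esub> \<phi> V s)) \<and>
     (\<forall>V W. openin X V \<and> openin X W \<and> V \<subseteq> W \<longrightarrow>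
        (\<forall>s \<in> carrier (MSec M W). \<phi> V (MRes M W V s) = MRes N W V (\<phi> W s)))"

type_synonym ('p, 'r, 'm) shmod_arrow = "(('p, 'r, 'm) mod_psh, 'p set \<Rightarrow> 'm \<Rightarrow> 'm) arrow"

type_synonym ('p, 'r, 'm) shmod_functr =
  "(('p, 'r, 'm) mod_psh, ('p, 'r, 'm) shmod_arrow, ('p, 'r, 'm) mod_psh, ('p, 'r, 'm) shmod_arrow) functr"

text \<open>
  Families of maps on sections are normalised to be \<open>undefined\<close> off the open sets and off the
  sections, so that equality of arrows is equality of morphisms of sheaves.
\<close>

definition mk_arrow ::
  "'p topology \<Rightarrow> ('p, 'r, 'm) mod_psh \<Rightarrow> ('p, 'r, 'm) mod_psh \<Rightarrow> ('p set \<Rightarrow> 'm \<Rightarrow> 'm) \<Rightarrow>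
    ('p, 'r, 'm) shmod_arrow" where
  "mk_arrow X M N \<phi> =
     \<lparr>Src = M, Tgt = N, Fun = (\<lambda>V \<in> {V. openin X V}. \<lambda>s \<in> carrier (MSec M V). \<phi> V s)\<rparr>"

text \<open>
  The category of sheaves of \<open>\<O>\<close>-modules with sections in the type \<open>'m\<close>; the type plays the role of
  the universe.
\<close>

definition ShMod ::
  "'p topology \<Rightarrow> ('p, 'r) ring_psh \<Rightarrow> (('p, 'r, 'm) mod_psh, ('p, 'r, 'm) shmod_arrow) add_cat" where
  "ShMod X \<O> =
     \<lparr>Obj = {M. sheaf_of_modules X \<O> M},
      Arr = {mk_arrow X M N \<phi> | M N \<phi>.
               sheaf_of_modules X \<O> M \<and> sheaf_of_modules X \<O> N \<and> shmod_hom X \<O> M N \<phi>},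
      Dom = Src,
      Cod = Tgt,
      Ident = (\<lambda>M. mk_arrow X M M (\<lambda>V s. s)),
      Comp = (\<lambda>g f. mk_arrow X (Src f) (Tgt g) (\<lambda>V s. Fun g V (Fun f V s))),
      Add = (\<lambda>f g. mk_arrow X (Src f) (Tgt f) (\<lambda>V s. Fun f V s \<oplus>\<^bsub>MSec (Tgt f) V\<^esub> Fun g V s)),
      Zer = (\<lambda>M N. mk_arrow X M N (\<lambda>V s. \<zero>\<^bsub>MSec N V\<^esub>))\<rparr>"


section \<open>Open subspaces\<close>

text \<open>
  Restriction to an open \<open>U\<close> only forgets the sections over open sets not contained in \<open>U\<close>. Hence
  \<open>j\<^sup>*\<close> does not change the data of a presheaf, the ringed space \<open>(U, \<O>\<^sub>U)\<close> is
  \<open>(subtopology X U, \<O>)\<close>, and \<open>j\<^sup>* M\<close> is \<open>M\<close> seen on \<open>subtopology X U\<close>.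
\<close>

definition j_pull ::
  "'p topology \<Rightarrow> 'p set \<Rightarrow>
    ('p, 'r, 'm) shmod_functr" where
  "j_pull X U = \<lparr>OMap = (\<lambda>M. M), AMap = (\<lambda>f. mk_arrow (subtopology X U) (Src f) (Tgt f) (Fun f))\<rparr>"

definition j_push_obj ::
  "('p, 'r) ring_psh \<Rightarrow> 'p set \<Rightarrow> ('p, 'r, 'm) mod_psh \<Rightarrow> ('p, 'r, 'm) mod_psh" where
  "j_push_obj \<O> U M =
     \<lparr>MSec = (\<lambda>V. (MSec M (V \<inter> U))\<lparr>smult := (\<lambda>a s. RRes \<O> V (V \<inter> U) a \<odot>\<^bsub>MSec M (V \<inter> U)\<^esub> s)\<rparr>),
      MRes = (\<lambda>W V. MRes M (W \<inter> U) (V \<inter> U))\<rparr>"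

definition j_push ::
  "'p topology \<Rightarrow> ('p, 'r) ring_psh \<Rightarrow> 'p set \<Rightarrow>
    ('p, 'r, 'm) shmod_functr" where
  "j_push X \<O> U =
     \<lparr>OMap = j_push_obj \<O> U,
      AMap = (\<lambda>f. mk_arrow X (j_push_obj \<O> U (Src f)) (j_push_obj \<O> U (Tgt f)) (\<lambda>V. Fun f (V \<inter> U)))\<rparr>"

text \<open>The canonical isomorphism \<open>j\<^sup>* j\<^sub>* M \<rightarrow> M\<close>: for \<open>V \<subseteq> U\<close> one has \<open>V \<inter> U = V\<close>.\<close>

definition j_counit ::
  "'p topology \<Rightarrow> ('p, 'r) ring_psh \<Rightarrow> 'p set \<Rightarrow> ('p, 'r, 'm) mod_psh \<Rightarrow> ('p, 'r, 'm) shmod_arrow" where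
  "j_counit X \<O> U M = mk_arrow (subtopology X U) (j_push_obj \<O> U M) M (\<lambda>V s. s)"

text \<open>
  \<open>j\<^sub>! M\<close>, extension by zero, as the subsheaf of \<open>j\<^sub>* M\<close> of the sections over \<open>V \<inter> U\<close> whose support is
  closed in \<open>V\<close>, that is, which vanish on \<open>W \<inter> U\<close> for an open \<open>W \<subseteq> V\<close> containing \<open>V - U\<close>.
\<close>

definition j_ext_obj ::
  "'p topology \<Rightarrow> ('p, 'r) ring_psh \<Rightarrow> 'p set \<Rightarrow> ('p, 'r, 'm) mod_psh \<Rightarrow> ('p, 'r, 'm) mod_psh" where
  "j_ext_obj X \<O> U M =
     \<lparr>MSec = (\<lambda>V. (MSec (j_push_obj \<O> U M) V)
        \<lparr>carrier := {s \<in> carrier (MSec M (V \<inter> U)). \<exists>W. openin X W \<and> V - U \<subseteq> W \<and> W \<subseteq> V \<and>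
                        MRes M (V \<inter> U) (W \<inter> U) s = \<zero>\<^bsub>MSec M (W \<inter> U)\<^esub>}\<rparr>),
      MRes = MRes (j_push_obj \<O> U M)\<rparr>"

definition j_ext ::
  "'p topology \<Rightarrow> ('p, 'r) ring_psh \<Rightarrow> 'p set \<Rightarrow>
    ('p, 'r, 'm) shmod_functr" where
  "j_ext X \<O> U =
     \<lparr>OMap = j_ext_obj X \<O> U,
      AMap = (\<lambda>f. mk_arrow X (j_ext_obj X \<O> U (Src f)) (j_ext_obj X \<O> U (Tgt f)) (\<lambda>V. Fun f (V \<inter> U)))\<rparr>"


section \<open>Closed subspaces\<close>

text \<open>
  Inverse image along the inclusion of a subspace \<open>C\<close>. A section of \<open>i\<^sup>* P\<close> over \<open>V\<close> open in \<open>C\<close> is a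
  function assigning to each point of \<open>V\<close> a germ of \<open>P\<close> at that point, given locally by sections
  of \<open>P\<close> over open subsets of \<open>X\<close>. Below, \<open>S\<close> and \<open>res\<close> are the sections and restrictions of \<open>P\<close>.
\<close>

type_synonym ('p, 's) germ_fun = "'p \<Rightarrow> ('p set \<times> 's) set"

definition germ ::
  "'p topology \<Rightarrow> ('p set \<Rightarrow> 's set) \<Rightarrow> ('p set \<Rightarrow> 'p set \<Rightarrow> 's \<Rightarrow> 's) \<Rightarrow> 'p \<Rightarrow> 'p set \<Rightarrow> 's \<Rightarrow>
    ('p set \<times> 's) set" where
  "germ X S res x W s =
     {(V, t). openin X V \<and> x \<in> V \<and> t \<in> S V \<and>
        (\<exists>T. openin X T \<and> x \<in> T \<and> T \<subseteq> V \<inter> W \<and> res V T t = res W T s)}"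

definition inv_sections ::
  "'p topology \<Rightarrow> ('p set \<Rightarrow> 's set) \<Rightarrow> ('p set \<Rightarrow> 'p set \<Rightarrow> 's \<Rightarrow> 's) \<Rightarrow> 'p set \<Rightarrow>
    ('p, 's) germ_fun set" where
  "inv_sections X S res V =
     {\<xi> \<in> extensional V. \<forall>x \<in> V. \<exists>W s. openin X W \<and> x \<in> W \<and> s \<in> S W \<and>
        (\<forall>y \<in> W \<inter> V. \<xi> y = germ X S res y W s)}"

text \<open>
  The operation on germs at \<open>x\<close> induced by the operations \<open>op V\<close> on sections over \<open>V\<close>: all members
  of the union coincide, namely with the germ of \<open>op\<close> applied to representatives.
\<close>

definition germ_op ::
  "'p topology \<Rightarrow> ('p set \<Rightarrow> 's set) \<Rightarrow> ('p set \<Rightarrow> 'p set \<Rightarrow> 'q \<Rightarrow> 'q) \<Rightarrow>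
    ('p set \<Rightarrow> 'p set \<Rightarrow> 's \<Rightarrow> 's) \<Rightarrow> ('p set \<Rightarrow> 'q \<Rightarrow> 's \<Rightarrow> 's) \<Rightarrow> 'p \<Rightarrow>
    ('p set \<times> 'q) set \<Rightarrow> ('p set \<times> 's) set \<Rightarrow> ('p set \<times> 's) set" where
  "germ_op X S res' res op x A B =
     (\<Union>(V, a) \<in> A. \<Union>(W, s) \<in> B.
        germ X S res x (V \<inter> W) (op (V \<inter> W) (res' V (V \<inter> W) a) (res W (V \<inter> W) s)))"

abbreviation rgerm :: "'p topology \<Rightarrow> ('p, 'r) ring_psh \<Rightarrow> 'p \<Rightarrow> 'p set \<Rightarrow> 'r \<Rightarrow> ('p set \<times> 'r) set" where
  "rgerm X \<O> \<equiv> germ X (\<lambda>V. carrier (RSec \<O> V)) (RRes \<O>)"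

abbreviation mgerm ::
  "'p topology \<Rightarrow> ('p, 'r, 'm) mod_psh \<Rightarrow> 'p \<Rightarrow> 'p set \<Rightarrow> 'm \<Rightarrow> ('p set \<times> 'm) set" where
  "mgerm X M \<equiv> germ X (\<lambda>V. carrier (MSec M V)) (MRes M)"

text \<open>\<open>i\<^sup>* \<O>\<close>. The subspace \<open>C\<close> enters only through the sets on which this is evaluated.\<close>

definition i_pull_ring :: "'p topology \<Rightarrow> ('p, 'r) ring_psh \<Rightarrow> ('p, ('p, 'r) germ_fun) ring_psh" where
  "i_pull_ring X \<O> =
     (let S = (\<lambda>V. carrier (RSec \<O> V)); X' = topspace X in
     \<lparr>RSec = (\<lambda>V.
        \<lparr>carrier = inv_sections X S (RRes \<O>) V,
         monoid.mult = (\<lambda>\<xi> \<eta>. \<lambda>x\<in>V.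
           germ_op X S (RRes \<O>) (RRes \<O>) (\<lambda>W. monoid.mult (RSec \<O> W)) x (\<xi> x) (\<eta> x)),
         one = (\<lambda>x\<in>V. rgerm X \<O> x X' \<one>\<^bsub>RSec \<O> X'\<^esub>),
         zero = (\<lambda>x\<in>V. rgerm X \<O> x X' \<zero>\<^bsub>RSec \<O> X'\<^esub>),
         add = (\<lambda>\<xi> \<eta>. \<lambda>x\<in>V.
           germ_op X S (RRes \<O>) (RRes \<O>) (\<lambda>W. add (RSec \<O> W)) x (\<xi> x) (\<eta> x))\<rparr>),
      RRes = (\<lambda>W V \<xi>. restrict \<xi> V)\<rparr>)"

definition i_pull_obj ::
  "'p topology \<Rightarrow> ('p, 'r) ring_psh \<Rightarrow> ('p, 'r, 'm) mod_psh \<Rightarrow>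
    ('p, ('p, 'r) germ_fun, ('p, 'm) germ_fun) mod_psh" where
  "i_pull_obj X \<O> M =
     (let S = (\<lambda>V. carrier (MSec M V)); X' = topspace X in
     \<lparr>MSec = (\<lambda>V.
        \<lparr>carrier = inv_sections X S (MRes M) V,
         monoid.mult = undefined,
         one = undefined,
         zero = (\<lambda>x\<in>V. mgerm X M x X' \<zero>\<^bsub>MSec M X'\<^esub>),
         add = (\<lambda>\<xi> \<eta>. \<lambda>x\<in>V.
           germ_op X S (MRes M) (MRes M) (\<lambda>W. add (MSec M W)) x (\<xi> x) (\<eta> x)),
         smult = (\<lambda>\<xi> \<eta>. \<lambda>x\<in>V.
           germ_op X S (RRes \<O>) (MRes M) (\<lambda>W. smult (MSec M W)) x (\<xi> x) (\<eta> x))\<rparr>),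
      MRes = (\<lambda>W V \<xi>. restrict \<xi> V)\<rparr>)"

definition i_pull_map ::
  "'p topology \<Rightarrow> ('p, 'r, 'm) shmod_arrow \<Rightarrow> 'p set \<Rightarrow> ('p, 'm) germ_fun \<Rightarrow> ('p, 'm) germ_fun" where
  "i_pull_map X f V \<xi> = (\<lambda>x\<in>V. \<Union>(W, s) \<in> \<xi> x. mgerm X (Tgt f) x W (Fun f W s))"

text \<open>
  The sections of \<open>i\<^sup>* M\<close> have another type than those of \<open>M\<close>. So \<open>i\<^sup>*\<close> takes values in the
  category of \<open>\<O>\<^sub>C\<close>-modules with sections in \<open>'m\<close> only up to isomorphism: the following says that
  the complex \<open>N\<close> in that category is isomorphic to \<open>i\<^sup>* K\<close>.
\<close>

definition represents_i_pull ::
  "'p topology \<Rightarrow> 'p set \<Rightarrow> ('p, 'r) ring_psh \<Rightarrow>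
    (('p, 'r, 'm) mod_psh, ('p, 'r, 'm) shmod_arrow) cplx \<Rightarrow>
    (('p, ('p, 'r) germ_fun, 'm) mod_psh, ('p, ('p, 'r) germ_fun, 'm) shmod_arrow) cplx \<Rightarrow> bool" where
  "represents_i_pull X C \<O> K N \<longleftrightarrow>
     (\<exists>\<theta>. (\<forall>n. shmod_hom (subtopology X C) (i_pull_ring X \<O>) (i_pull_obj X \<O> (Cob K n)) (Cob N n) (\<theta> n)) \<and>
          (\<forall>n V. openin (subtopology X C) V \<longrightarrow>
             bij_betw (\<theta> n V) (carrier (MSec (i_pull_obj X \<O> (Cob K n)) V)) (carrier (MSec (Cob N n) V)) \<and>
             (\<forall>\<xi> \<in> carrier (MSec (i_pull_obj X \<O> (Cob K n)) V).
                \<theta> (n + 1) V (i_pull_map X (Cdf K n) V \<xi>) = Fun (Cdf N n) V (\<theta> n V \<xi>))))"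

definition i_pull_induces_Dplus ::
  "'p topology \<Rightarrow> 'p set \<Rightarrow> ('p, 'r) ring_psh \<Rightarrow> ('p, 'r, 'm) mod_psh set \<Rightarrow>
    ('p, ('p, 'r) germ_fun, 'm) mod_psh set \<Rightarrow> bool" where
  "i_pull_induces_Dplus X C \<O> AX AC \<longleftrightarrow>
     (\<forall>K. in_Dplus (ShMod X \<O>) AX K \<longrightarrow>
        (\<exists>N. represents_i_pull X C \<O> K N \<and>
             in_Dplus (ShMod (subtopology X C) (i_pull_ring X \<O>)) AC N))"

text \<open>The ring \<open>\<O>(V)\<close> acts on \<open>(i\<^sub>* N)(V) = N(V \<inter> C)\<close> through \<open>\<O>(V) \<rightarrow> (i\<^sup>* \<O>)(V \<inter> C)\<close>.\<close>

definition i_push_obj ::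
  "'p topology \<Rightarrow> ('p, 'r) ring_psh \<Rightarrow> 'p set \<Rightarrow> ('p, ('p, 'r) germ_fun, 'm) mod_psh \<Rightarrow>
    ('p, 'r, 'm) mod_psh" where
  "i_push_obj X \<O> C N =
     \<lparr>MSec = (\<lambda>V. let N' = MSec N (V \<inter> C) in
        \<lparr>carrier = carrier N', monoid.mult = monoid.mult N', one = one N', zero = zero N', add = add N',
         smult = (\<lambda>b s. (\<lambda>x\<in>V \<inter> C. rgerm X \<O> x V b) \<odot>\<^bsub>N'\<^esub> s)\<rparr>),
      MRes = (\<lambda>W V. MRes N (W \<inter> C) (V \<inter> C))\<rparr>"

definition i_push ::
  "'p topology \<Rightarrow> ('p, 'r) ring_psh \<Rightarrow> 'p set \<Rightarrow>
    (('p, ('p, 'r) germ_fun, 'm) mod_psh, ('p, ('p, 'r) germ_fun, 'm) shmod_arrow,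
     ('p, 'r, 'm) mod_psh, ('p, 'r, 'm) shmod_arrow) functr" where
  "i_push X \<O> C =
     \<lparr>OMap = i_push_obj X \<O> C,
      AMap = (\<lambda>f. mk_arrow X (i_push_obj X \<O> C (Src f)) (i_push_obj X \<O> C (Tgt f)) (\<lambda>V. Fun f (V \<inter> C)))\<rparr>"

text \<open>
  \<open>i\<^sup>! M\<close> is the sheaf of sections of \<open>M\<close> with support in \<open>C\<close>: for \<open>W\<close> open in \<open>C\<close>, its sections
  over \<open>W\<close> are the sections of \<open>M\<close> over the open set \<open>W \<union> U\<close> (\<open>U\<close> the complement of \<open>C\<close>) that
  vanish on \<open>U\<close>. A section \<open>\<xi>\<close> of \<open>i\<^sup>* \<O>\<close> acts locally as any section of \<open>\<O>\<close> that represents it.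
\<close>

definition i_upper_obj ::
  "'p topology \<Rightarrow> ('p, 'r) ring_psh \<Rightarrow> 'p set \<Rightarrow> ('p, 'r, 'm) mod_psh \<Rightarrow>
    ('p, ('p, 'r) germ_fun, 'm) mod_psh" where
  "i_upper_obj X \<O> C M =
     (let U = topspace X - C;
          S = (\<lambda>W. {s \<in> carrier (MSec M (W \<union> U)). MRes M (W \<union> U) U s = \<zero>\<^bsub>MSec M U\<^esub>}) in
     \<lparr>MSec = (\<lambda>W. let M' = MSec M (W \<union> U) in
        \<lparr>carrier = S W, monoid.mult = monoid.mult M', one = one M', zero = zero M', add = add M',
         smult = (\<lambda>\<xi> s. THE t. t \<in> S W \<and>
           (\<forall>x \<in> W. \<exists>V b. openin X V \<and> x \<in> V \<and> V \<subseteq> W \<union> U \<and> b \<in> carrier (RSec \<O> V) \<and>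
              (\<forall>y \<in> V \<inter> W. \<xi> y = rgerm X \<O> y V b) \<and>
              MRes M (W \<union> U) V t = b \<odot>\<^bsub>MSec M V\<^esub> MRes M (W \<union> U) V s))\<rparr>),
      MRes = (\<lambda>W V. MRes M (W \<union> U) (V \<union> U))\<rparr>)"

definition i_upper ::
  "'p topology \<Rightarrow> ('p, 'r) ring_psh \<Rightarrow> 'p set \<Rightarrow>
    (('p, 'r, 'm) mod_psh, ('p, 'r, 'm) shmod_arrow,
     ('p, ('p, 'r) germ_fun, 'm) mod_psh, ('p, ('p, 'r) germ_fun, 'm) shmod_arrow) functr" where
  "i_upper X \<O> C =
     \<lparr>OMap = i_upper_obj X \<O> C,
      AMap = (\<lambda>f. mk_arrow (subtopology X C) (i_upper_obj X \<O> C (Src f)) (i_upper_obj X \<O> C (Tgt f))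
                (\<lambda>W. Fun f (W \<union> (topspace X - C))))\<rparr>"


section \<open>The setting\<close>

locale stratified_ringed_space =
  fixes X :: "'p topology" and C U :: "'p set" and \<O> :: "('p, 'r) ring_psh"
  assumes closed: "closedin X C"
    and complement: "U = topspace X - C"
    and dense: "X closure_of U = topspace X"
    and structure_sheaf: "sheaf_of_rings X \<O>"

text \<open>
  \<open>BX\<close>, \<open>BU\<close>, \<open>BC\<close> are abelian for sheaves in a universe; here this is where the type \<open>'m\<close> of
  sections is required to be large enough. The functors \<open>i\<^sub>*\<close>, \<open>i\<^sup>*\<close>, \<open>j\<^sub>!\<close>, \<open>j\<^sup>*\<close> are exact, and
  \<open>\<D>\<^sub>*\<close> is a full subcategory of the derived category, so that they and \<open>\<^bold>R i\<^sup>!\<close>, \<open>\<^bold>R j\<^sub>*\<close> induce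
  functors between the \<open>\<D>\<^sub>*\<close> as soon as they map objects to objects.
\<close>

locale gluing_setting = stratified_ringed_space X C U \<O>
  for X :: "'p topology" and C U :: "'p set" and \<O> :: "('p, 'r) ring_psh" +
  fixes BX BU :: "(('p, 'r, 'm) mod_psh, ('p, 'r, 'm) shmod_arrow) add_cat"
    and BC :: "(('p, ('p, 'r) germ_fun, 'm) mod_psh, ('p, ('p, 'r) germ_fun, 'm) shmod_arrow) add_cat"
    and AX AU :: "('p, 'r, 'm) mod_psh set"
    and AC :: "('p, ('p, 'r) germ_fun, 'm) mod_psh set"
  assumes BX: "BX = ShMod X \<O>"
    and BU: "BU = ShMod (subtopology X U) \<O>"
    and BC: "BC = ShMod (subtopology X C) (i_pull_ring X \<O>)"
    and abelian_BX: "abelian_category BX"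
    and abelian_BU: "abelian_category BU"
    and abelian_BC: "abelian_category BC"
    and AX: "stable_abelian_subcat BX AX"
    and AU: "stable_abelian_subcat BU AU"
    and AC: "stable_abelian_subcat BC AC"
    and i_push: "induces_Dplus BC AC BX AX (i_push X \<O> C)"
    and i_pull: "i_pull_induces_Dplus X C \<O> AX AC"
    and i_upper: "derived_induces_Dplus BX AX BC AC (i_upper X \<O> C)"
    and j_push: "derived_induces_Dplus BU AU BX AX (j_push X \<O> U)"
    and j_ext: "induces_Dplus BU AU BX AX (j_ext X \<O> U)"
    and j_pull: "induces_Dplus BX AX BU AU (j_pull X U)"

locale resolving_setting = gluing_setting X C U \<O> BX BU BC AX AU AC
  for X :: "'p topology" and C U :: "'p set" and \<O> :: "('p, 'r) ring_psh"
    and BX BU :: "(('p, 'r, 'm) mod_psh, ('p, 'r, 'm) shmod_arrow) add_cat"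
    and BC :: "(('p, ('p, 'r) germ_fun, 'm) mod_psh, ('p, ('p, 'r) germ_fun, 'm) shmod_arrow) add_cat"
    and AX AU :: "('p, 'r, 'm) mod_psh set"
    and AC :: "('p, ('p, 'r) germ_fun, 'm) mod_psh set" +
  fixes A' :: "('o, 'a) add_cat"
    and G :: "(('p, 'r, 'm) mod_psh, ('p, 'r, 'm) shmod_arrow, 'o, 'a) functr"
    and F :: "('o, 'a, ('p, 'r, 'm) mod_psh, ('p, 'r, 'm) shmod_arrow) functr"
    and \<alpha> :: "('p, 'r, 'm) mod_psh \<Rightarrow> ('p, 'r, 'm) shmod_arrow"
    and \<beta> :: "'o \<Rightarrow> 'a"
    and \<F> \<Q> :: "('p, 'r, 'm) shmod_functr"
    and q :: "('p, 'r, 'm) mod_psh \<Rightarrow> ('p, 'r, 'm) shmod_arrow"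
  assumes abelian_A': "abelian_category A'"
    and adjoint: "adjunction BU A' G F \<alpha> \<beta>"
    and G_exact: "exact_functor BU A' G"
    and F_left_exact: "left_exact A' BU F"
    and \<alpha>_injective: "\<forall>M \<in> Obj BU. is_mono BU (\<alpha> M)"
    and \<F>: "\<F> = comp_functor F G"
    and \<Q>_functor: "is_functor BU BU \<Q>"
    and q_natural: "nat_trans BU BU \<F> \<Q> q"
    and q_cokernel: "\<forall>M \<in> Obj BU. is_cokernel BU (\<alpha> M) (q M)"
    and \<F>_AU: "\<forall>A \<in> AU. OMap \<F> A \<in> AU"
    and \<F>_exact: "exact_functor (full_subcat BU AU) (full_subcat BU AU) \<F>"
    and j_push_\<F>_acyclic: "\<forall>A \<in> AU. acyclic_for BU BX (j_push X \<O> U) (OMap \<F> A)"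
    and j_push_\<F>_derived: "\<forall>A \<in> AU. equals_derived_at BU BX (comp_functor (j_push X \<O> U) \<F>) A"


section \<open>The category of gluing data and the functor to complexes\<close>

text \<open>\<open>g\<^sup>m : \<F> \<Q>\<^sup>m L \<rightarrow> \<F> \<Q>\<^bsup>m+1\<^esup> L\<close>\<close>

definition gdiff ::
  "('o, 'a, 'z) cat_scheme \<Rightarrow> ('o, 'a, 'o, 'a) functr \<Rightarrow> ('o \<Rightarrow> 'a) \<Rightarrow> ('o \<Rightarrow> 'a) \<Rightarrow> nat \<Rightarrow> 'o \<Rightarrow> 'a" where
  "gdiff B \<Q> \<alpha> q m L = Comp B (\<alpha> (OMap (pow_functor \<Q> (m + 1)) L)) (q (OMap (pow_functor \<Q> m) L))"

text \<open>\<open>\<F> \<Q>\<^sup>m\<close> followed by \<open>j\<^sub>*\<close>\<close>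

definition jFQ ::
  "'p topology \<Rightarrow> ('p, 'r) ring_psh \<Rightarrow> 'p set \<Rightarrow>
    ('p, 'r, 'm) shmod_functr \<Rightarrow>
    ('p, 'r, 'm) shmod_functr \<Rightarrow>
    nat \<Rightarrow>
    ('p, 'r, 'm) shmod_functr" where
  "jFQ X \<O> U \<F> \<Q> m = comp_functor (j_push X \<O> U) (comp_functor \<F> (pow_functor \<Q> m))"

record ('o, 'a) gdata =
  GL :: 'o
  GF :: 'o
  Gu :: 'a
  Gs :: 'a

definition is_gdata ::
  "'p topology \<Rightarrow> ('p, 'r) ring_psh \<Rightarrow> 'p set \<Rightarrow> ('p, 'r, 'm) mod_psh set \<Rightarrow> ('p, 'r, 'm) mod_psh set \<Rightarrow>
    ('p, 'r, 'm) shmod_functr \<Rightarrow>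
    ('p, 'r, 'm) shmod_functr \<Rightarrow>
    (('p, 'r, 'm) mod_psh \<Rightarrow> ('p, 'r, 'm) shmod_arrow) \<Rightarrow>
    (('p, 'r, 'm) mod_psh \<Rightarrow> ('p, 'r, 'm) shmod_arrow) \<Rightarrow> nat \<Rightarrow>
    (('p, 'r, 'm) mod_psh, ('p, 'r, 'm) shmod_arrow) gdata \<Rightarrow> bool" where
  "is_gdata X \<O> U AX AU \<F> \<Q> \<alpha> q d z \<longleftrightarrow>
     (let BX = ShMod X \<O>; BU = ShMod (subtopology X U) \<O>;
          L = GL z; u = Gu z; \<sigma> = Gs z;
          E = OMap (pow_functor \<Q> (d - 1)) L in
      L \<in> AU \<and> GF z \<in> AX \<and>
      u \<in> Hom BX (OMap (jFQ X \<O> U \<F> \<Q> (d - 1)) L) (GF z) \<and>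
      \<sigma> \<in> Hom BU (OMap (pow_functor \<Q> d) L) (OMap (j_pull X U) (GF z)) \<and> is_iso BU \<sigma> \<and>
      (2 \<le> d \<longrightarrow>
         Comp BX u (AMap (j_push X \<O> U) (gdiff BU \<Q> \<alpha> q (d - 2) L))
           = Zer BX (OMap (jFQ X \<O> U \<F> \<Q> (d - 2)) L) (GF z)) \<and>
      Comp BU (Comp BU \<sigma> (q E)) (j_counit X \<O> U (OMap \<F> E)) = AMap (j_pull X U) u)"

definition glue_cat ::
  "'p topology \<Rightarrow> ('p, 'r) ring_psh \<Rightarrow> 'p set \<Rightarrow> ('p, 'r, 'm) mod_psh set \<Rightarrow> ('p, 'r, 'm) mod_psh set \<Rightarrow>
    ('p, 'r, 'm) shmod_functr \<Rightarrow>
    ('p, 'r, 'm) shmod_functr \<Rightarrow>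
    (('p, 'r, 'm) mod_psh \<Rightarrow> ('p, 'r, 'm) shmod_arrow) \<Rightarrow>
    (('p, 'r, 'm) mod_psh \<Rightarrow> ('p, 'r, 'm) shmod_arrow) \<Rightarrow> nat \<Rightarrow>
    ((('p, 'r, 'm) mod_psh, ('p, 'r, 'm) shmod_arrow) gdata,
     ((('p, 'r, 'm) mod_psh, ('p, 'r, 'm) shmod_arrow) gdata,
      ('p, 'r, 'm) shmod_arrow \<times> ('p, 'r, 'm) shmod_arrow) arrow) cat" where
  "glue_cat X \<O> U AX AU \<F> \<Q> \<alpha> q d =
     (let BX = ShMod X \<O>; BU = ShMod (subtopology X U) \<O>; Ob = Collect (is_gdata X \<O> U AX AU \<F> \<Q> \<alpha> q d) in
     \<lparr>Obj = Ob,
      Arr = {\<lparr>Src = z, Tgt = z', Fun = (f, g)\<rparr> | z z' f g.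
               z \<in> Ob \<and> z' \<in> Ob \<and> f \<in> Hom BU (GL z) (GL z') \<and> g \<in> Hom BX (GF z) (GF z') \<and>
               Comp BX (Gu z') (AMap (jFQ X \<O> U \<F> \<Q> (d - 1)) f) = Comp BX g (Gu z)},
      Dom = Src,
      Cod = Tgt,
      Ident = (\<lambda>z. \<lparr>Src = z, Tgt = z, Fun = (Ident BU (GL z), Ident BX (GF z))\<rparr>),
      Comp = (\<lambda>h k. \<lparr>Src = Src k, Tgt = Tgt h,
                     Fun = (Comp BU (fst (Fun h)) (fst (Fun k)), Comp BX (snd (Fun h)) (snd (Fun k)))\<rparr>)\<rparr>)"

definition B_obj ::
  "'p topology \<Rightarrow> ('p, 'r) ring_psh \<Rightarrow> 'p set \<Rightarrow>
    ('p, 'r, 'm) shmod_functr \<Rightarrow>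
    ('p, 'r, 'm) shmod_functr \<Rightarrow>
    (('p, 'r, 'm) mod_psh \<Rightarrow> ('p, 'r, 'm) shmod_arrow) \<Rightarrow>
    (('p, 'r, 'm) mod_psh \<Rightarrow> ('p, 'r, 'm) shmod_arrow) \<Rightarrow> nat \<Rightarrow>
    (('p, 'r, 'm) mod_psh, ('p, 'r, 'm) shmod_arrow) gdata \<Rightarrow>
    (('p, 'r, 'm) mod_psh, ('p, 'r, 'm) shmod_arrow) cplx" where
  "B_obj X \<O> U \<F> \<Q> \<alpha> q d z =
     (let BX = ShMod X \<O>; BU = ShMod (subtopology X U) \<O>;
          K = (\<lambda>n::int. if 0 \<le> n \<and> n < int d then OMap (jFQ X \<O> U \<F> \<Q> (nat n)) (GL z)
                        else if n = int d then GF z else zero_obj BX) in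
      \<lparr>Cob = K,
       Cdf = (\<lambda>n. if 0 \<le> n \<and> n < int d - 1 then AMap (j_push X \<O> U) (gdiff BU \<Q> \<alpha> q (nat n) (GL z))
                  else if n = int d - 1 then Gu z else Zer BX (K n) (K (n + 1)))\<rparr>)"

definition B_functor ::
  "'p topology \<Rightarrow> ('p, 'r) ring_psh \<Rightarrow> 'p set \<Rightarrow>
    ('p, 'r, 'm) shmod_functr \<Rightarrow>
    ('p, 'r, 'm) shmod_functr \<Rightarrow>
    (('p, 'r, 'm) mod_psh \<Rightarrow> ('p, 'r, 'm) shmod_arrow) \<Rightarrow>
    (('p, 'r, 'm) mod_psh \<Rightarrow> ('p, 'r, 'm) shmod_arrow) \<Rightarrow> nat \<Rightarrow>
    ((('p, 'r, 'm) mod_psh, ('p, 'r, 'm) shmod_arrow) gdata,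
     ((('p, 'r, 'm) mod_psh, ('p, 'r, 'm) shmod_arrow) gdata,
      ('p, 'r, 'm) shmod_arrow \<times> ('p, 'r, 'm) shmod_arrow) arrow,
     (('p, 'r, 'm) mod_psh, ('p, 'r, 'm) shmod_arrow) cplx,
     ((('p, 'r, 'm) mod_psh, ('p, 'r, 'm) shmod_arrow) cplx, (int \<Rightarrow> ('p, 'r, 'm) shmod_arrow) set) arrow)
     functr" where
  "B_functor X \<O> U \<F> \<Q> \<alpha> q d =
     (let BX = ShMod X \<O>; B = B_obj X \<O> U \<F> \<Q> \<alpha> q d in
     \<lparr>OMap = B,
      AMap = (\<lambda>h. htpy_class BX (B (Src h)) (B (Tgt h))
        (\<lambda>n. if 0 \<le> n \<and> n < int d then AMap (jFQ X \<O> U \<F> \<Q> (nat n)) (fst (Fun h))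
             else if n = int d then snd (Fun h) else Zer BX (zero_obj BX) (zero_obj BX)))\<rparr>)"

end

theory Submission
  imports Defs
begin

text \<open>
  The complex of a gluing datum \<open>(L, P, u, \<sigma>)\<close> is a coresolution relative to the functor \<open>\<F>\<close>. Over \<open>U\<close> it is spliced from the exact
  sequences \<open>0 \<rightarrow> \<Q>\<^sup>n L \<rightarrow> \<F> \<Q>\<^sup>n L \<rightarrow> \<Q>\<^bsup>n+1\<^esup> L \<rightarrow> 0\<close> (\<open>0 \<le> n < d\<close>), the last term \<open>\<Q>\<^sup>d L\<close> being identified with
  \<open>j\<^sup>* P\<close> by \<open>\<sigma>\<close>. An object \<open>\<F> M = F G M\<close> is injective relative to these sequences: a morphism
  \<open>\<kappa> : A \<rightarrow> \<F> M\<close> extends along \<open>\<alpha> : A \<rightarrow> \<F> A\<close> by means of the counit (lemma \<open>F_extend\<close>). So the comparison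
  theorem of relative homological algebra applies, provided that the argument can be carried out on
  \<open>X\<close>, where the direct image of a short exact sequence need not be exact.
  
  It can, because only morphisms into objects \<open>j\<^sub>* \<F> M\<close> matter, and these are the morphisms on \<open>U\<close> into
  \<open>\<F> M\<close>, by the adjunction between \<open>j\<^sup>*\<close> and \<open>j\<^sub>*\<close>. Hence \<open>Hom(-, j\<^sub>* \<F> M)\<close> makes a short exact sequence out of
  \<open>j\<^sub>* \<Q>\<^sup>n L \<rightarrow> j\<^sub>* \<F> \<Q>\<^sup>n L \<rightarrow> j\<^sub>* \<Q>\<^bsup>n+1\<^esup> L\<close>, and also out of the last stage
  \<open>j\<^sub>* \<Q>\<^bsup>d-1\<^esup> L \<rightarrow> j\<^sub>* \<F> \<Q>\<^bsup>d-1\<^esup> L \<rightarrow> P\<close>, whose second morphism is \<open>u\<close> (lemma \<open>push_hom_exact\<close>). This is all that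
  the comparison uses, and the rest is an argument in a preadditive category.
  
  Fullness. A chain map \<open>\<psi>\<close> carries \<open>L\<close>, the kernel of the first differential over \<open>U\<close>, to \<open>L'\<close>, and so
  gives \<open>f : L \<rightarrow> L'\<close> (lemma \<open>chain_map_induces_arrow\<close>). The morphisms \<open>j\<^sub>* \<F> \<Q>\<^sup>n f\<close> agree with \<open>\<psi>\<close> on \<open>j\<^sub>* L\<close>, hence
  differ from \<open>\<psi>\<close> by a homotopy in the degrees below \<open>d\<close>, and in degree \<open>d\<close> the component \<open>g\<close> is obtained by
  correcting \<open>\<psi>\<^sup>d\<close> with this homotopy (lemma \<open>chain_map_extension\<close>).
  
  Faithfulness. Homotopic chain maps agree on \<open>j\<^sub>* L\<close>, whence \<open>f = f'\<close>, as \<open>\<alpha>\<close> is injective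
  (lemma \<open>homotopic_agree\<close>). A homotopy between chain maps that agree below degree \<open>d\<close> is, up to sign, a chain
  map from the truncated complex \<open>K\<^bsup>\<ge>1\<^esup>\<close> to the shifted target. By the same comparison it is null-homotopic,
  so that the last component of the homotopy factors through the differential before \<open>u'\<close> and is killed by
  \<open>u'\<close> (lemma \<open>homotopic_rigid\<close>). So \<open>g = g'\<close>.
  
  The functor takes values in complexes with cohomology in \<open>AX\<close> because \<open>j\<^sub>* \<F> A\<close> is the cohomology in degree
  zero of the derived direct image of \<open>\<F> A\<close>, hence lies in \<open>AX\<close> (lemma \<open>derived_degree_zero\<close>).
  
  Below, \<open>N\<close> stands for \<open>d - 1\<close>.
\<close>

section \<open>Preadditive categories and the homotopy category\<close>

locale preadditive_category =
  fixes C :: "('o, 'a, 'z) add_cat_scheme"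
  assumes preadditive: "preadditive C"
begin

abbreviation comp (infixr "\<cdot>" 70) where "g \<cdot> f \<equiv> Comp C g f"
abbreviation plus (infixl "\<boxplus>" 65) where "f \<boxplus> g \<equiv> Add C f g"

lemma category: "category C"
  using preadditive by (simp add: preadditive_def)

lemma HomD: "f \<in> Hom C x y \<Longrightarrow> f \<in> Arr C \<and> Dom C f = x \<and> Cod C f = y \<and> x \<in> Obj C \<and> y \<in> Obj C"
  using category by (auto simp: category_def Hom_def)

lemma Arr_Hom: "f \<in> Arr C \<Longrightarrow> f \<in> Hom C (Dom C f) (Cod C f)"
  by (simp add: Hom_def)

lemma Ident_Hom [simp]: "x \<in> Obj C \<Longrightarrow> Ident C x \<in> Hom C x x"
  using category by (simp add: category_def)

lemma comp_Hom: "f \<in> Hom C x y \<Longrightarrow> g \<in> Hom C y z \<Longrightarrow> g \<cdot> f \<in> Hom C x z"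
  using category unfolding category_def by blast

lemma comp_id: "f \<in> Hom C x y \<Longrightarrow> f \<cdot> Ident C x = f"
  using category unfolding category_def by blast

lemma id_comp: "f \<in> Hom C x y \<Longrightarrow> Ident C y \<cdot> f = f"
  using category unfolding category_def by blast

lemma comp_assoc:
  assumes "f \<in> Hom C w x" "g \<in> Hom C x y" "h \<in> Hom C y z"
  shows "(h \<cdot> g) \<cdot> f = h \<cdot> (g \<cdot> f)"
  using assms category unfolding category_def by metis

lemma hom_group:
  assumes "x \<in> Obj C" "y \<in> Obj C"
  shows "comm_group \<lparr>carrier = Hom C x y, monoid.mult = Add C, one = Zer C x y\<rparr>"
  using preadditive assms by (simp add: preadditive_def)

lemma zero_Hom [simp]: "x \<in> Obj C \<Longrightarrow> y \<in> Obj C \<Longrightarrow> Zer C x y \<in> Hom C x y"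
  using monoid.one_closed[OF comm_monoid.axioms(1)[OF comm_group.axioms(1)[OF hom_group]]] by simp

lemma add_Hom: "f \<in> Hom C x y \<Longrightarrow> g \<in> Hom C x y \<Longrightarrow> f \<boxplus> g \<in> Hom C x y"
  using monoid.m_closed[OF comm_monoid.axioms(1)[OF comm_group.axioms(1)[OF hom_group]], of x y f g] HomD
  by fastforce

lemma add_assoc:
  assumes "f \<in> Hom C x y" "g \<in> Hom C x y" "h \<in> Hom C x y"
  shows "(f \<boxplus> g) \<boxplus> h = f \<boxplus> (g \<boxplus> h)"
  using monoid.m_assoc[OF comm_monoid.axioms(1)[OF comm_group.axioms(1)[OF hom_group]], of x y f g h]
    HomD assms by fastforce

lemma add_commute:
  assumes "f \<in> Hom C x y" "g \<in> Hom C x y"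
  shows "f \<boxplus> g = g \<boxplus> f"
  using comm_monoid.m_comm[OF comm_group.axioms(1)[OF hom_group], of x y f g] HomD assms by fastforce

lemma zero_add: "f \<in> Hom C x y \<Longrightarrow> Zer C x y \<boxplus> f = f"
  using monoid.l_one[OF comm_monoid.axioms(1)[OF comm_group.axioms(1)[OF hom_group]], of x y f] HomD
  by fastforce

lemma add_zero: "f \<in> Hom C x y \<Longrightarrow> f \<boxplus> Zer C x y = f"
  by (metis zero_add add_commute zero_Hom HomD)

lemma ex_negative: 
  assumes "f \<in> Hom C x y"
  shows "\<exists>g \<in> Hom C x y. f \<boxplus> g = Zer C x y"
proof -
  let ?G = "\<lparr>carrier = Hom C x y, monoid.mult = Add C, one = Zer C x y\<rparr>"
  have "group ?G" using hom_group HomD[OF assms] comm_group.axioms(2) by blast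
  then have "inv\<^bsub>?G\<^esub> f \<in> carrier ?G \<and> f \<otimes>\<^bsub>?G\<^esub> inv\<^bsub>?G\<^esub> f = \<one>\<^bsub>?G\<^esub>"
    using assms group.inv_closed group.r_inv by fastforce
  then show ?thesis by auto
qed

text \<open>
  The record of a preadditive category carries no negatives, so they are chosen in the groups of arrows.
\<close>

definition neg :: "'a \<Rightarrow> 'a" ("\<boxminus> _" [71] 70)
  where "\<boxminus> f = (SOME g. g \<in> Hom C (Dom C f) (Cod C f) \<and> f \<boxplus> g = Zer C (Dom C f) (Cod C f))"

lemma neg: assumes "f \<in> Hom C x y"
  shows neg_Hom: "\<boxminus> f \<in> Hom C x y" and add_neg: "f \<boxplus> \<boxminus> f = Zer C x y"
    and neg_add: "\<boxminus> f \<boxplus> f = Zer C x y"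
proof -
  have "\<boxminus> f \<in> Hom C x y \<and> f \<boxplus> \<boxminus> f = Zer C x y"
    using someI_ex[of "\<lambda>g. g \<in> Hom C x y \<and> f \<boxplus> g = Zer C x y"] ex_negative[OF assms] HomD[OF assms]
    by (auto simp: neg_def)
  then show "\<boxminus> f \<in> Hom C x y" "f \<boxplus> \<boxminus> f = Zer C x y" "\<boxminus> f \<boxplus> f = Zer C x y"
    using add_commute[OF assms] by metis+
qed

lemma add_left_commute:
  assumes "f \<in> Hom C x y" "g \<in> Hom C x y" "h \<in> Hom C x y"
  shows "f \<boxplus> (g \<boxplus> h) = g \<boxplus> (f \<boxplus> h)"
  using add_assoc[OF assms] add_assoc[OF assms(2,1,3)] add_commute[OF assms(1,2)] by simp

lemma add_add_swap:
  assumes "a \<in> Hom C x y" "b \<in> Hom C x y" "c \<in> Hom C x y" "d \<in> Hom C x y"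
  shows "(a \<boxplus> b) \<boxplus> (c \<boxplus> d) = (a \<boxplus> c) \<boxplus> (b \<boxplus> d)"
  using add_assoc[OF assms(1,2) add_Hom[OF assms(3,4)]] add_assoc[OF assms(1,3) add_Hom[OF assms(2,4)]]
    add_left_commute[OF assms(2,3,4)] by simp

lemma add_left_imp_eq:
  assumes "f \<boxplus> g = f \<boxplus> h" "f \<in> Hom C x y" "g \<in> Hom C x y" "h \<in> Hom C x y"
  shows "g = h"
proof -
  have "\<boxminus> f \<boxplus> (f \<boxplus> k) = k" if "k \<in> Hom C x y" for k
    using add_assoc[OF neg_Hom[OF assms(2)] assms(2) that] neg_add[OF assms(2)] zero_add[OF that] by simp
  then show ?thesis using assms by metis
qed

lemma neg_unique:
  assumes "f \<boxplus> g = Zer C x y" "f \<in> Hom C x y" "g \<in> Hom C x y"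
  shows "g = \<boxminus> f"
  using add_left_imp_eq[of f g "\<boxminus> f" x y] assms add_neg[OF assms(2)] neg_Hom[OF assms(2)] by simp

lemma eq_add_neg:
  assumes "f \<in> Hom C x y" "g \<in> Hom C x y" "h \<in> Hom C x y"
  shows "f \<boxplus> \<boxminus> g = h \<longleftrightarrow> f = g \<boxplus> h"
proof
  note n = neg_Hom[OF assms(2)]
  have "g \<boxplus> (f \<boxplus> \<boxminus> g) = f"
    using add_left_commute[OF assms(2,1) n] add_neg[OF assms(2)] add_zero[OF assms(1)] by simp
  then show "f = g \<boxplus> h" if "f \<boxplus> \<boxminus> g = h" using that by simp
  have "(g \<boxplus> h) \<boxplus> \<boxminus> g = h"
    using add_assoc[OF assms(2,3) n] add_left_commute[OF assms(2,3) n] add_neg[OF assms(2)]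
      add_zero[OF assms(3)] by simp
  then show "f \<boxplus> \<boxminus> g = h" if "f = g \<boxplus> h" using that by simp
qed

lemma comp_add:
  assumes "f \<in> Hom C x y" "f' \<in> Hom C x y" "g \<in> Hom C y z"
  shows "g \<cdot> (f \<boxplus> f') = g \<cdot> f \<boxplus> g \<cdot> f'"
  using assms preadditive unfolding preadditive_def by blast

lemma add_comp:
  assumes "f \<in> Hom C x y" "g \<in> Hom C y z" "g' \<in> Hom C y z"
  shows "(g \<boxplus> g') \<cdot> f = g \<cdot> f \<boxplus> g' \<cdot> f"
  using assms preadditive unfolding preadditive_def by blast

lemma comp_zero:
  assumes "x \<in> Obj C" "g \<in> Hom C y z"
  shows "g \<cdot> Zer C x y = Zer C x z"
proof -
  have o: "Zer C x y \<in> Hom C x y" using assms HomD by auto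
  then have "g \<cdot> Zer C x y \<boxplus> g \<cdot> Zer C x y = g \<cdot> Zer C x y"
    using comp_add[OF o o assms(2)] zero_add[OF o] by simp
  then show ?thesis
    using add_left_imp_eq[of "g \<cdot> Zer C x y" "g \<cdot> Zer C x y" "Zer C x z" x z] comp_Hom[OF o assms(2)]
      add_zero[OF comp_Hom[OF o assms(2)]] HomD[OF comp_Hom[OF o assms(2)]] by simp
qed

lemma zero_comp:
  assumes "f \<in> Hom C x y" "z \<in> Obj C"
  shows "Zer C y z \<cdot> f = Zer C x z"
proof -
  have o: "Zer C y z \<in> Hom C y z" using assms HomD by auto
  then have "Zer C y z \<cdot> f \<boxplus> Zer C y z \<cdot> f = Zer C y z \<cdot> f"
    using add_comp[OF assms(1) o o] zero_add[OF o] by simp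
  then show ?thesis
    using add_left_imp_eq[of "Zer C y z \<cdot> f" "Zer C y z \<cdot> f" "Zer C x z" x z] comp_Hom[OF assms(1) o]
      add_zero[OF comp_Hom[OF assms(1) o]] HomD[OF comp_Hom[OF assms(1) o]] by simp
qed

lemma comp_neg:
  assumes "f \<in> Hom C x y" "g \<in> Hom C y z"
  shows "g \<cdot> \<boxminus> f = \<boxminus> (g \<cdot> f)"
proof (rule neg_unique)
  show "g \<cdot> f \<boxplus> g \<cdot> \<boxminus> f = Zer C x z"
    using comp_add[OF assms(1) neg_Hom[OF assms(1)] assms(2)] add_neg[OF assms(1)]
      comp_zero[OF _ assms(2)] HomD[OF assms(1)] by simp
qed (use assms neg_Hom comp_Hom in blast)+

lemma neg_comp:
  assumes "f \<in> Hom C x y" "g \<in> Hom C y z"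
  shows "(\<boxminus> g) \<cdot> f = \<boxminus> (g \<cdot> f)"
proof (rule neg_unique)
  show "g \<cdot> f \<boxplus> (\<boxminus> g) \<cdot> f = Zer C x z"
    using add_comp[OF assms(1,2) neg_Hom[OF assms(2)]] add_neg[OF assms(2)]
      zero_comp[OF assms(1)] HomD[OF assms(2)] by simp
qed (use assms neg_Hom comp_Hom in blast)+

lemma zero_obj_into:
  assumes "is_zero_obj C z" "f \<in> Hom C x z" shows "f = Zer C x z"
  using assms HomD[OF assms(2)] zero_Hom[of x z] unfolding is_zero_obj_def by blast

lemma zero_obj_from:
  assumes "is_zero_obj C z" "f \<in> Hom C z x" shows "f = Zer C z x"
  using assms HomD[OF assms(2)] zero_Hom[of z x] unfolding is_zero_obj_def by blast

lemma zero_objI: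
  assumes "z \<in> Obj C" "Ident C z = Zer C z z"
  shows "is_zero_obj C z"
proof -
  have "f = Zer C x z" if "f \<in> Hom C x z" for f x
    using id_comp[OF that] zero_comp[OF that assms(1)] assms(2) by simp
  moreover have "f = Zer C z x" if "f \<in> Hom C z x" for f x
    using comp_id[OF that] comp_zero[OF assms(1) that] assms(2) by simp
  ultimately show ?thesis
    unfolding is_zero_obj_def using assms(1) zero_Hom by metis
qed

lemma complexD:
  assumes "is_complex C K"
  shows "Cdf K n \<in> Hom C (Cob K n) (Cob K (n + 1))" "Cob K n \<in> Obj C"
    "Cdf K (n + 1) \<cdot> Cdf K n = Zer C (Cob K n) (Cob K (n + 1 + 1))"
    "Cdf K (n - 1) \<in> Hom C (Cob K (n - 1)) (Cob K n)"
    "Cdf K n \<cdot> Cdf K (n - 1) = Zer C (Cob K (n - 1)) (Cob K (n + 1))"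
proof -
  show "Cdf K n \<in> Hom C (Cob K n) (Cob K (n + 1))" "Cob K n \<in> Obj C"
    "Cdf K (n + 1) \<cdot> Cdf K n = Zer C (Cob K n) (Cob K (n + 1 + 1))" for n
    using assms by (simp_all add: is_complex_def)
  from this(1)[of "n - 1"] this(3)[of "n - 1"]
  show "Cdf K (n - 1) \<in> Hom C (Cob K (n - 1)) (Cob K n)"
    "Cdf K n \<cdot> Cdf K (n - 1) = Zer C (Cob K (n - 1)) (Cob K (n + 1))" by simp_all
qed

lemma homotopicI:
  assumes "\<And>n. h n \<in> Hom C (Cob K n) (Cob L (n - 1))"
    "\<And>n. \<psi> n = \<phi> n \<boxplus> (Cdf L (n - 1) \<cdot> h n \<boxplus> h (n + 1) \<cdot> Cdf K n)"
  shows "homotopic C K L \<phi> \<psi>"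
  using assms unfolding homotopic_def by blast

lemma homotopy_Hom:
  assumes "is_complex C K" "is_complex C L" "\<And>n. h n \<in> Hom C (Cob K n) (Cob L (n - 1))"
  shows "Cdf L (n - 1) \<cdot> h n \<in> Hom C (Cob K n) (Cob L n)"
    "h (n + 1) \<cdot> Cdf K n \<in> Hom C (Cob K n) (Cob L n)"
proof -
  show "Cdf L (n - 1) \<cdot> h n \<in> Hom C (Cob K n) (Cob L n)"
    using comp_Hom[OF assms(3) complexD(4)[OF assms(2)]] .
  have "h (n + 1) \<in> Hom C (Cob K (n + 1)) (Cob L n)" using assms(3)[of "n + 1"] by simp
  then show "h (n + 1) \<cdot> Cdf K n \<in> Hom C (Cob K n) (Cob L n)"
    using comp_Hom complexD(1)[OF assms(1)] by blast
qed

lemma chain_mapD: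
  assumes "chain_map C K L \<phi>"
  shows "\<phi> n \<in> Hom C (Cob K n) (Cob L n)" "\<phi> (n + 1) \<cdot> Cdf K n = Cdf L n \<cdot> \<phi> n"
    "\<phi> n \<cdot> Cdf K (n - 1) = Cdf L (n - 1) \<cdot> \<phi> (n - 1)"
proof -
  show "\<phi> n \<in> Hom C (Cob K n) (Cob L n)" and *: "\<phi> (n + 1) \<cdot> Cdf K n = Cdf L n \<cdot> \<phi> n" for n
    using assms by (simp_all add: chain_map_def)
  show "\<phi> n \<cdot> Cdf K (n - 1) = Cdf L (n - 1) \<cdot> \<phi> (n - 1)" using *[of "n - 1"] by simp
qed

lemma homotopic_refl:
  assumes "is_complex C K" "is_complex C L" "chain_map C K L \<phi>"
  shows "homotopic C K L \<phi> \<phi>"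
proof (rule homotopicI)
  fix n
  show "Zer C (Cob K n) (Cob L (n - 1)) \<in> Hom C (Cob K n) (Cob L (n - 1))"
    using assms complexD by simp
  have k: "Cob K n \<in> Obj C" "Cob L n \<in> Obj C" using assms complexD(2) by auto
  have "Cdf L (n - 1) \<cdot> Zer C (Cob K n) (Cob L (n - 1)) = Zer C (Cob K n) (Cob L n)"
    "Zer C (Cob K (n + 1)) (Cob L (n + 1 - 1)) \<cdot> Cdf K n = Zer C (Cob K n) (Cob L n)"
    using comp_zero[OF k(1) complexD(4)[OF assms(2)]] zero_comp[OF complexD(1)[OF assms(1)] k(2)] by simp_all
  then show "\<phi> n = \<phi> n \<boxplus> (Cdf L (n - 1) \<cdot> Zer C (Cob K n) (Cob L (n - 1)) \<boxplus>
      Zer C (Cob K (n + 1)) (Cob L (n + 1 - 1)) \<cdot> Cdf K n)"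
    using k zero_Hom[OF k] add_zero chain_mapD(1)[OF assms(3)] by metis
qed

lemma homotopic_sym:
  assumes "is_complex C K" "is_complex C L" "chain_map C K L \<phi>" "homotopic C K L \<phi> \<psi>"
  shows "homotopic C K L \<psi> \<phi>"
proof -
  obtain h where h: "\<And>n. h n \<in> Hom C (Cob K n) (Cob L (n - 1))"
    "\<And>n. \<psi> n = \<phi> n \<boxplus> (Cdf L (n - 1) \<cdot> h n \<boxplus> h (n + 1) \<cdot> Cdf K n)"
    using assms(4) unfolding homotopic_def by blast
  show ?thesis
  proof (rule homotopicI)
    fix n
    show "\<boxminus> h n \<in> Hom C (Cob K n) (Cob L (n - 1))" using h neg_Hom by blast
    have h1: "h (n + 1) \<in> Hom C (Cob K (n + 1)) (Cob L n)" using h(1)[of "n + 1"] by simp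
    let ?A = "Cdf L (n - 1) \<cdot> h n" and ?B = "h (n + 1) \<cdot> Cdf K n"
    note AB = homotopy_Hom[OF assms(1,2) h(1), of n]
    have "Cdf L (n - 1) \<cdot> \<boxminus> h n = \<boxminus> ?A" "(\<boxminus> h (n + 1)) \<cdot> Cdf K n = \<boxminus> ?B"
      using comp_neg[OF h(1) complexD(4)[OF assms(2)]] neg_comp[OF complexD(1)[OF assms(1)] h1] by auto
    moreover have "(?A \<boxplus> ?B) \<boxplus> (\<boxminus> ?A \<boxplus> \<boxminus> ?B) = Zer C (Cob K n) (Cob L n)"
      using add_add_swap[OF AB neg_Hom[OF AB(1)] neg_Hom[OF AB(2)]] add_neg[OF AB(1)] add_neg[OF AB(2)]
        add_zero zero_Hom HomD[OF AB(1)] by simp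
    moreover have "\<psi> n \<boxplus> (\<boxminus> ?A \<boxplus> \<boxminus> ?B) = \<phi> n \<boxplus> ((?A \<boxplus> ?B) \<boxplus> (\<boxminus> ?A \<boxplus> \<boxminus> ?B))"
      using h(2) add_assoc[OF chain_mapD(1)[OF assms(3)] add_Hom[OF AB] add_Hom] neg_Hom AB by metis
    ultimately show "\<phi> n = \<psi> n \<boxplus> (Cdf L (n - 1) \<cdot> \<boxminus> h n \<boxplus> (\<boxminus> h (n + 1)) \<cdot> Cdf K n)"
      using add_zero[OF chain_mapD(1)[OF assms(3)]] by simp
  qed
qed

lemma homotopic_trans:
  assumes "is_complex C K" "is_complex C L" "chain_map C K L \<phi>"
    "homotopic C K L \<phi> \<psi>" "homotopic C K L \<psi> \<chi>"
  shows "homotopic C K L \<phi> \<chi>"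
proof -
  obtain h where h: "\<And>n. h n \<in> Hom C (Cob K n) (Cob L (n - 1))"
    "\<And>n. \<psi> n = \<phi> n \<boxplus> (Cdf L (n - 1) \<cdot> h n \<boxplus> h (n + 1) \<cdot> Cdf K n)"
    using assms(4) unfolding homotopic_def by blast
  obtain k where k: "\<And>n. k n \<in> Hom C (Cob K n) (Cob L (n - 1))"
    "\<And>n. \<chi> n = \<psi> n \<boxplus> (Cdf L (n - 1) \<cdot> k n \<boxplus> k (n + 1) \<cdot> Cdf K n)"
    using assms(5) unfolding homotopic_def by blast
  show ?thesis
  proof (rule homotopicI)
    fix n
    show "h n \<boxplus> k n \<in> Hom C (Cob K n) (Cob L (n - 1))" using h k add_Hom by blast
    have h1: "h (n + 1) \<in> Hom C (Cob K (n + 1)) (Cob L n)" using h(1)[of "n + 1"] by simp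
    have k1: "k (n + 1) \<in> Hom C (Cob K (n + 1)) (Cob L n)" using k(1)[of "n + 1"] by simp
    let ?A = "Cdf L (n - 1) \<cdot> h n" and ?B = "h (n + 1) \<cdot> Cdf K n"
    let ?A' = "Cdf L (n - 1) \<cdot> k n" and ?B' = "k (n + 1) \<cdot> Cdf K n"
    note AB = homotopy_Hom[OF assms(1,2) h(1), of n] homotopy_Hom[OF assms(1,2) k(1), of n]
    have "Cdf L (n - 1) \<cdot> (h n \<boxplus> k n) = ?A \<boxplus> ?A'"
      "(h (n + 1) \<boxplus> k (n + 1)) \<cdot> Cdf K n = ?B \<boxplus> ?B'"
      using comp_add[OF h(1) k(1) complexD(4)[OF assms(2)]] add_comp[OF complexD(1)[OF assms(1)] h1 k1] by auto
    moreover have "(?A \<boxplus> ?B) \<boxplus> (?A' \<boxplus> ?B') = (?A \<boxplus> ?A') \<boxplus> (?B \<boxplus> ?B')"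
      using add_add_swap[OF AB] .
    ultimately show "\<chi> n = \<phi> n \<boxplus> (Cdf L (n - 1) \<cdot> (h n \<boxplus> k n) \<boxplus> (h (n + 1) \<boxplus> k (n + 1)) \<cdot> Cdf K n)"
      using h(2) k(2) add_assoc[OF chain_mapD(1)[OF assms(3)] add_Hom[OF AB(1,2)] add_Hom[OF AB(3,4)]] by simp
  qed
qed

lemma chain_map_comp:
  assumes "is_complex C K" "is_complex C L" "is_complex C M" "chain_map C K L \<phi>" "chain_map C L M \<psi>"
  shows "chain_map C K M (\<lambda>n. \<psi> n \<cdot> \<phi> n)"
  unfolding chain_map_def
proof (intro conjI allI)
  fix n
  show "\<psi> n \<cdot> \<phi> n \<in> Hom C (Cob K n) (Cob M n)" using assms chain_mapD(1) comp_Hom by blast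
  note t = complexD(1)[OF assms(1)] complexD(1)[OF assms(2)] complexD(1)[OF assms(3)]
    chain_mapD(1)[OF assms(4)] chain_mapD(1)[OF assms(5)]
  have "(\<psi> (n + 1) \<cdot> \<phi> (n + 1)) \<cdot> Cdf K n = \<psi> (n + 1) \<cdot> (Cdf L n \<cdot> \<phi> n)"
    using comp_assoc[OF t(1) t(4) t(5)] chain_mapD(2)[OF assms(4)] by simp
  also have "\<dots> = Cdf M n \<cdot> (\<psi> n \<cdot> \<phi> n)"
    using comp_assoc[OF t(4) t(2) t(5)] comp_assoc[OF t(4) t(5) t(3)] chain_mapD(2)[OF assms(5)] by metis
  finally show "(\<psi> (n + 1) \<cdot> \<phi> (n + 1)) \<cdot> Cdf K n = Cdf M n \<cdot> (\<psi> n \<cdot> \<phi> n)" .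
qed

lemma homotopic_comp_left:
  assumes "is_complex C K" "is_complex C L" "is_complex C M" "chain_map C K L \<phi>" "chain_map C L M \<chi>"
    "homotopic C K L \<phi> \<psi>"
  shows "homotopic C K M (\<lambda>n. \<chi> n \<cdot> \<phi> n) (\<lambda>n. \<chi> n \<cdot> \<psi> n)"
proof -
  obtain h where h: "\<And>n. h n \<in> Hom C (Cob K n) (Cob L (n - 1))"
    "\<And>n. \<psi> n = \<phi> n \<boxplus> (Cdf L (n - 1) \<cdot> h n \<boxplus> h (n + 1) \<cdot> Cdf K n)"
    using assms(6) unfolding homotopic_def by blast
  show ?thesis
  proof (rule homotopicI)
    fix n
    note c = chain_mapD(1)[OF assms(5)]
    show "\<chi> (n - 1) \<cdot> h n \<in> Hom C (Cob K n) (Cob M (n - 1))" using h c comp_Hom by blast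
    have h1: "h (n + 1) \<in> Hom C (Cob K (n + 1)) (Cob L n)" using h(1)[of "n + 1"] by simp
    note AB = homotopy_Hom[OF assms(1,2) h(1), of n]
    have "\<chi> n \<cdot> (Cdf L (n - 1) \<cdot> h n) = Cdf M (n - 1) \<cdot> (\<chi> (n - 1) \<cdot> h n)"
      using comp_assoc[OF h(1) complexD(4)[OF assms(2)] c] comp_assoc[OF h(1) c complexD(4)[OF assms(3)]]
        chain_mapD(3)[OF assms(5)] by metis
    moreover have "\<chi> n \<cdot> (h (n + 1) \<cdot> Cdf K n) = (\<chi> (n + 1 - 1) \<cdot> h (n + 1)) \<cdot> Cdf K n"
      using comp_assoc[OF complexD(1)[OF assms(1)] h1 c] by simp
    moreover have "\<chi> n \<cdot> \<psi> n = \<chi> n \<cdot> \<phi> n \<boxplus> (\<chi> n \<cdot> (Cdf L (n - 1) \<cdot> h n) \<boxplus> \<chi> n \<cdot> (h (n + 1) \<cdot> Cdf K n))"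
      using comp_add[OF AB c] comp_add[OF chain_mapD(1)[OF assms(4)] add_Hom[OF AB] c] h(2) by simp
    ultimately show "\<chi> n \<cdot> \<psi> n = \<chi> n \<cdot> \<phi> n \<boxplus> (Cdf M (n - 1) \<cdot> (\<chi> (n - 1) \<cdot> h n)
        \<boxplus> (\<chi> (n + 1 - 1) \<cdot> h (n + 1)) \<cdot> Cdf K n)" by simp
  qed
qed

lemma homotopic_comp_right:
  assumes "is_complex C K" "is_complex C L" "is_complex C M" "chain_map C K L \<chi>" "chain_map C L M \<phi>"
    "homotopic C L M \<phi> \<psi>"
  shows "homotopic C K M (\<lambda>n. \<phi> n \<cdot> \<chi> n) (\<lambda>n. \<psi> n \<cdot> \<chi> n)"
proof -
  obtain h where h: "\<And>n. h n \<in> Hom C (Cob L n) (Cob M (n - 1))"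
    "\<And>n. \<psi> n = \<phi> n \<boxplus> (Cdf M (n - 1) \<cdot> h n \<boxplus> h (n + 1) \<cdot> Cdf L n)"
    using assms(6) unfolding homotopic_def by blast
  show ?thesis
  proof (rule homotopicI)
    fix n
    note c = chain_mapD(1)[OF assms(4)]
    show "h n \<cdot> \<chi> n \<in> Hom C (Cob K n) (Cob M (n - 1))" using h c comp_Hom by blast
    have h1: "h (n + 1) \<in> Hom C (Cob L (n + 1)) (Cob M n)" using h(1)[of "n + 1"] by simp
    note AB = homotopy_Hom[OF assms(2,3) h(1), of n]
    have "(h (n + 1) \<cdot> Cdf L n) \<cdot> \<chi> n = (h (n + 1) \<cdot> \<chi> (n + 1)) \<cdot> Cdf K n"
      using comp_assoc[OF c complexD(1)[OF assms(2)] h1] comp_assoc[OF complexD(1)[OF assms(1)] c h1]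
        chain_mapD(2)[OF assms(4)] by metis
    moreover have "(Cdf M (n - 1) \<cdot> h n) \<cdot> \<chi> n = Cdf M (n - 1) \<cdot> (h n \<cdot> \<chi> n)"
      using comp_assoc[OF c h(1) complexD(4)[OF assms(3)]] by simp
    moreover have "\<psi> n \<cdot> \<chi> n = \<phi> n \<cdot> \<chi> n \<boxplus> ((Cdf M (n - 1) \<cdot> h n) \<cdot> \<chi> n \<boxplus> (h (n + 1) \<cdot> Cdf L n) \<cdot> \<chi> n)"
      using add_comp[OF c AB] add_comp[OF c chain_mapD(1)[OF assms(5)] add_Hom[OF AB]] h(2) by simp
    ultimately show "\<psi> n \<cdot> \<chi> n = \<phi> n \<cdot> \<chi> n \<boxplus> (Cdf M (n - 1) \<cdot> (h n \<cdot> \<chi> n)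
        \<boxplus> (h (n + 1) \<cdot> \<chi> (n + 1)) \<cdot> Cdf K n)" by simp
  qed
qed

lemma htpy_class_eq_iff:
  assumes "is_complex C K" "is_complex C L" "chain_map C K L \<phi>" "chain_map C K L \<psi>"
  shows "htpy_class C K L \<phi> = htpy_class C K L \<psi> \<longleftrightarrow> homotopic C K L \<phi> \<psi>"
proof
  assume "htpy_class C K L \<phi> = htpy_class C K L \<psi>"
  then show "homotopic C K L \<phi> \<psi>"
    using assms homotopic_refl[OF assms(1,2,4)] by (auto simp: htpy_class_def)
next
  assume *: "homotopic C K L \<phi> \<psi>"
  have "homotopic C K L \<phi> \<chi> \<longleftrightarrow> homotopic C K L \<psi> \<chi>" if "chain_map C K L \<chi>" for \<chi>
    using * homotopic_trans homotopic_sym assms that by blast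
  then show "htpy_class C K L \<phi> = htpy_class C K L \<psi>" by (auto simp: htpy_class_def)
qed

text \<open>
  Composition in \<open>Kb\<close> takes arbitrary members of the two classes. As homotopy is a congruence, the choice
  is irrelevant.
\<close>

lemma Kb_comp_class:
  assumes "is_complex C K" "is_complex C L" "is_complex C M" "chain_map C K L \<phi>" "chain_map C L M \<psi>"
  shows "Comp (Kb C S) (htpy_class C L M \<psi>) (htpy_class C K L \<phi>) = htpy_class C K M (\<lambda>n. \<psi> n \<cdot> \<phi> n)"
proof -
  let ?P = "\<lambda>\<phi>'. chain_map C K L \<phi>' \<and> homotopic C K L \<phi> \<phi>'"
  let ?R = "\<lambda>\<psi>'. chain_map C L M \<psi>' \<and> homotopic C L M \<psi> \<psi>'"
  define \<phi>' \<psi>' where d: "\<phi>' = (SOME \<phi>'. ?P \<phi>')" "\<psi>' = (SOME \<psi>'. ?R \<psi>')"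
  have p: "?P \<phi>'" unfolding d using assms homotopic_refl by (intro someI[of ?P \<phi>]) auto
  have r: "?R \<psi>'" unfolding d using assms homotopic_refl by (intro someI[of ?R \<psi>]) auto
  have "Comp (Kb C S) (htpy_class C L M \<psi>) (htpy_class C K L \<phi>) = htpy_class C K M (\<lambda>n. \<psi>' n \<cdot> \<phi>' n)"
    by (simp add: Kb_def Let_def htpy_class_def d)
  moreover have "homotopic C K M (\<lambda>n. \<psi> n \<cdot> \<phi> n) (\<lambda>n. \<psi>' n \<cdot> \<phi>' n)"
    using homotopic_trans[OF assms(1,3) chain_map_comp[OF assms]
        homotopic_comp_left[OF assms(1-5)] homotopic_comp_right[OF assms(1-3)]] p r assms by blast
  ultimately show ?thesis
    using htpy_class_eq_iff[OF assms(1,3)] chain_map_comp assms p r by metis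
qed

end

section \<open>Comparison of relative coresolutions\<close>

text \<open>
  Exactness of \<open>0 \<rightarrow> Hom(E', T) \<rightarrow> Hom(F, T) \<rightarrow> Hom(E, T) \<rightarrow> 0\<close> for \<open>a : E \<rightarrow> F\<close> and \<open>q : F \<rightarrow> E'\<close>: the
  object \<open>T\<close> regards the pair as a short exact sequence with respect to which it is injective. It is
  applied to pairs for which \<open>q \<circ> a\<close> need not even vanish.
\<close>

definition hom_exact :: "('o, 'a, 'z) add_cat_scheme \<Rightarrow> 'a \<Rightarrow> 'a \<Rightarrow> 'o \<Rightarrow> bool" where
  "hom_exact C a q T \<longleftrightarrow>
     (\<forall>k \<in> Hom C (Dom C a) T. \<exists>s \<in> Hom C (Cod C a) T. Comp C s a = k) \<and>
     (\<forall>\<phi> \<in> Hom C (Cod C a) T. Comp C \<phi> a = Zer C (Dom C a) T \<longleftrightarrow> (\<exists>k \<in> Hom C (Cod C q) T. \<phi> = Comp C k q)) \<and>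
     (\<forall>k \<in> Hom C (Cod C q) T. \<forall>k' \<in> Hom C (Cod C q) T. Comp C k q = Comp C k' q \<longrightarrow> k = k')"

text \<open>
  The complex \<open>K\<close> in degrees \<open>0, \<dots>, N + 1\<close> is spliced from sequences \<open>E n \<rightarrow> K\<^sup>n \<rightarrow> E (n + 1)\<close> that the objects
  of \<open>\<T>\<close> regard as short exact. It ends with the syzygy \<open>E (N + 1)\<close> itself, which is why the last differential is
  \<open>q N\<close> without a second factor.
\<close>

definition relative_coresolution ::
  "('o, 'a, 'z) add_cat_scheme \<Rightarrow> nat \<Rightarrow> ('o, 'a) cplx \<Rightarrow> (nat \<Rightarrow> 'o) \<Rightarrow> (nat \<Rightarrow> 'a) \<Rightarrow> (nat \<Rightarrow> 'a) \<Rightarrow>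
    'o set \<Rightarrow> bool" where
  "relative_coresolution C N K E a q \<T> \<longleftrightarrow> is_complex C K \<and>
     (\<forall>n. n < 0 \<or> n > int N + 1 \<longrightarrow> is_zero_obj C (Cob K n)) \<and>
     (\<forall>n \<le> N. a n \<in> Hom C (E n) (Cob K (int n)) \<and> q n \<in> Hom C (Cob K (int n)) (E (Suc n)) \<and>
        (\<forall>T \<in> \<T>. hom_exact C (a n) (q n) T)) \<and>
     (\<forall>n < N. Cdf K (int n) = Comp C (a (Suc n)) (q n)) \<and>
     E (Suc N) = Cob K (int N + 1) \<and> Cdf K (int N) = q N"

context preadditive_category
begin

lemma hom_exactD:
  assumes "hom_exact C a q T" "a \<in> Hom C x y" "q \<in> Hom C y z"
  shows hom_exact_extend: "k \<in> Hom C x T \<Longrightarrow> \<exists>s \<in> Hom C y T. s \<cdot> a = k"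
    and hom_exact_factor: "\<phi> \<in> Hom C y T \<Longrightarrow> \<phi> \<cdot> a = Zer C x T \<Longrightarrow> \<exists>k \<in> Hom C z T. \<phi> = k \<cdot> q"
    and hom_exact_zero: "k \<in> Hom C z T \<Longrightarrow> (k \<cdot> q) \<cdot> a = Zer C x T"
    and hom_exact_unique: "k \<in> Hom C z T \<Longrightarrow> k' \<in> Hom C z T \<Longrightarrow> k \<cdot> q = k' \<cdot> q \<Longrightarrow> k = k'"
  using assms HomD[OF assms(2)] HomD[OF assms(3)] comp_Hom[OF assms(3)] unfolding hom_exact_def by blast+

text \<open>
  The comparison theorem: a chain map \<open>\<delta>\<close> that vanishes on the first syzygy is null-homotopic, up to a
  morphism \<open>k\<close> on the last syzygy. The homotopy is found degree by degree. As soon as \<open>\<delta>\<^sup>N - t s\<close> factors as \<open>k q\<close>,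
  extending \<open>k\<close> along \<open>a\<close> gives the next component of \<open>s\<close>, and the equation for chain maps shows that the next
  difference vanishes on \<open>a\<close>.
  
  The target is indexed with a shift: \<open>T (n + 1)\<close> is its term in degree \<open>n\<close>. So \<open>T 0\<close> is the term in degree \<open>-1\<close>,
  and the homotopy \<open>s n : F n \<rightarrow> T n\<close> has degree \<open>-1\<close>.
\<close>

lemma relative_nullhomotopy:
  assumes "\<And>n. n \<le> N \<Longrightarrow> a n \<in> Hom C (E n) (F n)"
    and "\<And>n. n \<le> N \<Longrightarrow> q n \<in> Hom C (F n) (E (Suc n))"
    and "\<And>n m. n \<le> N \<Longrightarrow> m \<le> N \<Longrightarrow> hom_exact C (a n) (q n) (T (Suc m))"
    and "\<And>n. n \<le> N \<Longrightarrow> t n \<in> Hom C (T n) (T (Suc n))"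
    and "\<And>n. n < N \<Longrightarrow> t (Suc n) \<cdot> t n = Zer C (T n) (T (Suc (Suc n)))"
    and "\<And>n. n \<le> N \<Longrightarrow> \<delta> n \<in> Hom C (F n) (T (Suc n))"
    and "\<And>n. n < N \<Longrightarrow> \<delta> (Suc n) \<cdot> (a (Suc n) \<cdot> q n) = t (Suc n) \<cdot> \<delta> n"
    and "\<delta> 0 \<cdot> a 0 = Zer C (E 0) (T (Suc 0))"
  shows "\<exists>s k. (\<forall>n \<le> N. s n \<in> Hom C (F n) (T n)) \<and>
     k \<in> Hom C (E (Suc N)) (T (Suc N)) \<and>
     (\<forall>n < N. \<delta> n = t n \<cdot> s n \<boxplus> s (Suc n) \<cdot> (a (Suc n) \<cdot> q n)) \<and>
     \<delta> N = t N \<cdot> s N \<boxplus> k \<cdot> q N"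
  using assms
proof (induction N)
  case 0
  have a: "a 0 \<in> Hom C (E 0) (F 0)" "q 0 \<in> Hom C (F 0) (E (Suc 0))" "hom_exact C (a 0) (q 0) (T (Suc 0))"
    "t 0 \<in> Hom C (T 0) (T (Suc 0))" "\<delta> 0 \<in> Hom C (F 0) (T (Suc 0))"
    using 0 by auto
  obtain k where k: "k \<in> Hom C (E (Suc 0)) (T (Suc 0))" "\<delta> 0 = k \<cdot> q 0"
    using hom_exact_factor[OF a(3,1,2,5)] 0 by blast
  have "t 0 \<cdot> Zer C (F 0) (T 0) = Zer C (F 0) (T (Suc 0))"
    using comp_zero[OF _ a(4)] HomD[OF a(1)] by simp
  then have "\<delta> 0 = t 0 \<cdot> Zer C (F 0) (T 0) \<boxplus> k \<cdot> q 0"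
    using k zero_add a(5) by metis
  moreover have "Zer C (F 0) (T 0) \<in> Hom C (F 0) (T 0)"
    using HomD[OF a(1)] HomD[OF a(4)] by simp
  ultimately show ?case
    using k(1) by (intro exI[of _ "\<lambda>_. Zer C (F 0) (T 0)"] exI[of _ k]) auto
next
  case (Suc N)
  obtain s k where s: "\<And>n. n \<le> N \<Longrightarrow> s n \<in> Hom C (F n) (T n)"
    and k: "k \<in> Hom C (E (Suc N)) (T (Suc N))"
    and \<delta>: "\<And>n. n < N \<Longrightarrow> \<delta> n = t n \<cdot> s n \<boxplus> s (Suc n) \<cdot> (a (Suc n) \<cdot> q n)"
      "\<delta> N = t N \<cdot> s N \<boxplus> k \<cdot> q N"
    using Suc.IH Suc.prems by (smt (verit) le_SucI less_SucI)
  note a = Suc.prems(1)[of "Suc N", simplified] and q = Suc.prems(2)[of "Suc N", simplified]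
    and t = Suc.prems(4)[of "Suc N", simplified] and d = Suc.prems(6)[of "Suc N", simplified]
  have qN: "q N \<in> Hom C (F N) (E (Suc N))" and tN: "t N \<in> Hom C (T N) (T (Suc N))"
    and aN: "a N \<in> Hom C (E N) (F N)" using Suc.prems by auto
  have e: "hom_exact C (a (Suc N)) (q (Suc N)) (T (Suc N))"
    "hom_exact C (a (Suc N)) (q (Suc N)) (T (Suc (Suc N)))"
    "hom_exact C (a N) (q N) (T (Suc (Suc N)))" using Suc.prems(3) by auto
  obtain \<sigma> where \<sigma>: "\<sigma> \<in> Hom C (F (Suc N)) (T (Suc N))" "\<sigma> \<cdot> a (Suc N) = k"
    using hom_exact_extend[OF e(1) a q k] by blast
  \<comment> \<open>the morphism \<open>\<sigma>\<close> is the component \<open>s (N + 1)\<close>\<close>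
  have \<delta>N: "\<delta> N = t N \<cdot> s N \<boxplus> \<sigma> \<cdot> (a (Suc N) \<cdot> q N)"
    using \<delta>(2) comp_assoc[OF qN a \<sigma>(1)] \<sigma>(2) by simp
  define \<epsilon> where "\<epsilon> = \<delta> (Suc N) \<boxplus> \<boxminus> (t (Suc N) \<cdot> \<sigma>)"
  have t\<sigma>: "t (Suc N) \<cdot> \<sigma> \<in> Hom C (F (Suc N)) (T (Suc (Suc N)))"
    using comp_Hom[OF \<sigma>(1) t] .
  have \<epsilon>: "\<epsilon> \<in> Hom C (F (Suc N)) (T (Suc (Suc N)))"
    unfolding \<epsilon>_def using add_Hom[OF d neg_Hom[OF t\<sigma>]] .
  have aq: "a (Suc N) \<cdot> q N \<in> Hom C (F N) (F (Suc N))" using comp_Hom[OF qN a] .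
  have sN: "s N \<in> Hom C (F N) (T N)" using s by simp
  \<comment> \<open>\<open>\<epsilon>\<close> vanishes on \<open>a (N + 1) q N\<close>, and \<open>q N\<close> can be cancelled\<close>
  have "t (Suc N) \<cdot> (t N \<cdot> s N) = Zer C (F N) (T (Suc (Suc N)))"
    using comp_assoc[OF sN tN t] Suc.prems(5)[of N] zero_comp[OF sN] HomD[OF t] by simp
  then have "t (Suc N) \<cdot> \<delta> N = t (Suc N) \<cdot> (\<sigma> \<cdot> (a (Suc N) \<cdot> q N))"
    using comp_add[OF comp_Hom[OF sN tN] comp_Hom[OF aq \<sigma>(1)] t] \<delta>N
      zero_add[OF comp_Hom[OF comp_Hom[OF aq \<sigma>(1)] t]] by simp
  then have "\<delta> (Suc N) \<cdot> (a (Suc N) \<cdot> q N) = (t (Suc N) \<cdot> \<sigma>) \<cdot> (a (Suc N) \<cdot> q N)"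
    using Suc.prems(7)[of N] comp_assoc[OF aq \<sigma>(1) t] by simp
  then have "\<epsilon> \<cdot> (a (Suc N) \<cdot> q N) = Zer C (F N) (T (Suc (Suc N)))"
    unfolding \<epsilon>_def using add_comp[OF aq d neg_Hom[OF t\<sigma>]] neg_comp[OF aq t\<sigma>]
      add_neg[OF comp_Hom[OF aq t\<sigma>]] by simp
  then have "(\<epsilon> \<cdot> a (Suc N)) \<cdot> q N = Zer C (E (Suc N)) (T (Suc (Suc N))) \<cdot> q N"
    using comp_assoc[OF qN a \<epsilon>] zero_comp[OF qN] HomD[OF t] by simp
  then have "\<epsilon> \<cdot> a (Suc N) = Zer C (E (Suc N)) (T (Suc (Suc N)))"
    using hom_exact_unique[OF e(3) aN qN comp_Hom[OF a \<epsilon>]] zero_Hom HomD[OF t] HomD[OF a] by blast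
  then obtain k' where k': "k' \<in> Hom C (E (Suc (Suc N))) (T (Suc (Suc N)))" "\<epsilon> = k' \<cdot> q (Suc N)"
    using hom_exact_factor[OF e(2) a q \<epsilon>] by blast
  have "\<delta> (Suc N) = t (Suc N) \<cdot> \<sigma> \<boxplus> k' \<cdot> q (Suc N)"
    using eq_add_neg[OF d t\<sigma> \<epsilon>] k'(2) unfolding \<epsilon>_def by simp
  moreover have "\<delta> n = t n \<cdot> (s(Suc N := \<sigma>)) n \<boxplus> (s(Suc N := \<sigma>)) (Suc n) \<cdot> (a (Suc n) \<cdot> q n)"
    if "n < Suc N" for n
    using that \<delta>(1)[of n] \<delta>N by (cases "n = N") auto
  ultimately show ?case
    using s k'(1) \<sigma>(1) by (intro exI[of _ "s(Suc N := \<sigma>)"] exI[of _ k']) (auto simp: le_Suc_eq)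
qed

lemma relative_coresolutionD:
  assumes "relative_coresolution C N K E a q \<T>"
  shows "is_complex C K" "\<And>n. n < 0 \<Longrightarrow> is_zero_obj C (Cob K n)"
    "\<And>n. n > int N + 1 \<Longrightarrow> is_zero_obj C (Cob K n)"
    "\<And>n. n \<le> N \<Longrightarrow> a n \<in> Hom C (E n) (Cob K (int n))"
    "\<And>n. n \<le> N \<Longrightarrow> q n \<in> Hom C (Cob K (int n)) (E (Suc n))"
    "\<And>n T. n \<le> N \<Longrightarrow> T \<in> \<T> \<Longrightarrow> hom_exact C (a n) (q n) T"
    "E (Suc N) = Cob K (int N + 1)" "Cdf K (int N) = q N"
    "\<And>n. n < N \<Longrightarrow> Cdf K (int n) = a (Suc n) \<cdot> q n"
  using assms unfolding relative_coresolution_def by auto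

text \<open>
  Treats the last differential \<open>q N\<close> and the other ones \<open>a (n + 1) q n\<close> alike.
\<close>

lemma relative_coresolution_factor:
  assumes K: "relative_coresolution C N K E a q \<T>" and n: "n \<le> N"
    and k: "k \<in> Hom C (Cob K (int n + 1)) T"
  shows "\<exists>k' \<in> Hom C (E (Suc n)) T. k \<cdot> Cdf K (int n) = k' \<cdot> q n"
proof (cases "n = N")
  case True
  then show ?thesis using relative_coresolutionD(7,8)[OF K] k by auto
next
  case False
  then have n': "n < N" using n by simp
  have k1: "k \<in> Hom C (Cob K (int (Suc n))) T" using k by (simp add: add.commute)
  note aS = relative_coresolutionD(4)[OF K Suc_leI[OF n']]
  have "k \<cdot> Cdf K (int n) = (k \<cdot> a (Suc n)) \<cdot> q n"
    using relative_coresolutionD(9)[OF K n'] comp_assoc[OF relative_coresolutionD(5)[OF K n] aS k1] by simp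
  then show ?thesis using comp_Hom[OF aS k1] by blast
qed

text \<open>
  In degree \<open>0\<close> a homotopy contributes only its composite with the first differential of \<open>K\<close>. This factors
  through \<open>q 0\<close>, and so vanishes on \<open>a 0\<close>.
\<close>

lemma homotopic_agree:
  assumes K: "relative_coresolution C N K E a q \<T>" and L: "is_complex C L"
    and "is_zero_obj C (Cob L (-1))" "Cob L 0 \<in> \<T>"
    and "chain_map C K L \<phi>" "homotopic C K L \<phi> \<psi>"
  shows "\<phi> 0 \<cdot> a 0 = \<psi> 0 \<cdot> a 0"
proof -
  obtain h where h: "\<And>n. h n \<in> Hom C (Cob K n) (Cob L (n - 1))"
    "\<And>n. \<psi> n = \<phi> n \<boxplus> (Cdf L (n - 1) \<cdot> h n \<boxplus> h (n + 1) \<cdot> Cdf K n)"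
    using assms(6) unfolding homotopic_def by blast
  note R = relative_coresolutionD[OF K]
  note AB = homotopy_Hom[OF R(1) L h(1), of 0]
  have a: "a 0 \<in> Hom C (E 0) (Cob K 0)" and q: "q 0 \<in> Hom C (Cob K 0) (E (Suc 0))"
    and e: "hom_exact C (a 0) (q 0) (Cob L 0)" using R(4)[of 0] R(5)[of 0] R(6)[of 0] assms(4) by auto
  have "h 0 = Zer C (Cob K 0) (Cob L (-1))" using zero_obj_into[OF assms(3)] h(1)[of 0] by simp
  then have A: "Cdf L (0 - 1) \<cdot> h 0 = Zer C (Cob K 0) (Cob L 0)"
    using comp_zero[OF complexD(2)[OF R(1)] complexD(4)[OF L], of 0 0] by simp
  obtain k where k: "k \<in> Hom C (E (Suc 0)) (Cob L 0)" "h (0 + 1) \<cdot> Cdf K 0 = k \<cdot> q 0"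
    using relative_coresolution_factor[OF K, of 0 "h 1" "Cob L 0"] h(1)[of 1] by auto
  have "\<psi> 0 = \<phi> 0 \<boxplus> k \<cdot> q 0" using h(2)[of 0] A k(2) zero_add[OF AB(2)] by simp
  moreover have "(k \<cdot> q 0) \<cdot> a 0 = Zer C (E 0) (Cob L 0)" using hom_exact_zero[OF e a q k(1)] .
  ultimately show ?thesis
    using add_comp[OF a chain_mapD(1)[OF assms(5)] comp_Hom[OF q k(1)]]
      add_zero[OF comp_Hom[OF a chain_mapD(1)[OF assms(5)]]] by simp
qed

text \<open>
  By the comparison theorem \<open>\<psi> - \<phi>\<close> is null-homotopic below the last degree, up to a morphism \<open>k\<close> from the last
  term of \<open>K\<close>. In the last degree \<open>\<psi>\<close> minus the differential of \<open>k\<close> is the extension, and \<open>k\<close> is the last component of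
  the homotopy.
\<close>

lemma chain_map_extension:
  assumes K: "relative_coresolution C N K E a q \<T>" and L: "is_complex C L"
    and LT: "\<And>n. n \<le> N \<Longrightarrow> Cob L (int n) \<in> \<T>"
    and \<psi>: "chain_map C K L \<psi>"
    and \<phi>: "\<And>n. n \<le> N \<Longrightarrow> \<phi> n \<in> Hom C (Cob K (int n)) (Cob L (int n))"
    and \<phi>d: "\<And>n. n < N \<Longrightarrow> \<phi> (Suc n) \<cdot> Cdf K (int n) = Cdf L (int n) \<cdot> \<phi> n"
    and agree: "\<phi> 0 \<cdot> a 0 = \<psi> 0 \<cdot> a 0"
  obtains g where "g \<in> Hom C (Cob K (int N + 1)) (Cob L (int N + 1))"
    "g \<cdot> Cdf K (int N) = Cdf L (int N) \<cdot> \<phi> N"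
    "homotopic C K L (\<lambda>n. if 0 \<le> n \<and> n < int N + 1 then \<phi> (nat n) else if n = int N + 1 then g
        else Zer C (Cob K n) (Cob L n)) \<psi>"
proof -
  note R = relative_coresolutionD[OF K]
  define F where "F n = Cob K (int n)" for n
  define T where "T n = Cob L (int n - 1)" for n
  define t where "t n = Cdf L (int n - 1)" for n
  define \<delta> where "\<delta> n = \<psi> (int n) \<boxplus> \<boxminus> \<phi> n" for n
  have TS: "T (Suc n) = Cob L (int n)" "t (Suc n) = Cdf L (int n)" for n by (simp_all add: T_def t_def)
  have t: "t n \<in> Hom C (T n) (T (Suc n))" for n
    using complexD(4)[OF L, of "int n"] TS by (simp add: T_def t_def)
  have tt: "t (Suc n) \<cdot> t n = Zer C (T n) (T (Suc (Suc n)))" for n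
    using complexD(5)[OF L, of "int n"] TS[of n] TS[of "Suc n"] by (simp add: T_def t_def add.commute)
  have \<psi>h: "\<psi> (int n) \<in> Hom C (F n) (T (Suc n))" for n using chain_mapD(1)[OF \<psi>] by (simp add: F_def TS)
  have \<phi>h: "\<phi> n \<in> Hom C (F n) (T (Suc n))" if "n \<le> N" for n using \<phi>[OF that] by (simp add: F_def TS)
  have \<delta>h: "\<delta> n \<in> Hom C (F n) (T (Suc n))" if "n \<le> N" for n
    unfolding \<delta>_def using add_Hom[OF \<psi>h neg_Hom[OF \<phi>h[OF that]]] .
  have dK: "Cdf K (int n) \<in> Hom C (F n) (F (Suc n))" for n
    using complexD(1)[OF R(1), of "int n"] by (simp add: F_def add.commute)
  have \<delta>d: "\<delta> (Suc n) \<cdot> (a (Suc n) \<cdot> q n) = t (Suc n) \<cdot> \<delta> n" if n: "n < N" for n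
  proof -
    have "\<delta> (Suc n) \<cdot> Cdf K (int n) = \<psi> (int n + 1) \<cdot> Cdf K (int n) \<boxplus> \<boxminus> (\<phi> (Suc n) \<cdot> Cdf K (int n))"
      using add_comp[OF dK \<psi>h neg_Hom[OF \<phi>h]] neg_comp[OF dK \<phi>h, of n] n by (simp add: \<delta>_def add.commute)
    also have "\<dots> = t (Suc n) \<cdot> \<psi> (int n) \<boxplus> \<boxminus> (t (Suc n) \<cdot> \<phi> n)"
      using \<phi>d[OF n] chain_mapD(2)[OF \<psi>] by (simp add: TS)
    also have "\<dots> = t (Suc n) \<cdot> \<delta> n"
      unfolding \<delta>_def using comp_add[OF \<psi>h neg_Hom[OF \<phi>h] t] comp_neg[OF \<phi>h t] n by simp
    finally show ?thesis using R(9)[OF n] by simp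
  qed
  have \<delta>0: "\<delta> 0 \<cdot> a 0 = Zer C (E 0) (T (Suc 0))"
  proof -
    have a0: "a 0 \<in> Hom C (E 0) (F 0)" using R(4)[of 0] by (simp add: F_def)
    show ?thesis
      unfolding \<delta>_def using add_comp[OF a0 \<psi>h neg_Hom[OF \<phi>h]] neg_comp[OF a0 \<phi>h] agree
        add_neg[OF comp_Hom[OF a0 \<phi>h]] by simp
  qed
  obtain s k where s: "\<And>n. n \<le> N \<Longrightarrow> s n \<in> Hom C (F n) (T n)"
    and k: "k \<in> Hom C (E (Suc N)) (T (Suc N))"
    and \<delta>: "\<And>n. n < N \<Longrightarrow> \<delta> n = t n \<cdot> s n \<boxplus> s (Suc n) \<cdot> (a (Suc n) \<cdot> q n)"
      "\<delta> N = t N \<cdot> s N \<boxplus> k \<cdot> q N"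
  proof -
    have "\<exists>s k. (\<forall>n \<le> N. s n \<in> Hom C (F n) (T n)) \<and>
       k \<in> Hom C (E (Suc N)) (T (Suc N)) \<and>
       (\<forall>n < N. \<delta> n = t n \<cdot> s n \<boxplus> s (Suc n) \<cdot> (a (Suc n) \<cdot> q n)) \<and> \<delta> N = t N \<cdot> s N \<boxplus> k \<cdot> q N"
    proof (rule relative_nullhomotopy)
      show "a n \<in> Hom C (E n) (F n)" "q n \<in> Hom C (F n) (E (Suc n))" if "n \<le> N" for n
        using R(4,5)[OF that] by (simp_all add: F_def)
      show "hom_exact C (a n) (q n) (T (Suc m))" if "n \<le> N" "m \<le> N" for n m
        using R(6)[OF that(1) LT[OF that(2)]] by (simp add: TS)
    qed (use t tt \<delta>h \<delta>d \<delta>0 in auto)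
    then show ?thesis using that by auto
  qed
  have k': "k \<in> Hom C (F (Suc N)) (T (Suc N))" using k R(7) by (simp add: F_def add.commute)
  define g where "g = \<psi> (int (Suc N)) \<boxplus> \<boxminus> (t (Suc N) \<cdot> k)"
  have tk: "t (Suc N) \<cdot> k \<in> Hom C (F (Suc N)) (T (Suc (Suc N)))" using comp_Hom[OF k' t] .
  have g: "g \<in> Hom C (F (Suc N)) (T (Suc (Suc N)))"
    unfolding g_def using add_Hom[OF \<psi>h neg_Hom[OF tk]] .
  have \<psi>g: "\<psi> (int (Suc N)) = g \<boxplus> t (Suc N) \<cdot> k"
    using eq_add_neg[OF \<psi>h tk g] add_commute[OF tk g] unfolding g_def by simp
  have \<psi>\<phi>: "\<psi> (int n) = \<phi> n \<boxplus> \<delta> n" if "n \<le> N" for n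
    using eq_add_neg[OF \<psi>h \<phi>h \<delta>h] that unfolding \<delta>_def by blast
  note dN = dK[of N]
  have ts: "t (Suc N) \<cdot> \<delta> N = t (Suc N) \<cdot> (k \<cdot> q N)"
  proof -
    note sN = s[OF order_refl]
    have kq: "k \<cdot> q N \<in> Hom C (F N) (T (Suc N))" using comp_Hom[OF dN k'] R(8) by simp
    have "t (Suc N) \<cdot> (t N \<cdot> s N) = Zer C (F N) (T (Suc (Suc N)))"
      using comp_assoc[OF sN t t] tt[of N] zero_comp[OF sN] HomD[OF t] by simp
    then show ?thesis
      using comp_add[OF comp_Hom[OF sN t] kq t] \<delta>(2) zero_add[OF comp_Hom[OF kq t]] by simp
  qed
  have "\<psi> (int (Suc N)) \<cdot> Cdf K (int N) = t (Suc N) \<cdot> \<psi> (int N)"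
    using chain_mapD(2)[OF \<psi>, of "int N"] by (simp add: TS add.commute)
  also have "\<dots> = t (Suc N) \<cdot> \<phi> N \<boxplus> t (Suc N) \<cdot> (k \<cdot> q N)"
    using \<psi>\<phi>[of N] comp_add[OF \<phi>h \<delta>h t] ts by simp
  also have "t (Suc N) \<cdot> (k \<cdot> q N) = (t (Suc N) \<cdot> k) \<cdot> Cdf K (int N)"
    using comp_assoc[OF dN k' t] R(8) by simp
  finally have "g \<cdot> Cdf K (int N) = t (Suc N) \<cdot> \<phi> N"
  proof -
    assume *: "\<psi> (int (Suc N)) \<cdot> Cdf K (int N) = t (Suc N) \<cdot> \<phi> N \<boxplus> (t (Suc N) \<cdot> k) \<cdot> Cdf K (int N)"
    have "\<psi> (int (Suc N)) \<cdot> Cdf K (int N) = g \<cdot> Cdf K (int N) \<boxplus> (t (Suc N) \<cdot> k) \<cdot> Cdf K (int N)"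
      using \<psi>g add_comp[OF dN g tk] by simp
    with * show ?thesis
      using add_left_imp_eq add_commute comp_Hom[OF dN tk] comp_Hom[OF dN g] comp_Hom[OF \<phi>h t, of N]
      by (metis order_refl)
  qed
  then have gd: "g \<cdot> Cdf K (int N) = Cdf L (int N) \<cdot> \<phi> N" by (simp add: TS)
  have g': "g \<in> Hom C (Cob K (int N + 1)) (Cob L (int N + 1))"
    using g TS(1)[of "Suc N"] by (simp add: F_def add.commute)
  define h where "h n = (if 0 \<le> n \<and> n < int N + 1 then s (nat n) else if n = int N + 1 then k
     else Zer C (Cob K n) (Cob L (n - 1)))" for n
  define \<chi> where "\<chi> n = (if 0 \<le> n \<and> n < int N + 1 then \<phi> (nat n) else if n = int N + 1 then g
        else Zer C (Cob K n) (Cob L n))" for n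
  have hnat: "h (int n) = s n" if "n \<le> N" for n using that by (simp add: h_def)
  have hSuc: "h (int N + 1) = k" by (simp add: h_def)
  have hh: "h n \<in> Hom C (Cob K n) (Cob L (n - 1))" for n
  proof -
    consider m where "n = int m" "m \<le> N" | "n = int (Suc N)" | "n < 0 \<or> n > int N + 1"
      using zero_le_imp_eq_int[of n] by force
    then show ?thesis
    proof cases
      case 1
      then show ?thesis using s[of m] hnat[of m] by (simp add: F_def T_def)
    next
      case 2
      then show ?thesis using k' hSuc by (simp add: F_def T_def add.commute)
    next
      case 3
      then show ?thesis using complexD(2)[OF R(1)] complexD(2)[OF L] by (auto simp: h_def)
    qed
  qed
  have "homotopic C K L \<chi> \<psi>"
  proof (rule homotopicI[OF hh])
    fix n
    consider m where "n = int m" "m < N" | "n = int N" | "n = int (Suc N)" | "n < 0 \<or> n > int N + 1"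
      using zero_le_imp_eq_int[of n] by force
    then show "\<psi> n = \<chi> n \<boxplus> (Cdf L (n - 1) \<cdot> h n \<boxplus> h (n + 1) \<cdot> Cdf K n)"
    proof cases
      case 1
      then have "\<chi> n = \<phi> m" "h n = s m" "h (n + 1) = s (Suc m)"
        using hnat[of m] hnat[of "Suc m"] by (auto simp: \<chi>_def add.commute)
      then show ?thesis using \<psi>\<phi>[of m] \<delta>(1)[of m] R(9)[of m] 1 by (simp add: t_def)
    next
      case 2
      then have "\<chi> n = \<phi> N" "h n = s N" "h (n + 1) = k"
        using hnat[of N] hSuc by (auto simp: \<chi>_def)
      then show ?thesis using \<psi>\<phi>[of N] \<delta>(2) R(8) 2 by (simp add: t_def)
    next
      case 3
      then have e: "\<chi> n = g" "h n = k" using hSuc by (auto simp: \<chi>_def add.commute)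
      have "is_zero_obj C (Cob K (n + 1))" using R(3) 3 by simp
      then have "h (n + 1) = Zer C (Cob K (n + 1)) (Cob L n)"
        using zero_obj_from hh[of "n + 1"] by simp
      then have "h (n + 1) \<cdot> Cdf K n = Zer C (F (Suc N)) (T (Suc (Suc N)))"
        using zero_comp[OF complexD(1)[OF R(1), of n] complexD(2)[OF L, of n]] 3 TS(1)[of "Suc N"] by (simp add: F_def)
      then show ?thesis using e \<psi>g add_zero[OF tk] 3 TS(2)[of N] by (simp add: t_def)
    next
      case 4
      then have z: "is_zero_obj C (Cob K n)" using R(2,3) by blast
      note AB = homotopy_Hom[OF R(1) L hh, of n]
      have "\<chi> n \<in> Hom C (Cob K n) (Cob L n)"
        using 4 complexD(2)[OF R(1)] complexD(2)[OF L] by (auto simp: \<chi>_def)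
      then have "\<chi> n \<boxplus> (Cdf L (n - 1) \<cdot> h n \<boxplus> h (n + 1) \<cdot> Cdf K n) \<in> Hom C (Cob K n) (Cob L n)"
        using add_Hom AB by blast
      then show ?thesis using zero_obj_from[OF z] chain_mapD(1)[OF \<psi>] by metis
    qed
  qed
  with g' gd show ?thesis by (intro that[of g]) (simp_all add: \<chi>_def[abs_def])
qed

text \<open>
  Where \<open>\<phi>\<close> and \<open>\<psi>\<close> agree, the homotopy \<open>h\<close> anticommutes with the differentials. So it is a chain map
  from the terms of \<open>K\<close> of positive degree to \<open>L\<close> with the negative differential, and it vanishes on the syzygy
  \<open>E 1\<close>. By the comparison theorem its last components are \<open>h\<^sup>N = t s + k q\<close> and \<open>h\<^bsup>N+1\<^esup> = t k\<close> for the differential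
  \<open>t\<close> of \<open>L\<close> up to sign. Hence the differential of \<open>h\<^bsup>N+1\<^esup>\<close>, by which \<open>\<phi>\<close> and \<open>\<psi>\<close> differ in the last degree, is
  zero.
\<close>

lemma homotopic_rigid:
  assumes K: "relative_coresolution C N K E a q \<T>" and L: "is_complex C L"
    and L0: "\<And>n. n < 0 \<Longrightarrow> is_zero_obj C (Cob L n)"
    and LT: "\<And>n. n \<le> N \<Longrightarrow> Cob L (int n) \<in> \<T>"
    and \<phi>: "chain_map C K L \<phi>" and "homotopic C K L \<phi> \<psi>"
    and eq: "\<And>n. n \<le> N \<Longrightarrow> \<phi> (int n) = \<psi> (int n)"
  shows "\<phi> (int N + 1) = \<psi> (int N + 1)"
proof -
  obtain h where h: "\<And>n. h n \<in> Hom C (Cob K n) (Cob L (n - 1))"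
    "\<And>n. \<psi> n = \<phi> n \<boxplus> (Cdf L (n - 1) \<cdot> h n \<boxplus> h (n + 1) \<cdot> Cdf K n)"
    using assms(6) unfolding homotopic_def by blast
  note R = relative_coresolutionD[OF K]
  note AB = homotopy_Hom[OF R(1) L h(1)]
  have z: "Cdf L (int n - 1) \<cdot> h (int n) \<boxplus> h (int n + 1) \<cdot> Cdf K (int n) = Zer C (Cob K (int n)) (Cob L (int n))"
    if "n \<le> N" for n
  proof (rule add_left_imp_eq)
    note p = chain_mapD(1)[OF \<phi>, of "int n"]
    show "\<phi> (int n) \<boxplus> (Cdf L (int n - 1) \<cdot> h (int n) \<boxplus> h (int n + 1) \<cdot> Cdf K (int n)) =
        \<phi> (int n) \<boxplus> Zer C (Cob K (int n)) (Cob L (int n))"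
      using h(2)[of "int n"] eq[OF that] add_zero[OF p] by simp
  qed (use add_Hom[OF AB] chain_mapD(1)[OF \<phi>] complexD(2)[OF R(1)] complexD(2)[OF L] in auto)
  have h0: "h 0 = Zer C (Cob K 0) (Cob L (-1))" using zero_obj_into[OF L0] h(1)[of 0] by simp
  then have A: "Cdf L (0 - 1) \<cdot> h 0 = Zer C (Cob K 0) (Cob L 0)"
    using comp_zero[OF complexD(2)[OF R(1)] complexD(4)[OF L], of 0 0] by simp
  have h1: "h 1 \<in> Hom C (Cob K 1) (Cob L 0)" using h(1)[of 1] by simp
  have h1d: "h 1 \<cdot> Cdf K 0 = Zer C (Cob K 0) (Cob L 0)"
    using z[of 0] A zero_add AB(2)[of 0] by simp
  have main: "Cdf L (int N) \<cdot> h (int N + 1) = Zer C (Cob K (int N + 1)) (Cob L (int N + 1))"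
  proof (cases N)
    case 0
    have a: "a 0 \<in> Hom C (E 0) (Cob K 0)" and q: "q 0 \<in> Hom C (Cob K 0) (Cob K 1)"
      using R(4)[of 0] R(5)[of 0] R(7) 0 by auto
    have o: "Zer C (Cob K 1) (Cob L 0) \<in> Hom C (Cob K 1) (Cob L 0)"
      using complexD(2)[OF R(1)] complexD(2)[OF L] by simp
    have "h 1 \<cdot> q 0 = Zer C (Cob K 1) (Cob L 0) \<cdot> q 0"
      using h1d R(8) 0 zero_comp[OF q complexD(2)[OF L]] by simp
    then have "h 1 = Zer C (Cob K 1) (Cob L 0)"
      using hom_exact_unique[OF R(6) a q h1 o] LT[of 0] 0 by simp
    then show ?thesis using comp_zero[OF complexD(2)[OF R(1)] complexD(1)[OF L]] 0 by simp
  next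
    case (Suc M)
    \<comment> \<open>the comparison theorem for \<open>K\<close> shifted by one degree and \<open>L\<close> with the differential negated\<close>
    define F where "F n = Cob K (int (Suc n))" for n
    define T where "T n = Cob L (int n - 1)" for n
    define t where "t n = \<boxminus> Cdf L (int n - 1)" for n
    define \<delta> where "\<delta> n = h (int (Suc n))" for n
    have TS: "T (Suc n) = Cob L (int n)" "t (Suc n) = \<boxminus> Cdf L (int n)" for n by (simp_all add: T_def t_def)
    have dL: "Cdf L (int n - 1) \<in> Hom C (T n) (T (Suc n))" for n
      using complexD(4)[OF L, of "int n"] TS by (simp add: T_def)
    have dLS: "Cdf L (int n) \<in> Hom C (T (Suc n)) (T (Suc (Suc n)))" for n using dL[of "Suc n"] by simp
    have t: "t n \<in> Hom C (T n) (T (Suc n))" for n unfolding t_def using neg_Hom[OF dL] .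
    have dd: "Cdf L (int n) \<cdot> Cdf L (int n - 1) = Zer C (T n) (T (Suc (Suc n)))" for n
      using complexD(5)[OF L, of "int n"] TS(1)[of "Suc n"] by (simp add: T_def add.commute)
    have oT: "T n \<in> Obj C" for n unfolding T_def using complexD(2)[OF L] .
    have neg0: "\<boxminus> Zer C x y = Zer C x y" if "x \<in> Obj C" "y \<in> Obj C" for x y
      using neg_unique[OF add_zero] zero_Hom[OF that] by metis
    have tt: "t (Suc n) \<cdot> t n = Zer C (T n) (T (Suc (Suc n)))" for n
      using comp_neg[OF dL neg_Hom[OF dLS]] neg_comp[OF dL dLS] dd neg0[OF oT oT] by (simp add: TS(2) t_def)
    have \<delta>h: "\<delta> n \<in> Hom C (F n) (T (Suc n))" for n
      using h(1)[of "int (Suc n)"] by (simp add: \<delta>_def F_def T_def)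
    have FN: "F (Suc M) = E (Suc (Suc M))" using R(7) Suc by (simp add: F_def add.commute)
    have aq: "a (Suc n) \<in> Hom C (E (Suc n)) (F n)" "q (Suc n) \<in> Hom C (F n) (E (Suc (Suc n)))" if "n \<le> M" for n
      using R(4)[of "Suc n"] R(5)[of "Suc n"] Suc that by (simp_all add: F_def)
    have ex: "hom_exact C (a (Suc n)) (q (Suc n)) (T (Suc m))" if "n \<le> M" "m \<le> M" for n m
      using R(6)[of "Suc n"] LT[of m] Suc that by (simp add: TS)
    have anti: "\<delta> (Suc n) \<cdot> Cdf K (int (Suc n)) = t (Suc n) \<cdot> \<delta> n" if "n \<le> M" for n
    proof -
      have "Cdf L (int n) \<cdot> \<delta> n \<boxplus> \<delta> (Suc n) \<cdot> Cdf K (int (Suc n)) = Zer C (F n) (T (Suc (Suc n)))"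
        using z[of "Suc n"] that Suc TS(1)[of "Suc n"] by (simp add: \<delta>_def F_def add.commute)
      moreover have "Cdf K (int (Suc n)) \<in> Hom C (F n) (F (Suc n))"
        using complexD(1)[OF R(1), of "int (Suc n)"] by (simp add: F_def add.commute)
      ultimately have "\<delta> (Suc n) \<cdot> Cdf K (int (Suc n)) = \<boxminus> (Cdf L (int n) \<cdot> \<delta> n)"
        using neg_unique comp_Hom[OF \<delta>h dLS] comp_Hom[OF _ \<delta>h] by blast
      then show ?thesis using neg_comp[OF \<delta>h dLS] by (simp add: TS)
    qed
    have \<delta>d: "\<delta> (Suc n) \<cdot> (a (Suc (Suc n)) \<cdot> q (Suc n)) = t (Suc n) \<cdot> \<delta> n" if "n < M" for n
      using anti[of n] R(9)[of "Suc n"] that Suc by simp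
    have \<delta>0: "\<delta> 0 \<cdot> a (Suc 0) = Zer C (E (Suc 0)) (T (Suc 0))"
    proof -
      have a: "a 0 \<in> Hom C (E 0) (Cob K 0)" and q: "q 0 \<in> Hom C (Cob K 0) (E (Suc 0))"
        and e: "hom_exact C (a 0) (q 0) (T (Suc 0))"
        using R(4)[of 0] R(5)[of 0] R(6)[of 0] LT[of 0] by (auto simp: TS)
      have "(\<delta> 0 \<cdot> a (Suc 0)) \<cdot> q 0 = Zer C (E (Suc 0)) (T (Suc 0)) \<cdot> q 0"
        using comp_assoc[OF q aq(1)[of 0] \<delta>h] h1d R(9)[of 0] Suc zero_comp[OF q oT[of "Suc 0"]] by (simp add: \<delta>_def TS)
      then show ?thesis
        using hom_exact_unique[OF e a q comp_Hom[OF aq(1)[of 0] \<delta>h] zero_Hom] oT HomD[OF q] by simp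
    qed
    obtain s k where s: "\<And>n. n \<le> M \<Longrightarrow> s n \<in> Hom C (F n) (T n)"
      and k: "k \<in> Hom C (F (Suc M)) (T (Suc M))"
      and \<delta>: "\<delta> M = t M \<cdot> s M \<boxplus> k \<cdot> q (Suc M)"
      using relative_nullhomotopy[of M "\<lambda>n. a (Suc n)" "\<lambda>n. E (Suc n)" F "\<lambda>n. q (Suc n)" T t \<delta>]
        t tt \<delta>h \<delta>d \<delta>0 aq ex FN by (smt (verit, best) order_refl)
    have qM: "q (Suc M) \<in> Hom C (F M) (F (Suc M))" using aq(2)[of M] FN by simp
    have "t (Suc M) \<cdot> \<delta> M = t (Suc M) \<cdot> (k \<cdot> q (Suc M))"
    proof -
      note sM = s[OF order_refl]
      have "t (Suc M) \<cdot> (t M \<cdot> s M) = Zer C (F M) (T (Suc (Suc M)))"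
        using comp_assoc[OF sM t t] tt[of M] zero_comp[OF sM oT] by simp
      then show ?thesis
        using comp_add[OF comp_Hom[OF sM t] comp_Hom[OF qM k] t] \<delta>
          zero_add[OF comp_Hom[OF comp_Hom[OF qM k] t]] by simp
    qed
    then have "\<delta> (Suc M) \<cdot> q (Suc M) = (t (Suc M) \<cdot> k) \<cdot> q (Suc M)"
      using anti[of M] R(8) Suc comp_assoc[OF qM k t] by simp
    then have "\<delta> (Suc M) = t (Suc M) \<cdot> k"
      using hom_exact_unique[OF _ aq(1)[of M] qM \<delta>h comp_Hom[OF k t]] R(6)[of "Suc M"] LT[of "Suc M"] Suc
      by (simp add: TS)
    then have "t (Suc (Suc M)) \<cdot> \<delta> (Suc M) = Zer C (F (Suc M)) (T (Suc (Suc (Suc M))))"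
      using comp_assoc[OF k t t] tt[of "Suc M"] zero_comp[OF k oT] by simp
    then have "\<boxminus> (Cdf L (int (Suc M)) \<cdot> \<delta> (Suc M)) = Zer C (F (Suc M)) (T (Suc (Suc (Suc M))))"
      using neg_comp[OF \<delta>h dLS, of "Suc M"] TS(2)[of "Suc M"] by simp
    then have "Cdf L (int (Suc M)) \<cdot> \<delta> (Suc M) = Zer C (F (Suc M)) (T (Suc (Suc (Suc M))))"
      using add_neg[OF comp_Hom[OF \<delta>h dLS]] add_zero[OF comp_Hom[OF \<delta>h dLS]] by metis
    then show ?thesis using Suc TS(1)[of "Suc (Suc M)"] by (simp add: \<delta>_def F_def add.commute)
  qed
  have "is_zero_obj C (Cob K (int N + 1 + 1))" using R(3) by simp
  then have "h (int N + 1 + 1) = Zer C (Cob K (int N + 1 + 1)) (Cob L (int N + 1))"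
    using zero_obj_from h(1)[of "int N + 1 + 1"] by (simp add: add.commute)
  then have "h (int N + 1 + 1) \<cdot> Cdf K (int N + 1) = Zer C (Cob K (int N + 1)) (Cob L (int N + 1))"
    using zero_comp[OF complexD(1)[OF R(1), of "int N + 1"] complexD(2)[OF L, of "int N + 1"]] by simp
  then have "\<psi> (int N + 1) = \<phi> (int N + 1) \<boxplus> (Zer C (Cob K (int N + 1)) (Cob L (int N + 1)) \<boxplus>
      Zer C (Cob K (int N + 1)) (Cob L (int N + 1)))"
    using h(2)[of "int N + 1"] main by simp
  then show ?thesis
    using add_zero zero_Hom complexD(2)[OF R(1)] complexD(2)[OF L] chain_mapD(1)[OF \<phi>] by metis
qed

end

section \<open>Kernels, stable subcategories and derived functors in degree zero\<close>

context preadditive_category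
begin

lemma kernelD:
  assumes "is_kernel C f k" "f \<in> Hom C x y"
  shows "k \<in> Hom C (Dom C k) x" "f \<cdot> k = Zer C (Dom C k) y"
    and kernel_lift: "\<And>w h. h \<in> Hom C w x \<Longrightarrow> f \<cdot> h = Zer C w y \<Longrightarrow> \<exists>e \<in> Hom C w (Dom C k). k \<cdot> e = h"
    and kernel_unique: "\<And>w e e'. e \<in> Hom C w (Dom C k) \<Longrightarrow> e' \<in> Hom C w (Dom C k) \<Longrightarrow> k \<cdot> e = k \<cdot> e' \<Longrightarrow> e = e'"
proof -
  note f = HomD[OF assms(2)]
  show k: "k \<in> Hom C (Dom C k) x" and z: "f \<cdot> k = Zer C (Dom C k) y"
    using assms f Arr_Hom[of k] unfolding is_kernel_def by auto
  have *: "\<exists>!e. e \<in> Hom C w (Dom C k) \<and> k \<cdot> e = h" if "h \<in> Hom C w x" "f \<cdot> h = Zer C w y" for w h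
    using assms(1) f that unfolding is_kernel_def by blast
  then show "\<exists>e \<in> Hom C w (Dom C k). k \<cdot> e = h" if "h \<in> Hom C w x" "f \<cdot> h = Zer C w y" for w h
    using that by blast
  show "e = e'" if e: "e \<in> Hom C w (Dom C k)" "e' \<in> Hom C w (Dom C k)" "k \<cdot> e = k \<cdot> e'" for w e e'
  proof -
    have "f \<cdot> (k \<cdot> e) = Zer C w y"
      using comp_assoc[OF e(1) k assms(2)] z zero_comp[OF e(1)] f by simp
    then show ?thesis using *[OF comp_Hom[OF e(1) k]] e by metis
  qed
qed

lemma kernelI:
  assumes "f \<in> Hom C x y" "k \<in> Hom C z x" "f \<cdot> k = Zer C z y"
    "\<And>w h. h \<in> Hom C w x \<Longrightarrow> f \<cdot> h = Zer C w y \<Longrightarrow> \<exists>e \<in> Hom C w z. k \<cdot> e = h"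
    "\<And>w e e'. e \<in> Hom C w z \<Longrightarrow> e' \<in> Hom C w z \<Longrightarrow> k \<cdot> e = k \<cdot> e' \<Longrightarrow> e = e'"
  shows "is_kernel C f k"
  using assms HomD[OF assms(1)] HomD[OF assms(2)] unfolding is_kernel_def by metis

lemma cokernelD:
  assumes "is_cokernel C f c" "f \<in> Hom C x y"
  shows "c \<in> Hom C y (Cod C c)" "c \<cdot> f = Zer C x (Cod C c)"
    and cokernel_factor: "\<And>w h. h \<in> Hom C y w \<Longrightarrow> h \<cdot> f = Zer C x w \<Longrightarrow> \<exists>e \<in> Hom C (Cod C c) w. e \<cdot> c = h"
    and cokernel_unique: "\<And>w e e'. e \<in> Hom C (Cod C c) w \<Longrightarrow> e' \<in> Hom C (Cod C c) w \<Longrightarrow> e \<cdot> c = e' \<cdot> c \<Longrightarrow> e = e'"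
proof -
  note f = HomD[OF assms(2)]
  show c: "c \<in> Hom C y (Cod C c)" and z: "c \<cdot> f = Zer C x (Cod C c)"
    using assms f Arr_Hom[of c] unfolding is_cokernel_def by auto
  have *: "\<exists>!e. e \<in> Hom C (Cod C c) w \<and> e \<cdot> c = h" if "h \<in> Hom C y w" "h \<cdot> f = Zer C x w" for w h
    using assms(1) f that unfolding is_cokernel_def by blast
  then show "\<exists>e \<in> Hom C (Cod C c) w. e \<cdot> c = h" if "h \<in> Hom C y w" "h \<cdot> f = Zer C x w" for w h
    using that by blast
  show "e = e'" if e: "e \<in> Hom C (Cod C c) w" "e' \<in> Hom C (Cod C c) w" "e \<cdot> c = e' \<cdot> c" for w e e'
  proof -
    have "(e \<cdot> c) \<cdot> f = Zer C x w"
      using comp_assoc[OF assms(2) c e(1)] z comp_zero[OF _ e(1)] f by simp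
    then show ?thesis using *[OF comp_Hom[OF c e(1)]] e by metis
  qed
qed

lemma zero_kernel_Ident: "x \<in> Obj C \<Longrightarrow> y \<in> Obj C \<Longrightarrow> is_kernel C (Zer C x y) (Ident C x)"
  by (rule kernelI[of _ x y _ x]) (auto simp: comp_id[OF zero_Hom] id_comp)

lemma zero_cokernel_Ident:
  assumes "x \<in> Obj C" "y \<in> Obj C" shows "is_cokernel C (Zer C x y) (Ident C y)"
proof -
  have "\<exists>!e. e \<in> Hom C y z \<and> e \<cdot> Ident C y = h" if "h \<in> Hom C y z" for z h
    using that comp_id by metis
  then show ?thesis
    using assms HomD[OF zero_Hom[OF assms]] HomD[OF Ident_Hom[OF assms(2)]] id_comp[OF zero_Hom[OF assms]]
    unfolding is_cokernel_def by auto
qed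

text \<open>
  If \<open>a\<close> is the kernel of \<open>f\<close>, then \<open>f\<close> factors through the cokernel \<open>q\<close>, so that \<open>q\<close> kills no more than \<open>f\<close>.
\<close>

lemma mono_is_kernel:
  assumes "is_kernel C f a" "a \<in> Hom C x y" "is_cokernel C a q"
  shows "is_kernel C q a"
proof -
  have "f \<in> Hom C y (Cod C f)"
    using assms(1) HomD[OF assms(2)] Arr_Hom[of f] unfolding is_kernel_def by auto
  note f = this
  have x: "Dom C a = x" using HomD[OF assms(2)] by simp
  note q = cokernelD[OF assms(3,2)] and a = kernelD[OF assms(1) f, unfolded x]
  obtain e where e: "e \<in> Hom C (Cod C q) (Cod C f)" "e \<cdot> q = f" using q(3)[OF f a(2)] by blast
  show ?thesis
  proof (rule kernelI[OF q(1) assms(2) q(2) _ a(4)])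
    fix w h
    assume h: "h \<in> Hom C w y" "q \<cdot> h = Zer C w (Cod C q)"
    have "f \<cdot> h = Zer C w (Cod C f)"
      using comp_assoc[OF h(1) q(1) e(1)] e(2) h(2) comp_zero[OF _ e(1)] HomD[OF h(1)] by simp
    then show "\<exists>e \<in> Hom C w x. a \<cdot> e = h" using a(3)[OF h(1)] by blast
  qed
qed

end

locale stable_subcategory = preadditive_category C
  for C :: "('o, 'a, 'z) add_cat_scheme" +
  fixes S :: "'o set"
  assumes abelian: "abelian_category C" and stable: "stable_abelian_subcat C S"
begin

lemma ex_kernel: "f \<in> Hom C x y \<Longrightarrow> \<exists>k. is_kernel C f k"
  and ex_cokernel: "f \<in> Hom C x y \<Longrightarrow> \<exists>c. is_cokernel C f c"
  using abelian HomD unfolding abelian_category_def by blast+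

lemma mono_kernel_of_cokernel:
  assumes "is_mono C a" "a \<in> Hom C x y" "is_cokernel C a q"
  shows "is_kernel C q a"
  using abelian assms mono_is_kernel unfolding abelian_category_def by blast

lemma zero_obj: "is_zero_obj C (zero_obj C)"
  using abelian someI_ex[of "is_zero_obj C"] unfolding abelian_category_def zero_obj_def by blast

lemma S_Obj: "x \<in> S \<Longrightarrow> x \<in> Obj C" 
  using stable unfolding stable_abelian_subcat_def by blast

lemma kernel_in: "is_kernel C f k \<Longrightarrow> f \<in> Hom C x y \<Longrightarrow> x \<in> S \<Longrightarrow> y \<in> S \<Longrightarrow> Dom C k \<in> S"
  using stable HomD unfolding stable_abelian_subcat_def by blast

lemma cokernel_in: "is_cokernel C f c \<Longrightarrow> f \<in> Hom C x y \<Longrightarrow> x \<in> S \<Longrightarrow> y \<in> S \<Longrightarrow> Cod C c \<in> S"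
  using stable HomD unfolding stable_abelian_subcat_def by blast

text \<open>
  An isomorphism onto \<open>y\<close> is a kernel of the zero arrow of \<open>y\<close>.
\<close>

lemma iso_closed:
  assumes "y \<in> S" "f \<in> Hom C x y" "g \<in> Hom C y x" "g \<cdot> f = Ident C x" "f \<cdot> g = Ident C y"
  shows "x \<in> S"
proof -
  have y: "y \<in> Obj C" "x \<in> Obj C" using HomD[OF assms(2)] by auto
  have "is_kernel C (Zer C y y) f"
  proof (rule kernelI[OF zero_Hom[OF y(1,1)] assms(2) zero_comp[OF assms(2) y(1)]])
    show "\<exists>e \<in> Hom C w x. f \<cdot> e = h" if "h \<in> Hom C w y" for w h
      using comp_assoc[OF that assms(3,2)] assms(5) id_comp[OF that] comp_Hom[OF that assms(3)] by metis
    show "e = e'" if "e \<in> Hom C w x" "e' \<in> Hom C w x" "f \<cdot> e = f \<cdot> e'" for w e e'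
      using comp_assoc[OF that(1) assms(2,3)] comp_assoc[OF that(2) assms(2,3)] that assms(4) id_comp by metis
  qed
  then show ?thesis using kernel_in[OF _ zero_Hom[OF y(1,1)] assms(1,1)] HomD[OF assms(2)] by blast
qed

text \<open>
  A zero object of the subcategory has only one endomorphism, hence is a zero object of the whole category.
\<close>

lemma zero_obj_in:
  assumes "is_zero_obj C z" shows "z \<in> S"
proof -
  obtain z' where "is_zero_obj (full_subcat C S) z'"
    using stable unfolding stable_abelian_subcat_def abelian_category_def by blast
  then have z': "z' \<in> S" "z' \<in> Obj C" and u: "\<exists>!f. f \<in> Hom (full_subcat C S) z' z'"
    unfolding is_zero_obj_def full_subcat_def by auto
  have "Hom (full_subcat C S) z' z' = Hom C z' z'"
    using z' by (auto simp: Hom_def full_subcat_def)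
  then have i: "Ident C z' = Zer C z' z'" using u Ident_Hom[OF z'(2)] zero_Hom[OF z'(2,2)] by auto
  have z: "z \<in> Obj C" using assms unfolding is_zero_obj_def by blast
  show ?thesis
  proof (rule iso_closed[OF z'(1) zero_Hom[OF z z'(2)] zero_Hom[OF z'(2) z]])
    show "Zer C z' z \<cdot> Zer C z z' = Ident C z"
      using zero_comp[OF zero_Hom[OF z z'(2)] z] zero_obj_into[OF assms Ident_Hom[OF z]] by simp
    show "Zer C z z' \<cdot> Zer C z' z = Ident C z'"
      using zero_comp[OF zero_Hom[OF z'(2) z] z'(2)] i by simp
  qed
qed

lemma cohomology_in_terms:
  assumes K: "is_complex C K" and S: "\<And>n. Cob K n \<in> S"
  shows "cohomology_in C S K"
  unfolding cohomology_in_def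
proof
  fix n
  note d = complexD(1)[OF K, of n] and d' = complexD(4)[OF K, of n]
  obtain k where k: "is_kernel C (Cdf K n) k" using ex_kernel[OF d] by blast
  obtain b where b: "b \<in> Hom C (Cob K (n - 1)) (Dom C k)" "k \<cdot> b = Cdf K (n - 1)"
    using kernel_lift[OF k d d' complexD(5)[OF K]] by blast
  obtain c where c: "is_cokernel C b c" using ex_cokernel[OF b(1)] by blast
  have "Cod C c \<in> S" using cokernel_in[OF c b(1) S kernel_in[OF k d S S]] .
  then show "\<exists>H \<in> S. is_cohomology C K n H"
    using k b c unfolding is_cohomology_def cohomology_data_def by blast
qed

lemma conc_cplx_in_Dplus:
  assumes "A \<in> S" shows "in_Dplus C S (conc_cplx C A)"
proof -
  have z: "zero_obj C \<in> S" using zero_obj_in[OF zero_obj] .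
  have t: "Cob (conc_cplx C A) n \<in> S" for n using assms z by (simp add: conc_cplx_def Let_def)
  have K: "is_complex C (conc_cplx C A)"
    using S_Obj[OF t] zero_comp[OF zero_Hom] unfolding is_complex_def by (auto simp: conc_cplx_def Let_def)
  have "bounded_below C (conc_cplx C A)"
    unfolding bounded_below_def using zero_obj by (intro exI[of _ 0]) (simp add: conc_cplx_def Let_def)
  then show ?thesis using K cohomology_in_terms[OF K t] by (simp add: in_Dplus_def)
qed

text \<open>
  The complex with \<open>A\<close> in degree \<open>0\<close> has cohomology \<open>A\<close> there. As \<open>I\<close> starts in degree \<open>0\<close>, its cohomology in
  this degree is the kernel of the first differential, and the quasi-isomorphism identifies the two.
\<close>

lemma injective_resolution_kernel:
  assumes A: "A \<in> S" and I: "injective_resolution C (conc_cplx C A) I \<rho>"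
  shows "is_kernel C (Cdf I 0) (\<rho> 0)" "is_zero_obj C (Cob I (-1))"
proof -
  define K where "K = conc_cplx C A"
  have cI: "is_complex C I" and q: "quasi_iso C K I \<rho>" and \<rho>: "chain_map C K I \<rho>"
    and bd: "\<And>a. (\<forall>n<a. is_zero_obj C (Cob K n)) \<Longrightarrow> (\<forall>n<a. is_zero_obj C (Cob I n))"
    using I unfolding injective_resolution_def quasi_iso_def K_def by auto
  have cK: "is_complex C K" using conc_cplx_in_Dplus[OF A] by (simp add: in_Dplus_def K_def)
  have "\<forall>n<0. is_zero_obj C (Cob K n)" using zero_obj by (simp add: K_def conc_cplx_def Let_def)
  then show zI: "is_zero_obj C (Cob I (-1))" using bd[of 0] by auto
  have K0: "Cob K 0 = A" "Cdf K 0 = Zer C A (Cob K 1)" "Cdf K (-1) = Zer C (Cob K (-1)) A"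
    by (simp_all add: K_def conc_cplx_def Let_def)
  have AO: "A \<in> Obj C" and O: "Cob K n \<in> Obj C" "Cob I n \<in> Obj C" for n
    using S_Obj[OF A] complexD(2)[OF cK] complexD(2)[OF cI] by auto
  note d = complexD(1)[OF cI, of 0]
  have \<rho>0: "\<rho> 0 \<in> Hom C A (Cob I 0)" using chain_mapD(1)[OF \<rho>, of 0] K0 by simp
  have "Cdf I 0 \<cdot> \<rho> 0 = Zer C A (Cob I (0 + 1))"
    using chain_mapD(2)[OF \<rho>, of 0] K0(2) comp_zero[OF AO chain_mapD(1)[OF \<rho>, of 1]] by simp
  note d\<rho> = this
  obtain k where k: "is_kernel C (Cdf I 0) k" using ex_kernel[OF d] by blast
  note kd = kernelD[OF k d]
  obtain z where z: "z \<in> Hom C A (Dom C k)" "k \<cdot> z = \<rho> 0" using kd(3)[OF \<rho>0 d\<rho>] by blast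
  have kO: "Dom C k \<in> Obj C" using HomD[OF z(1)] by blast
  have "cohomology_data C K 0 (Ident C A) (Ident C A)"
    unfolding cohomology_data_def
    using zero_kernel_Ident[OF AO O(1)[of 1]] zero_cokernel_Ident[OF O(1)[of "-1"] AO] K0
      zero_Hom[OF O(1)[of "-1"] AO] id_comp[OF zero_Hom[OF O(1)[of "-1"] AO]] HomD[OF Ident_Hom[OF AO]]
    by (metis diff_0)
  moreover have "cohomology_data C I 0 k (Ident C (Dom C k))"
  proof -
    have "k \<cdot> Zer C (Cob I (-1)) (Dom C k) = Cdf I (-1)"
      using comp_zero[OF O(2) kd(1)] zero_obj_from[OF zI complexD(1)[OF cI, of "-1"]] by simp
    then show ?thesis
      unfolding cohomology_data_def using k zero_cokernel_Ident[OF O(2)[of "-1"] kO] zero_Hom[OF O(2)[of "-1"] kO]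
      by (metis diff_0)
  qed
  moreover have "Dom C (Ident C x) = x" "Cod C (Ident C x) = x" if "x \<in> Obj C" for x
    using HomD[OF Ident_Hom[OF that]] by auto
  ultimately have "is_iso C z"
    using q z AO kO comp_id[OF z(1)] id_comp[OF z(1)] comp_id[OF \<rho>0] unfolding quasi_iso_def by metis
  then obtain y where y: "y \<in> Hom C (Dom C k) A" "y \<cdot> z = Ident C A" "z \<cdot> y = Ident C (Dom C k)"
    using HomD[OF z(1)] unfolding is_iso_def by auto
  show "is_kernel C (Cdf I 0) (\<rho> 0)"
  proof (rule kernelI[OF d \<rho>0 d\<rho>])
    fix w h
    assume h: "h \<in> Hom C w (Cob I 0)" "Cdf I 0 \<cdot> h = Zer C w (Cob I (0 + 1))"
    obtain e where e: "e \<in> Hom C w (Dom C k)" "k \<cdot> e = h" using kd(3)[OF h] by blast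
    have "\<rho> 0 \<cdot> (y \<cdot> e) = k \<cdot> ((z \<cdot> y) \<cdot> e)"
      using comp_assoc[OF comp_Hom[OF e(1) y(1)] z(1) kd(1)] comp_assoc[OF e(1) y(1) z(1)] z(2) by simp
    then have "\<rho> 0 \<cdot> (y \<cdot> e) = h" using y(3) id_comp[OF e(1)] e(2) by simp
    then show "\<exists>e \<in> Hom C w A. \<rho> 0 \<cdot> e = h" using comp_Hom[OF e(1) y(1)] by blast
  next
    fix w e e'
    assume e: "e \<in> Hom C w A" "e' \<in> Hom C w A" "\<rho> 0 \<cdot> e = \<rho> 0 \<cdot> e'"
    have "z \<cdot> e = z \<cdot> e'"
      using e(3) z(2) comp_assoc[OF e(1) z(1) kd(1)] comp_assoc[OF e(2) z(1) kd(1)]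
        kd(4)[OF comp_Hom[OF e(1) z(1)] comp_Hom[OF e(2) z(1)]] by simp
    then show "e = e'"
      using comp_assoc[OF e(1) z(1) y(1)] comp_assoc[OF e(2) z(1) y(1)] y(2) id_comp[OF e(1)] id_comp[OF e(2)]
      by simp
  qed
qed

end

text \<open>
  \<open>T A\<close> is the cohomology of \<open>\<^bold>R T A\<close> in degree \<open>0\<close>: a left exact functor turns the beginning \<open>0 \<rightarrow> A \<rightarrow> I\<^sup>0 \<rightarrow> I\<^sup>1\<close> of an
  injective resolution into a kernel of \<open>T I\<^sup>0 \<rightarrow> T I\<^sup>1\<close>.
\<close>

lemma derived_degree_zero:
  assumes C: "abelian_category C" "stable_abelian_subcat C S"
    and D: "abelian_category D" "stable_abelian_subcat D S'"
    and T: "left_exact C D T" "derived_induces_Dplus C S D S' T" and A: "A \<in> S"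
  shows "OMap T A \<in> S'"
proof -
  interpret C: stable_subcategory C S
    by unfold_locales (use C in \<open>auto simp: abelian_category_def\<close>)
  interpret D: stable_subcategory D S'
    by unfold_locales (use D in \<open>auto simp: abelian_category_def\<close>)
  obtain I \<rho> where I: "injective_resolution C (conc_cplx C A) I \<rho>" and TI: "in_Dplus D S' (map_cplx T I)"
    using T(2) C.conc_cplx_in_Dplus[OF A] unfolding derived_induces_Dplus_def by blast
  note k0 = C.injective_resolution_kernel[OF A I]
  have add: "additive_functor C D T" and fT: "is_functor C D T"
    and ker: "\<And>f k. is_kernel C f k \<Longrightarrow> is_kernel D (AMap T f) (AMap T k)"
    using T(1) unfolding left_exact_def additive_functor_def by auto
  have \<rho>0: "\<rho> 0 \<in> Hom C A (Cob I 0)"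
    using I unfolding injective_resolution_def quasi_iso_def chain_map_def
    by (auto simp: conc_cplx_def Let_def dest: spec[of _ 0])
  have T\<rho>: "AMap T (\<rho> 0) \<in> Hom D (OMap T A) (OMap T (Cob I 0))"
    using fT \<rho>0 unfolding is_functor_def by blast
  have zO: "Cob I (-1) \<in> Obj C" using k0(2) unfolding is_zero_obj_def by blast
  have TZ: "AMap T (Zer C x y) = Zer D (OMap T x) (OMap T y)" if "x \<in> Obj C" "y \<in> Obj C" for x y
  proof -
    note o = C.zero_Hom[OF that]
    have To: "AMap T (Zer C x y) \<in> Hom D (OMap T x) (OMap T y)" using fT o unfolding is_functor_def by blast
    have "AMap T (Zer C x y) = Add D (AMap T (Zer C x y)) (AMap T (Zer C x y))"
      using add o C.zero_add[OF o] unfolding additive_functor_def by metis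
    then show ?thesis
      using D.add_left_imp_eq[OF _ To To] D.add_zero[OF To] D.HomD[OF To] D.zero_Hom by metis
  qed
  have zT: "is_zero_obj D (OMap T (Cob I (-1)))"
  proof (rule D.zero_objI)
    show "OMap T (Cob I (-1)) \<in> Obj D" using fT zO unfolding is_functor_def by blast
    have "AMap T (Ident C (Cob I (-1))) = AMap T (Zer C (Cob I (-1)) (Cob I (-1)))"
      using C.zero_obj_into[OF k0(2) C.Ident_Hom[OF zO]] by simp
    then show "Ident D (OMap T (Cob I (-1))) = Zer D (OMap T (Cob I (-1))) (OMap T (Cob I (-1)))"
      using fT zO TZ[OF zO zO] unfolding is_functor_def by metis
  qed
  define J where "J = map_cplx T I"
  have cJ: "is_complex D J" using TI by (simp add: in_Dplus_def J_def)
  have J: "Cob J n = OMap T (Cob I n)" "Cdf J n = AMap T (Cdf I n)" for n by (simp_all add: J_def map_cplx_def)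
  obtain H k c b where H: "H \<in> S'" "is_kernel D (Cdf J 0) k"
    and b: "b \<in> Hom D (Cob J (-1)) (Dom D k)" and c: "is_cokernel D b c" "Cod D c = H"
    using TI unfolding in_Dplus_def cohomology_in_def is_cohomology_def cohomology_data_def J_def
    by (metis diff_0)
  note d = D.complexD(1)[OF cJ, of 0]
  note kd = D.kernelD[OF H(2) d]
  have kO: "Dom D k \<in> Obj D" using D.HomD[OF b] by blast
  have b0: "b = Zer D (Cob J (-1)) (Dom D k)" using D.zero_obj_from[OF _ b] zT J by simp
  note cd = D.cokernelD[OF c(1) b, unfolded c(2)]
  obtain e where e: "e \<in> Hom D H (Dom D k)" "Comp D e c = Ident D (Dom D k)"
    using cd(3)[OF D.Ident_Hom[OF kO]] D.id_comp[OF b] b0 by auto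
  have HO: "H \<in> Obj D" using D.HomD[OF e(1)] by blast
  have "Comp D (Comp D c e) c = Comp D (Ident D H) c"
    using D.comp_assoc[OF cd(1) e(1) cd(1)] e(2) D.comp_id[OF cd(1)] D.id_comp[OF cd(1)] by simp
  then have "Comp D c e = Ident D H" using cd(4)[OF D.comp_Hom[OF e(1) cd(1)] D.Ident_Hom[OF HO]] by blast
  then have kS: "Dom D k \<in> S'" using D.iso_closed[OF H(1) cd(1) e] by blast
  define r where "r = AMap T (\<rho> 0)"
  have r: "is_kernel D (Cdf J 0) r" "r \<in> Hom D (OMap T A) (Cob J 0)" "Dom D r = OMap T A"
    using ker[OF k0(1)] T\<rho> D.HomD[OF T\<rho>] J by (simp_all add: r_def)
  note rd = D.kernelD[OF r(1) d, unfolded r(3)]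
  obtain f where f: "f \<in> Hom D (OMap T A) (Dom D k)" "Comp D k f = r" using kd(3)[OF rd(1,2)] by blast
  obtain g where g: "g \<in> Hom D (Dom D k) (OMap T A)" "Comp D r g = k" using rd(3)[OF kd(1,2)] by blast
  have "Comp D g f = Ident D (OMap T A)"
  proof (rule rd(4)[OF D.comp_Hom[OF f(1) g(1)]])
    show "Ident D (OMap T A) \<in> Hom D (OMap T A) (OMap T A)" using D.Ident_Hom D.HomD[OF f(1)] by blast
    show "Comp D r (Comp D g f) = Comp D r (Ident D (OMap T A))"
      using D.comp_assoc[OF f(1) g(1) rd(1)] g(2) f(2) D.comp_id[OF rd(1)] by simp
  qed
  moreover have "Comp D f g = Ident D (Dom D k)"
  proof (rule kd(4)[OF D.comp_Hom[OF g(1) f(1)] D.Ident_Hom[OF kO]])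
    show "Comp D k (Comp D f g) = Comp D k (Ident D (Dom D k))"
      using D.comp_assoc[OF g(1) f(1) kd(1)] g(2) f(2) D.comp_id[OF kd(1)] by simp
  qed
  ultimately show ?thesis using D.iso_closed[OF kS f(1) g(1)] by blast
qed

section \<open>Sheaves of modules\<close>

lemma ShMod_simps [simp]:
  "Obj (ShMod X \<O>) = Collect (sheaf_of_modules X \<O>)" "Dom (ShMod X \<O>) = Src" "Cod (ShMod X \<O>) = Tgt"
  "Ident (ShMod X \<O>) = (\<lambda>M. mk_arrow X M M (\<lambda>V s. s))"
  "Comp (ShMod X \<O>) = (\<lambda>g f. mk_arrow X (Src f) (Tgt g) (\<lambda>V s. Fun g V (Fun f V s)))"
  "Zer (ShMod X \<O>) = (\<lambda>M N. mk_arrow X M N (\<lambda>V s. \<zero>\<^bsub>MSec N V\<^esub>))"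
  by (simp_all add: ShMod_def)

lemma mk_arrow_simps [simp]:
  "Src (mk_arrow X M N \<phi>) = M" "Tgt (mk_arrow X M N \<phi>) = N"
  "openin X V \<Longrightarrow> s \<in> carrier (MSec M V) \<Longrightarrow> Fun (mk_arrow X M N \<phi>) V s = \<phi> V s"
  by (simp_all add: mk_arrow_def)

lemma mk_arrow_cong:
  assumes "\<And>V s. openin X V \<Longrightarrow> s \<in> carrier (MSec M V) \<Longrightarrow> \<phi> V s = \<psi> V s"
  shows "mk_arrow X M N \<phi> = mk_arrow X M N \<psi>"
  using assms by (auto simp: mk_arrow_def restrict_def fun_eq_iff)

lemma mk_arrow_eta: "mk_arrow X M N (Fun (mk_arrow X M N \<phi>)) = mk_arrow X M N \<phi>"
  by (rule mk_arrow_cong) simp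

lemma sheaf_of_setsD:
  assumes "sheaf_of_sets X S res"
  shows "openin X V \<Longrightarrow> openin X W \<Longrightarrow> V \<subseteq> W \<Longrightarrow> s \<in> S W \<Longrightarrow> res W V s \<in> S V"
    "openin X V \<Longrightarrow> s \<in> S V \<Longrightarrow> res V V s = s"
    "openin X T \<Longrightarrow> openin X V \<Longrightarrow> openin X W \<Longrightarrow> T \<subseteq> V \<Longrightarrow> V \<subseteq> W \<Longrightarrow> s \<in> S W \<Longrightarrow>
      res V T (res W V s) = res W T s"
  using assms by (simp_all add: sheaf_of_sets_def Pi_iff)

lemma sheaf_gluing:
  assumes "sheaf_of_sets X S res" "\<And>V. V \<in> \<V> \<Longrightarrow> openin X V \<and> \<sigma> V \<in> S V"
    "\<And>V W. V \<in> \<V> \<Longrightarrow> W \<in> \<V> \<Longrightarrow> res V (V \<inter> W) (\<sigma> V) = res W (V \<inter> W) (\<sigma> W)"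
  shows "\<exists>!s. s \<in> S (\<Union>\<V>) \<and> (\<forall>V \<in> \<V>. res (\<Union>\<V>) V s = \<sigma> V)"
proof -
  have "\<forall>\<V> \<sigma>. (\<forall>V \<in> \<V>. openin X V \<and> \<sigma> V \<in> S V) \<and>
      (\<forall>V \<in> \<V>. \<forall>W \<in> \<V>. res V (V \<inter> W) (\<sigma> V) = res W (V \<inter> W) (\<sigma> W)) \<longrightarrow>
      (\<exists>!s. s \<in> S (\<Union>\<V>) \<and> (\<forall>V \<in> \<V>. res (\<Union>\<V>) V s = \<sigma> V))"
    using assms(1) unfolding sheaf_of_sets_def by (elim conjE)
  note * = this[THEN spec[of _ \<V>], THEN spec[of _ \<sigma>], THEN mp]
  show ?thesis by (rule *, intro conjI ballI assms(3)) (simp_all add: assms(2))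
qed

lemma sheaf_of_modulesD:
  assumes "sheaf_of_modules X \<O> M"
  shows "sheaf_of_sets X (\<lambda>V. carrier (MSec M V)) (MRes M)"
    "openin X V \<Longrightarrow> left_module (RSec \<O> V) (MSec M V)"
    "openin X V \<Longrightarrow> openin X W \<Longrightarrow> V \<subseteq> W \<Longrightarrow> s \<in> carrier (MSec M W) \<Longrightarrow> MRes M W V s \<in> carrier (MSec M V)"
    "openin X V \<Longrightarrow> s \<in> carrier (MSec M V) \<Longrightarrow> MRes M V V s = s"
    "openin X T \<Longrightarrow> openin X V \<Longrightarrow> openin X W \<Longrightarrow> T \<subseteq> V \<Longrightarrow> V \<subseteq> W \<Longrightarrow> s \<in> carrier (MSec M W) \<Longrightarrow>
      MRes M V T (MRes M W V s) = MRes M W T s"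
    "openin X V \<Longrightarrow> openin X W \<Longrightarrow> V \<subseteq> W \<Longrightarrow> s \<in> carrier (MSec M W) \<Longrightarrow> t \<in> carrier (MSec M W) \<Longrightarrow>
      MRes M W V (s \<oplus>\<^bsub>MSec M W\<^esub> t) = MRes M W V s \<oplus>\<^bsub>MSec M V\<^esub> MRes M W V t"
    "openin X V \<Longrightarrow> openin X W \<Longrightarrow> V \<subseteq> W \<Longrightarrow> a \<in> carrier (RSec \<O> W) \<Longrightarrow> s \<in> carrier (MSec M W) \<Longrightarrow>
      MRes M W V (a \<odot>\<^bsub>MSec M W\<^esub> s) = RRes \<O> W V a \<odot>\<^bsub>MSec M V\<^esub> MRes M W V s"
proof -
  show sets: "sheaf_of_sets X (\<lambda>V. carrier (MSec M V)) (MRes M)"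
    using assms unfolding sheaf_of_modules_def by blast
  note sheaf_of_setsD[OF sets]
  then show "openin X V \<Longrightarrow> openin X W \<Longrightarrow> V \<subseteq> W \<Longrightarrow> s \<in> carrier (MSec M W) \<Longrightarrow> MRes M W V s \<in> carrier (MSec M V)"
    "openin X V \<Longrightarrow> s \<in> carrier (MSec M V) \<Longrightarrow> MRes M V V s = s"
    "openin X T \<Longrightarrow> openin X V \<Longrightarrow> openin X W \<Longrightarrow> T \<subseteq> V \<Longrightarrow> V \<subseteq> W \<Longrightarrow> s \<in> carrier (MSec M W) \<Longrightarrow>
      MRes M V T (MRes M W V s) = MRes M W T s"
    by fast+
  show "openin X V \<Longrightarrow> left_module (RSec \<O> V) (MSec M V)"
    "openin X V \<Longrightarrow> openin X W \<Longrightarrow> V \<subseteq> W \<Longrightarrow> s \<in> carrier (MSec M W) \<Longrightarrow> t \<in> carrier (MSec M W) \<Longrightarrow>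
      MRes M W V (s \<oplus>\<^bsub>MSec M W\<^esub> t) = MRes M W V s \<oplus>\<^bsub>MSec M V\<^esub> MRes M W V t"
    "openin X V \<Longrightarrow> openin X W \<Longrightarrow> V \<subseteq> W \<Longrightarrow> a \<in> carrier (RSec \<O> W) \<Longrightarrow> s \<in> carrier (MSec M W) \<Longrightarrow>
      MRes M W V (a \<odot>\<^bsub>MSec M W\<^esub> s) = RRes \<O> W V a \<odot>\<^bsub>MSec M V\<^esub> MRes M W V s"
    using assms unfolding sheaf_of_modules_def by simp_all
qed

lemma sheaf_module_closed:
  assumes "sheaf_of_modules X \<O> M" "openin X V"
  shows "s \<in> carrier (MSec M V) \<Longrightarrow> t \<in> carrier (MSec M V) \<Longrightarrow> s \<oplus>\<^bsub>MSec M V\<^esub> t \<in> carrier (MSec M V)"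
    "a \<in> carrier (RSec \<O> V) \<Longrightarrow> s \<in> carrier (MSec M V) \<Longrightarrow> a \<odot>\<^bsub>MSec M V\<^esub> s \<in> carrier (MSec M V)"
proof -
  interpret left_module "RSec \<O> V" "MSec M V" using sheaf_of_modulesD(2)[OF assms] .
  show "s \<in> carrier (MSec M V) \<Longrightarrow> t \<in> carrier (MSec M V) \<Longrightarrow> s \<oplus>\<^bsub>MSec M V\<^esub> t \<in> carrier (MSec M V)"
    "a \<in> carrier (RSec \<O> V) \<Longrightarrow> s \<in> carrier (MSec M V) \<Longrightarrow> a \<odot>\<^bsub>MSec M V\<^esub> s \<in> carrier (MSec M V)"
    by simp_all
qed

lemma shmod_homD:
  assumes "shmod_hom X \<O> M N \<phi>"
  shows "openin X V \<Longrightarrow> s \<in> carrier (MSec M V) \<Longrightarrow> \<phi> V s \<in> carrier (MSec N V)"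
    "openin X V \<Longrightarrow> s \<in> carrier (MSec M V) \<Longrightarrow> t \<in> carrier (MSec M V) \<Longrightarrow>
      \<phi> V (s \<oplus>\<^bsub>MSec M V\<^esub> t) = \<phi> V s \<oplus>\<^bsub>MSec N V\<^esub> \<phi> V t"
    "openin X V \<Longrightarrow> a \<in> carrier (RSec \<O> V) \<Longrightarrow> s \<in> carrier (MSec M V) \<Longrightarrow>
      \<phi> V (a \<odot>\<^bsub>MSec M V\<^esub> s) = a \<odot>\<^bsub>MSec N V\<^esub> \<phi> V s"
    "openin X V \<Longrightarrow> openin X W \<Longrightarrow> V \<subseteq> W \<Longrightarrow> s \<in> carrier (MSec M W) \<Longrightarrow>
      \<phi> V (MRes M W V s) = MRes N W V (\<phi> W s)"
  using assms by (simp_all add: shmod_hom_def Pi_iff)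

lemma shmod_homI:
  assumes "\<And>V s. openin X V \<Longrightarrow> s \<in> carrier (MSec M V) \<Longrightarrow> \<phi> V s \<in> carrier (MSec N V)"
    "\<And>V s t. openin X V \<Longrightarrow> s \<in> carrier (MSec M V) \<Longrightarrow> t \<in> carrier (MSec M V) \<Longrightarrow>
      \<phi> V (s \<oplus>\<^bsub>MSec M V\<^esub> t) = \<phi> V s \<oplus>\<^bsub>MSec N V\<^esub> \<phi> V t"
    "\<And>V a s. openin X V \<Longrightarrow> a \<in> carrier (RSec \<O> V) \<Longrightarrow> s \<in> carrier (MSec M V) \<Longrightarrow>
      \<phi> V (a \<odot>\<^bsub>MSec M V\<^esub> s) = a \<odot>\<^bsub>MSec N V\<^esub> \<phi> V s"
    "\<And>V W s. openin X V \<Longrightarrow> openin X W \<Longrightarrow> V \<subseteq> W \<Longrightarrow> s \<in> carrier (MSec M W) \<Longrightarrow>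
      \<phi> V (MRes M W V s) = MRes N W V (\<phi> W s)"
  shows "shmod_hom X \<O> M N \<phi>"
  using assms(1) by (simp add: shmod_hom_def Pi_iff assms(2-4))

lemma shmod_hom_mk_arrow:
  assumes M: "sheaf_of_modules X \<O> M" and h: "shmod_hom X \<O> M N \<phi>"
  shows "shmod_hom X \<O> M N (Fun (mk_arrow X M N \<phi>))"
  by (rule shmod_homI)
    (simp_all add: sheaf_module_closed[OF M] sheaf_of_modulesD(3)[OF M] shmod_homD[OF h])

lemma ShMod_HomI:
  "sheaf_of_modules X \<O> M \<Longrightarrow> sheaf_of_modules X \<O> N \<Longrightarrow> shmod_hom X \<O> M N \<phi> \<Longrightarrow>
    mk_arrow X M N \<phi> \<in> Hom (ShMod X \<O>) M N"
  by (auto simp: Hom_def ShMod_def)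

lemma ShMod_HomD:
  assumes "f \<in> Hom (ShMod X \<O>) M N"
  shows "sheaf_of_modules X \<O> M" "sheaf_of_modules X \<O> N" "Src f = M" "Tgt f = N"
    "shmod_hom X \<O> M N (Fun f)" "mk_arrow X M N (Fun f) = f"
  using assms shmod_hom_mk_arrow mk_arrow_eta by (fastforce simp: Hom_def ShMod_def)+

lemma ShMod_eqI:
  assumes "f \<in> Hom (ShMod X \<O>) M N" "g \<in> Hom (ShMod X \<O>) M N"
    "\<And>V s. openin X V \<Longrightarrow> s \<in> carrier (MSec M V) \<Longrightarrow> Fun f V s = Fun g V s"
  shows "f = g"
  using mk_arrow_cong[of X M "Fun f" "Fun g" N] assms(3) ShMod_HomD(6)[OF assms(1)] ShMod_HomD(6)[OF assms(2)]
  by simp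

section \<open>The open inclusion\<close>

locale open_inclusion =
  fixes X :: "'p topology" and U :: "'p set" and \<O> :: "('p, 'r) ring_psh"
  assumes open_U: "openin X U" and sheaf_\<O>: "sheaf_of_rings X \<O>"
begin

abbreviation "XU \<equiv> subtopology X U"

lemma openin_XU: "openin XU V \<longleftrightarrow> openin X V \<and> V \<subseteq> U"
  using open_U by (auto simp: openin_open_subtopology)

lemma openin_Int: "openin X V \<Longrightarrow> openin X (V \<inter> U) \<and> openin XU (V \<inter> U)"
  using open_U by (auto simp: openin_XU)

lemma RRes_D:
  "openin X V \<Longrightarrow> ring (RSec \<O> V)"
  "openin X V \<Longrightarrow> openin X W \<Longrightarrow> V \<subseteq> W \<Longrightarrow> RRes \<O> W V \<in> ring_hom (RSec \<O> W) (RSec \<O> V)"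
  "openin X V \<Longrightarrow> a \<in> carrier (RSec \<O> V) \<Longrightarrow> RRes \<O> V V a = a"
  "openin X T \<Longrightarrow> openin X V \<Longrightarrow> openin X W \<Longrightarrow> T \<subseteq> V \<Longrightarrow> V \<subseteq> W \<Longrightarrow> a \<in> carrier (RSec \<O> W) \<Longrightarrow>
      RRes \<O> V T (RRes \<O> W V a) = RRes \<O> W T a"
proof -
  have "sheaf_of_sets X (\<lambda>V. carrier (RSec \<O> V)) (RRes \<O>)"
    using sheaf_\<O> by (simp add: sheaf_of_rings_def)
  note sheaf_of_setsD(2,3)[OF this]
  then show "openin X V \<Longrightarrow> a \<in> carrier (RSec \<O> V) \<Longrightarrow> RRes \<O> V V a = a"
    "openin X T \<Longrightarrow> openin X V \<Longrightarrow> openin X W \<Longrightarrow> T \<subseteq> V \<Longrightarrow> V \<subseteq> W \<Longrightarrow> a \<in> carrier (RSec \<O> W) \<Longrightarrow>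
      RRes \<O> V T (RRes \<O> W V a) = RRes \<O> W T a" by fast+
qed (use sheaf_\<O> in \<open>simp_all add: sheaf_of_rings_def\<close>)

lemma RRes_closed:
  "openin X V \<Longrightarrow> openin X W \<Longrightarrow> V \<subseteq> W \<Longrightarrow> a \<in> carrier (RSec \<O> W) \<Longrightarrow> RRes \<O> W V a \<in> carrier (RSec \<O> V)"
  using ring_hom_closed[OF RRes_D(2)] .

lemma sheaf_restrict:
  assumes "sheaf_of_modules X \<O> M" shows "sheaf_of_modules XU \<O> M"
proof -
  note S = sheaf_of_modulesD(1)[OF assms]
  have "sheaf_of_sets XU (\<lambda>V. carrier (MSec M V)) (MRes M)"
    unfolding sheaf_of_sets_def openin_XU
  proof (intro conjI allI impI)
    fix \<V> \<sigma>
    assume "(\<forall>V \<in> \<V>. (openin X V \<and> V \<subseteq> U) \<and> \<sigma> V \<in> carrier (MSec M V)) \<and>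
      (\<forall>V \<in> \<V>. \<forall>W \<in> \<V>. MRes M V (V \<inter> W) (\<sigma> V) = MRes M W (V \<inter> W) (\<sigma> W))"
    then show "\<exists>!s. s \<in> carrier (MSec M (\<Union>\<V>)) \<and> (\<forall>V \<in> \<V>. MRes M (\<Union>\<V>) V s = \<sigma> V)"
      by (intro sheaf_gluing[OF S]) blast+
  qed (use sheaf_of_setsD[OF S] in \<open>auto simp: Pi_iff\<close>)
  then show ?thesis using assms by (simp add: sheaf_of_modules_def openin_XU)
qed

lemma shmod_hom_restrict: "shmod_hom X \<O> M N \<phi> \<Longrightarrow> shmod_hom XU \<O> M N \<phi>"
  by (auto intro!: shmod_homI simp: openin_XU shmod_homD)

lemma j_push_obj_simps [simp]:
  "carrier (MSec (j_push_obj \<O> U M) V) = carrier (MSec M (V \<inter> U))"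
  "add (MSec (j_push_obj \<O> U M) V) = add (MSec M (V \<inter> U))"
  "zero (MSec (j_push_obj \<O> U M) V) = zero (MSec M (V \<inter> U))"
  "smult (MSec (j_push_obj \<O> U M) V) = (\<lambda>a s. RRes \<O> V (V \<inter> U) a \<odot>\<^bsub>MSec M (V \<inter> U)\<^esub> s)"
  "MRes (j_push_obj \<O> U M) W V = MRes M (W \<inter> U) (V \<inter> U)"
  by (simp_all add: j_push_obj_def)

text \<open>
  Members of a covering family may have the same trace on \<open>U\<close>. Compatible sections over such members
  coincide, so that it suffices to glue the sections \<open>\<sigma> (r W)\<close> over the traces \<open>W\<close>, with one member \<open>r W\<close> chosen for
  each trace.
\<close>

lemma sheaf_of_sets_push:
  assumes S: "sheaf_of_sets XU S res"
  shows "sheaf_of_sets X (\<lambda>V. S (V \<inter> U)) (\<lambda>W V. res (W \<inter> U) (V \<inter> U))"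
  unfolding sheaf_of_sets_def
proof (intro conjI allI impI ballI)
  note S' = sheaf_of_setsD[OF S]
  show "res (W \<inter> U) (V \<inter> U) \<in> S (W \<inter> U) \<rightarrow> S (V \<inter> U)" if "openin X V \<and> openin X W \<and> V \<subseteq> W" for V W
    using S'(1)[of "V \<inter> U" "W \<inter> U"] that openin_Int by auto
  show "res (V \<inter> U) (V \<inter> U) s = s" if "openin X V" "s \<in> S (V \<inter> U)" for V s
    using S'(2) that openin_Int[of V] by simp
  show "res (V \<inter> U) (T \<inter> U) (res (W \<inter> U) (V \<inter> U) s) = res (W \<inter> U) (T \<inter> U) s"
    if "openin X T \<and> openin X V \<and> openin X W \<and> T \<subseteq> V \<and> V \<subseteq> W" "s \<in> S (W \<inter> U)" for T V W s
  proof -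
    have "openin XU (T \<inter> U)" "openin XU (V \<inter> U)" "openin XU (W \<inter> U)" "T \<inter> U \<subseteq> V \<inter> U" "V \<inter> U \<subseteq> W \<inter> U"
      using that openin_Int by auto
    then show ?thesis using S'(3) that(2) by simp
  qed
next
  fix \<V> \<sigma>
  assume a: "(\<forall>V \<in> \<V>. openin X V \<and> \<sigma> V \<in> S (V \<inter> U)) \<and>
    (\<forall>V \<in> \<V>. \<forall>W \<in> \<V>. res (V \<inter> U) (V \<inter> W \<inter> U) (\<sigma> V) = res (W \<inter> U) (V \<inter> W \<inter> U) (\<sigma> W))"
  define \<W> where "\<W> = (\<lambda>V. V \<inter> U) ` \<V>"
  define r where "r W = (SOME V. V \<in> \<V> \<and> V \<inter> U = W)" for W
  have r: "r W \<in> \<V> \<and> r W \<inter> U = W" if "W \<in> \<W>" for W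
    using that someI_ex[of "\<lambda>V. V \<in> \<V> \<and> V \<inter> U = W"] by (auto simp: r_def \<W>_def)
  have \<sigma>: "\<sigma> (r (V \<inter> U)) = \<sigma> V" if V: "V \<in> \<V>" for V
  proof -
    have r': "r (V \<inter> U) \<in> \<V>" "r (V \<inter> U) \<inter> U = V \<inter> U" using r[of "V \<inter> U"] V by (auto simp: \<W>_def)
    have id: "res (V \<inter> U) (V \<inter> U) s = s" if "s \<in> S (V \<inter> U)" for s
      using sheaf_of_setsD(2)[OF S] that openin_Int[of V] a V by simp
    have e: "r (V \<inter> U) \<inter> V \<inter> U = V \<inter> U" using r'(2) by blast
    have "res (r (V \<inter> U) \<inter> U) (r (V \<inter> U) \<inter> V \<inter> U) (\<sigma> (r (V \<inter> U))) =
        res (V \<inter> U) (r (V \<inter> U) \<inter> V \<inter> U) (\<sigma> V)"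
      using a V r'(1) by blast
    moreover have "\<sigma> (r (V \<inter> U)) \<in> S (V \<inter> U)" "\<sigma> V \<in> S (V \<inter> U)" using a V r' by metis+
    ultimately show ?thesis using id e r'(2) by simp
  qed
  have U: "\<Union>\<W> = \<Union>\<V> \<inter> U" by (auto simp: \<W>_def)
  have "\<exists>!s. s \<in> S (\<Union>\<W>) \<and> (\<forall>W \<in> \<W>. res (\<Union>\<W>) W s = \<sigma> (r W))"
  proof (rule sheaf_gluing[OF S])
    fix W assume W: "W \<in> \<W>"
    have "openin X (r W)" "\<sigma> (r W) \<in> S (r W \<inter> U)" using a r[OF W] by auto
    then show "openin XU W \<and> \<sigma> (r W) \<in> S W" using r[OF W] openin_Int by metis
  next
    fix W W' assume W: "W \<in> \<W>" "W' \<in> \<W>"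
    have "r W \<inter> r W' \<inter> U = W \<inter> W'" using r[OF W(1)] r[OF W(2)] by blast
    then show "res W (W \<inter> W') (\<sigma> (r W)) = res W' (W \<inter> W') (\<sigma> (r W'))"
      using a r[OF W(1)] r[OF W(2)] by metis
  qed
  then show "\<exists>!s. s \<in> S (\<Union>\<V> \<inter> U) \<and> (\<forall>V \<in> \<V>. res (\<Union>\<V> \<inter> U) (V \<inter> U) s = \<sigma> V)"
    unfolding U by (simp add: \<W>_def \<sigma>)
qed

lemma left_module_push:
  assumes V: "openin X V" and M: "left_module (RSec \<O> (V \<inter> U)) (MSec M (V \<inter> U))"
  shows "left_module (RSec \<O> V) (MSec (j_push_obj \<O> U M) V)"
proof -
  interpret M: left_module "RSec \<O> (V \<inter> U)" "MSec M (V \<inter> U)" using M .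
  interpret R: ring "RSec \<O> V" using RRes_D(1)[OF V] .
  have "RRes \<O> V (V \<inter> U) \<in> ring_hom (RSec \<O> V) (RSec \<O> (V \<inter> U))"
    using RRes_D(2)[of "V \<inter> U" V] V openin_Int[OF V] by simp
  note h = ring_hom_closed[OF this] ring_hom_mult[OF this] ring_hom_add[OF this] ring_hom_one[OF this]
  have "abelian_group (MSec (j_push_obj \<O> U M) V)"
  proof (rule abelian_groupI)
    fix x assume "x \<in> carrier (MSec (j_push_obj \<O> U M) V)"
    then show "\<exists>y\<in>carrier (MSec (j_push_obj \<O> U M) V).
        y \<oplus>\<^bsub>MSec (j_push_obj \<O> U M) V\<^esub> x = \<zero>\<^bsub>MSec (j_push_obj \<O> U M) V\<^esub>"
      using M.M.l_neg M.M.a_inv_closed by auto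
  qed (auto simp: M.M.a_ac)
  then interpret N: abelian_group "MSec (j_push_obj \<O> U M) V" .
  show ?thesis
    by unfold_locales (auto simp: h M.smult_l_distr M.smult_r_distr M.smult_assoc1 M.smult_one)
qed

lemma sheaf_push:
  assumes M: "sheaf_of_modules XU \<O> M"
  shows "sheaf_of_modules X \<O> (j_push_obj \<O> U M)"
  unfolding sheaf_of_modules_def
proof (intro conjI allI impI ballI)
  show "sheaf_of_sets X (\<lambda>V. carrier (MSec (j_push_obj \<O> U M) V)) (MRes (j_push_obj \<O> U M))"
    using sheaf_of_sets_push[OF sheaf_of_modulesD(1)[OF M]] by (simp add: j_push_obj_def)
  show "left_module (RSec \<O> V) (MSec (j_push_obj \<O> U M) V)" if "openin X V" for V
    using left_module_push[OF that] sheaf_of_modulesD(2)[OF M] openin_Int[OF that] by blast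
next
  fix V W s t
  assume VW: "openin X V \<and> openin X W \<and> V \<subseteq> W"
    and s: "s \<in> carrier (MSec (j_push_obj \<O> U M) W)" "t \<in> carrier (MSec (j_push_obj \<O> U M) W)"
  have o: "openin XU (V \<inter> U)" "openin XU (W \<inter> U)" "V \<inter> U \<subseteq> W \<inter> U" using openin_Int VW by auto
  show "MRes (j_push_obj \<O> U M) W V (s \<oplus>\<^bsub>MSec (j_push_obj \<O> U M) W\<^esub> t) =
    MRes (j_push_obj \<O> U M) W V s \<oplus>\<^bsub>MSec (j_push_obj \<O> U M) V\<^esub> MRes (j_push_obj \<O> U M) W V t"
    using sheaf_of_modulesD(6)[OF M o] s by simp
next
  fix V W a s
  assume VW: "openin X V \<and> openin X W \<and> V \<subseteq> W"
    and a: "a \<in> carrier (RSec \<O> W)" and s: "s \<in> carrier (MSec (j_push_obj \<O> U M) W)"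
  have o: "openin XU (V \<inter> U)" "openin XU (W \<inter> U)" "V \<inter> U \<subseteq> W \<inter> U" using openin_Int VW by auto
  have o': "openin X (V \<inter> U)" "openin X (W \<inter> U)" using openin_Int VW by auto
  have "RRes \<O> (W \<inter> U) (V \<inter> U) (RRes \<O> W (W \<inter> U) a) = RRes \<O> V (V \<inter> U) (RRes \<O> W V a)"
    using RRes_D(4)[OF o'(1,2) _ o(3)] RRes_D(4)[OF o'(1)] VW a by auto
  then show "MRes (j_push_obj \<O> U M) W V (a \<odot>\<^bsub>MSec (j_push_obj \<O> U M) W\<^esub> s) =
    RRes \<O> W V a \<odot>\<^bsub>MSec (j_push_obj \<O> U M) V\<^esub> MRes (j_push_obj \<O> U M) W V s"
    using sheaf_of_modulesD(7)[OF M o] s RRes_closed[OF o'(2) _ _ a] VW by simp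
qed

lemma shmod_hom_push:
  assumes "shmod_hom XU \<O> M N \<phi>"
  shows "shmod_hom X \<O> (j_push_obj \<O> U M) (j_push_obj \<O> U N) (\<lambda>V. \<phi> (V \<inter> U))"
proof (rule shmod_homI)
  fix V W s assume a: "openin X V" "openin X W" "V \<subseteq> W" "s \<in> carrier (MSec (j_push_obj \<O> U M) W)"
  have "V \<inter> U \<subseteq> W \<inter> U" using a by auto
  then show "\<phi> (V \<inter> U) (MRes (j_push_obj \<O> U M) W V s) = MRes (j_push_obj \<O> U N) W V (\<phi> (W \<inter> U) s)"
    using shmod_homD(4)[OF assms] openin_Int a by auto
qed (use openin_Int RRes_closed in \<open>auto simp: shmod_homD[OF assms]\<close>)

lemma shmod_hom_adjoint:
  assumes W: "sheaf_of_modules X \<O> W" and \<kappa>: "shmod_hom XU \<O> W N \<kappa>"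
  shows "shmod_hom X \<O> W (j_push_obj \<O> U N) (\<lambda>V s. \<kappa> (V \<inter> U) (MRes W V (V \<inter> U) s))"
proof (rule shmod_homI)
  fix V V' s assume a: "openin X V" "openin X V'" "V \<subseteq> V'" "s \<in> carrier (MSec W V')"
  have o: "openin XU (V \<inter> U)" "openin XU (V' \<inter> U)" "V \<inter> U \<subseteq> V' \<inter> U" "openin X (V \<inter> U)" "openin X (V' \<inter> U)"
    using a openin_Int by auto
  have "MRes W V (V \<inter> U) (MRes W V' V s) = MRes W (V' \<inter> U) (V \<inter> U) (MRes W V' (V' \<inter> U) s)"
    using sheaf_of_modulesD(5)[OF W o(4)] a o by simp
  then show "\<kappa> (V \<inter> U) (MRes W V (V \<inter> U) (MRes W V' V s)) =
      MRes (j_push_obj \<O> U N) V' V (\<kappa> (V' \<inter> U) (MRes W V' (V' \<inter> U) s))"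
    using shmod_homD(4)[OF \<kappa> o(1-3)] sheaf_of_modulesD(3)[OF W o(5) a(2) _ a(4)] by simp
qed (use openin_Int RRes_closed in \<open>auto simp: shmod_homD[OF \<kappa>] sheaf_of_modulesD[OF W]\<close>)

lemma j_push_simps [simp]:
  "OMap (j_push X \<O> U) = j_push_obj \<O> U"
  "AMap (j_push X \<O> U) f = mk_arrow X (j_push_obj \<O> U (Src f)) (j_push_obj \<O> U (Tgt f)) (\<lambda>V. Fun f (V \<inter> U))"
  by (simp_all add: j_push_def)

lemma j_pull_simps [simp]:
  "OMap (j_pull X U) M = M"
  "AMap (j_pull X U) f = mk_arrow XU (Src f) (Tgt f) (Fun f)"
  by (simp_all add: j_pull_def)

lemma push_Hom:
  assumes "f \<in> Hom (ShMod XU \<O>) M N"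
  shows "AMap (j_push X \<O> U) f \<in> Hom (ShMod X \<O>) (j_push_obj \<O> U M) (j_push_obj \<O> U N)"
  using ShMod_HomI[OF sheaf_push[OF ShMod_HomD(1)[OF assms]] sheaf_push[OF ShMod_HomD(2)[OF assms]]
      shmod_hom_push[OF ShMod_HomD(5)[OF assms]]] ShMod_HomD(3,4)[OF assms] by simp

lemma pull_Hom:
  assumes "f \<in> Hom (ShMod X \<O>) M N"
  shows "AMap (j_pull X U) f \<in> Hom (ShMod XU \<O>) M N"
  using ShMod_HomI[OF sheaf_restrict[OF ShMod_HomD(1)[OF assms]] sheaf_restrict[OF ShMod_HomD(2)[OF assms]]
      shmod_hom_restrict[OF ShMod_HomD(5)[OF assms]]] ShMod_HomD(3,4)[OF assms] by simp

lemma push_functor: "is_functor (ShMod XU \<O>) (ShMod X \<O>) (j_push X \<O> U)"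
  unfolding is_functor_def
proof (intro conjI ballI allI impI)
  show "OMap (j_push X \<O> U) M \<in> Obj (ShMod X \<O>)" if "M \<in> Obj (ShMod XU \<O>)" for M
    using that sheaf_push by simp
  show "AMap (j_push X \<O> U) (Ident (ShMod XU \<O>) M) = Ident (ShMod X \<O>) (OMap (j_push X \<O> U) M)"
    if "M \<in> Obj (ShMod XU \<O>)" for M
    by (auto intro!: mk_arrow_cong simp: openin_Int)
  show "AMap (j_push X \<O> U) f \<in> Hom (ShMod X \<O>) (OMap (j_push X \<O> U) M) (OMap (j_push X \<O> U) N)"
    if "f \<in> Hom (ShMod XU \<O>) M N" for M N f
    using push_Hom[OF that] by simp
next
  fix L M N f g
  assume fg: "f \<in> Hom (ShMod XU \<O>) L M \<and> g \<in> Hom (ShMod XU \<O>) M N"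
  note f = ShMod_HomD[OF conjunct1[OF fg]] and g = ShMod_HomD[OF conjunct2[OF fg]]
  show "AMap (j_push X \<O> U) (Comp (ShMod XU \<O>) g f) =
      Comp (ShMod X \<O>) (AMap (j_push X \<O> U) g) (AMap (j_push X \<O> U) f)"
    by (auto intro!: mk_arrow_cong simp: openin_Int f(3,4) g(3,4) shmod_homD(1)[OF f(5)])
qed

lemma pull_functor: "is_functor (ShMod X \<O>) (ShMod XU \<O>) (j_pull X U)"
  unfolding is_functor_def
proof (intro conjI ballI allI impI)
  show "OMap (j_pull X U) M \<in> Obj (ShMod XU \<O>)" if "M \<in> Obj (ShMod X \<O>)" for M
    using that sheaf_restrict by simp
  show "AMap (j_pull X U) (Ident (ShMod X \<O>) M) = Ident (ShMod XU \<O>) (OMap (j_pull X U) M)"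
    if "M \<in> Obj (ShMod X \<O>)" for M
    by (auto intro!: mk_arrow_cong simp: openin_XU)
  show "AMap (j_pull X U) f \<in> Hom (ShMod XU \<O>) (OMap (j_pull X U) M) (OMap (j_pull X U) N)"
    if "f \<in> Hom (ShMod X \<O>) M N" for M N f
    using pull_Hom[OF that] by simp
next
  fix L M N f g
  assume fg: "f \<in> Hom (ShMod X \<O>) L M \<and> g \<in> Hom (ShMod X \<O>) M N"
  note f = ShMod_HomD[OF conjunct1[OF fg]] and g = ShMod_HomD[OF conjunct2[OF fg]]
  show "AMap (j_pull X U) (Comp (ShMod X \<O>) g f) =
      Comp (ShMod XU \<O>) (AMap (j_pull X U) g) (AMap (j_pull X U) f)"
    by (auto intro!: mk_arrow_cong simp: openin_XU f(3,4) g(3,4) shmod_homD(1)[OF f(5)])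
qed

lemma push_zero:
  "AMap (j_push X \<O> U) (Zer (ShMod XU \<O>) M N) = Zer (ShMod X \<O>) (j_push_obj \<O> U M) (j_push_obj \<O> U N)"
  by (auto intro!: mk_arrow_cong simp: openin_Int)

lemma pull_zero: "AMap (j_pull X U) (Zer (ShMod X \<O>) M N) = Zer (ShMod XU \<O>) M N"
  by (auto intro!: mk_arrow_cong simp: openin_XU)

lemma push_additive:
  "additive_functor (ShMod XU \<O>) (ShMod X \<O>) (j_push X \<O> U)"
  unfolding additive_functor_def
proof (intro conjI allI ballI push_functor)
  fix M N f g
  assume "f \<in> Hom (ShMod XU \<O>) M N" "g \<in> Hom (ShMod XU \<O>) M N"
  note f = ShMod_HomD[OF this(1)] and g = ShMod_HomD[OF this(2)]
  show "AMap (j_push X \<O> U) (Add (ShMod XU \<O>) f g) =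
      Add (ShMod X \<O>) (AMap (j_push X \<O> U) f) (AMap (j_push X \<O> U) g)"
    by (auto intro!: mk_arrow_cong simp: openin_Int ShMod_def f(3,4) g(3,4))
qed

lemma counit_iso:
  assumes M: "sheaf_of_modules XU \<O> M"
  shows "j_counit X \<O> U M \<in> Hom (ShMod XU \<O>) (j_push_obj \<O> U M) M"
    and "mk_arrow XU M (j_push_obj \<O> U M) (\<lambda>V s. s) \<in> Hom (ShMod XU \<O>) M (j_push_obj \<O> U M)"
    and "Comp (ShMod XU \<O>) (j_counit X \<O> U M) (mk_arrow XU M (j_push_obj \<O> U M) (\<lambda>V s. s)) = Ident (ShMod XU \<O>) M"
    and "Comp (ShMod XU \<O>) (mk_arrow XU M (j_push_obj \<O> U M) (\<lambda>V s. s)) (j_counit X \<O> U M) =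
      Ident (ShMod XU \<O>) (j_push_obj \<O> U M)"
proof -
  have V: "V \<inter> U = V" "openin X V" if "openin XU V" for V using that by (auto simp: openin_XU)
  note P = sheaf_restrict[OF sheaf_push[OF M]]
  show "j_counit X \<O> U M \<in> Hom (ShMod XU \<O>) (j_push_obj \<O> U M) M"
    unfolding j_counit_def by (rule ShMod_HomI[OF P M], rule shmod_homI) (simp_all add: V RRes_D(3))
  show "mk_arrow XU M (j_push_obj \<O> U M) (\<lambda>V s. s) \<in> Hom (ShMod XU \<O>) M (j_push_obj \<O> U M)"
    by (rule ShMod_HomI[OF M P], rule shmod_homI) (simp_all add: V RRes_D(3))
  show "Comp (ShMod XU \<O>) (j_counit X \<O> U M) (mk_arrow XU M (j_push_obj \<O> U M) (\<lambda>V s. s)) = Ident (ShMod XU \<O>) M"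
    "Comp (ShMod XU \<O>) (mk_arrow XU M (j_push_obj \<O> U M) (\<lambda>V s. s)) (j_counit X \<O> U M) =
      Ident (ShMod XU \<O>) (j_push_obj \<O> U M)"
    by (auto intro!: mk_arrow_cong simp: j_counit_def V)
qed

lemma counit_natural:
  assumes f: "f \<in> Hom (ShMod XU \<O>) M N"
  shows "Comp (ShMod XU \<O>) (j_counit X \<O> U N) (AMap (j_pull X U) (AMap (j_push X \<O> U) f)) =
    Comp (ShMod XU \<O>) f (j_counit X \<O> U M)"
proof -
  have V: "V \<inter> U = V" "openin X V" if "openin XU V" for V using that by (auto simp: openin_XU)
  note f = ShMod_HomD[OF f]
  show ?thesis
    by (auto intro!: mk_arrow_cong simp: j_counit_def V f(3,4) shmod_homD(1)[OF f(5)])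
qed

text \<open>
  The bijection \<open>Hom(W, j\<^sub>* N) \<rightarrow> Hom(j\<^sup>* W, N)\<close> of the adjunction between \<open>j\<^sup>*\<close> and \<open>j\<^sub>*\<close>.
\<close>

definition transpose :: "('p, 'r, 'm) mod_psh \<Rightarrow> ('p, 'r, 'm) shmod_arrow \<Rightarrow> ('p, 'r, 'm) shmod_arrow" where
  "transpose N k = Comp (ShMod XU \<O>) (j_counit X \<O> U N) (AMap (j_pull X U) k)"

text \<open>
  The value of \<open>k\<close> on a section \<open>s\<close> over \<open>V\<close> is a section of \<open>N\<close> over \<open>V \<inter> U\<close>. Compatibility with restriction from
  \<open>V\<close> to \<open>V \<inter> U\<close> makes it the value on the restriction of \<open>s\<close>, which \<open>j\<^sup>* k\<close> determines.
\<close>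

lemma transpose_inject:
  assumes "k \<in> Hom (ShMod X \<O>) W (j_push_obj \<O> U N)" "k' \<in> Hom (ShMod X \<O>) W (j_push_obj \<O> U N)"
    and "sheaf_of_modules XU \<O> N" "transpose N k = transpose N k'"
  shows "k = k'"
proof (rule ShMod_eqI[OF assms(1,2)])
  fix V s
  assume V: "openin X V" and s: "s \<in> carrier (MSec W V)"
  note k = ShMod_HomD[OF assms(1)] and k' = ShMod_HomD[OF assms(2)]
  define V' s' where "V' = V \<inter> U" and "s' = MRes W V V' s"
  have V': "V' \<inter> U = V'" "openin X V'" "openin XU V'" "V' \<subseteq> V" using V openin_Int by (auto simp: V'_def)
  have s': "s' \<in> carrier (MSec W V')" using sheaf_of_modulesD(3)[OF k(1) V'(2) V V'(4) s] by (simp add: s'_def)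
  have *: "Fun (transpose N h) V' s' = Fun h V s"
    if h: "h \<in> Hom (ShMod X \<O>) W (j_push_obj \<O> U N)" for h
  proof -
    note h = ShMod_HomD[OF h]
    have c: "Fun h V' s' \<in> carrier (MSec N V')" using shmod_homD(1)[OF h(5) V'(2) s'] V' by simp
    have "Fun (transpose N h) V' s' = Fun h V' s'"
      using V' s' c by (simp add: transpose_def j_counit_def h(3,4))
    also have "\<dots> = MRes (j_push_obj \<O> U N) V V' (Fun h V s)"
      unfolding s'_def using shmod_homD(4)[OF h(5) V'(2) V V'(4) s] .
    also have "\<dots> = Fun h V s"
      using sheaf_of_modulesD(4)[OF assms(3) V'(3)] shmod_homD(1)[OF h(5) V s] V' by (simp add: V'_def)
    finally show ?thesis .
  qed
  show "Fun k V s = Fun k' V s" using *[OF assms(1)] *[OF assms(2)] assms(4) by simp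
qed

lemma transpose_surj:
  assumes W: "sheaf_of_modules X \<O> W" and \<kappa>: "\<kappa> \<in> Hom (ShMod XU \<O>) W N"
  shows "\<exists>k \<in> Hom (ShMod X \<O>) W (j_push_obj \<O> U N). transpose N k = \<kappa>"
proof
  note K = ShMod_HomD[OF \<kappa>]
  let ?k = "mk_arrow X W (j_push_obj \<O> U N) (\<lambda>V s. Fun \<kappa> (V \<inter> U) (MRes W V (V \<inter> U) s))"
  show k: "?k \<in> Hom (ShMod X \<O>) W (j_push_obj \<O> U N)"
    using ShMod_HomI[OF W sheaf_push[OF K(2)] shmod_hom_adjoint[OF W K(5)]] .
  have V: "V \<inter> U = V" "openin X V" if "openin XU V" for V using that by (auto simp: openin_XU)
  have "transpose N ?k = mk_arrow XU W N (Fun \<kappa>)"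
    by (auto intro!: mk_arrow_cong simp: transpose_def j_counit_def V sheaf_of_modulesD(4)[OF W] shmod_homD(1)[OF K(5)])
  then show "transpose N ?k = \<kappa>" using K(6) by simp
qed

declare j_push_simps(2) [simp del] j_pull_simps(2) [simp del]

end

section \<open>Direct image along the open inclusion\<close>

context gluing_setting
begin

sublocale open_inclusion X U \<O>
  by unfold_locales (use closed complement structure_sheaf in \<open>auto simp: openin_diff\<close>)

sublocale X: stable_subcategory BX AX
  by unfold_locales (use abelian_BX AX in \<open>auto simp: abelian_category_def\<close>)

sublocale U: stable_subcategory BU AU
  by unfold_locales (use abelian_BU AU in \<open>auto simp: abelian_category_def\<close>)

abbreviation "jO \<equiv> j_push_obj \<O> U"
abbreviation "jA f \<equiv> AMap (j_push X \<O> U) f"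
abbreviation "rA f \<equiv> AMap (j_pull X U) f"
abbreviation "\<epsilon> \<equiv> j_counit X \<O> U"

lemma Obj_BU: "M \<in> Obj BU \<longleftrightarrow> sheaf_of_modules XU \<O> M" and Obj_BX: "M \<in> Obj BX \<longleftrightarrow> sheaf_of_modules X \<O> M"
  by (simp_all add: BX BU)

lemma jA_Hom: "f \<in> Hom BU M N \<Longrightarrow> jA f \<in> Hom BX (jO M) (jO N)"
  using push_Hom by (simp add: BX BU)

lemma rA_Hom: "f \<in> Hom BX M N \<Longrightarrow> rA f \<in> Hom BU M N"
  using pull_Hom by (simp add: BX BU)

lemma jA_comp:
  "f \<in> Hom BU L M \<Longrightarrow> g \<in> Hom BU M N \<Longrightarrow> jA (Comp BU g f) = Comp BX (jA g) (jA f)"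
  using push_functor unfolding is_functor_def BX BU by blast

lemma rA_comp:
  "f \<in> Hom BX L M \<Longrightarrow> g \<in> Hom BX M N \<Longrightarrow> rA (Comp BX g f) = Comp BU (rA g) (rA f)"
  using pull_functor unfolding is_functor_def BX BU by blast

lemma jA_Ident: "M \<in> Obj BU \<Longrightarrow> jA (Ident BU M) = Ident BX (jO M)"
  using push_functor unfolding is_functor_def BX BU j_push_simps(1) by blast

lemma jA_zero: "jA (Zer BU M N) = Zer BX (jO M) (jO N)"
  using push_zero by (simp add: BX BU del: ShMod_simps)

lemma rA_zero: "rA (Zer BX M N) = Zer BU M N"
  using pull_zero by (simp add: BX BU del: ShMod_simps)

lemma \<epsilon>_Hom: "M \<in> Obj BU \<Longrightarrow> \<epsilon> M \<in> Hom BU (jO M) M"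
  using counit_iso(1) by (simp add: BX BU)

lemma \<epsilon>_inverse:
  assumes "M \<in> Obj BU"
  obtains e where "e \<in> Hom BU M (jO M)" "Comp BU (\<epsilon> M) e = Ident BU M" "Comp BU e (\<epsilon> M) = Ident BU (jO M)"
  using counit_iso(2-4)[of M] assms Obj_BU unfolding BU by blast

lemma \<epsilon>_natural: "f \<in> Hom BU M N \<Longrightarrow> Comp BU (\<epsilon> N) (rA (jA f)) = Comp BU f (\<epsilon> M)"
  unfolding BU by (rule counit_natural)

lemma \<epsilon>_cancel:
  assumes "f \<in> Hom BU M N" "g \<in> Hom BU M N" "Comp BU f (\<epsilon> M) = Comp BU g (\<epsilon> M)"
  shows "f = g"
proof -
  have M: "M \<in> Obj BU" using U.HomD[OF assms(1)] by blast
  obtain e where e: "e \<in> Hom BU M (jO M)" "Comp BU (\<epsilon> M) e = Ident BU M" using \<epsilon>_inverse[OF M] .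
  have "Comp BU (Comp BU h (\<epsilon> M)) e = h" if "h \<in> Hom BU M N" for h
    using U.comp_assoc[OF e(1) \<epsilon>_Hom[OF M] that] e(2) U.comp_id[OF that] by simp
  then show ?thesis using assms by metis
qed

lemma transpose_eq: "transpose N k = Comp BU (\<epsilon> N) (rA k)"
  unfolding transpose_def BU ..

lemma transpose_Hom: "N \<in> Obj BU \<Longrightarrow> k \<in> Hom BX W (jO N) \<Longrightarrow> transpose N k \<in> Hom BU W N"
  unfolding transpose_eq using U.comp_Hom[OF rA_Hom \<epsilon>_Hom] .

lemma transpose_push: "f \<in> Hom BU M N \<Longrightarrow> transpose N (jA f) = Comp BU f (\<epsilon> M)"
  unfolding transpose_eq using \<epsilon>_natural .

lemma transpose_comp:
  assumes "N \<in> Obj BU" "h \<in> Hom BX V W" "k \<in> Hom BX W (jO N)"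
  shows "transpose N (Comp BX k h) = Comp BU (transpose N k) (rA h)"
  unfolding transpose_eq rA_comp[OF assms(2,3)]
  using U.comp_assoc[OF rA_Hom[OF assms(2)] rA_Hom[OF assms(3)] \<epsilon>_Hom[OF assms(1)]] by simp

lemma transpose_push_comp:
  assumes "h \<in> Hom BX W (jO M)" "f \<in> Hom BU M N"
  shows "transpose N (Comp BX (jA f) h) = Comp BU f (transpose M h)"
proof -
  have o: "M \<in> Obj BU" "N \<in> Obj BU" using U.HomD[OF assms(2)] by auto
  show ?thesis
    using transpose_comp[OF o(2) assms(1) jA_Hom[OF assms(2)]] transpose_push[OF assms(2)]
      U.comp_assoc[OF rA_Hom[OF assms(1)] \<epsilon>_Hom[OF o(1)] assms(2)] by (simp add: transpose_eq)
qed

lemma transpose_inj: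
  "N \<in> Obj BU \<Longrightarrow> k \<in> Hom BX W (jO N) \<Longrightarrow> k' \<in> Hom BX W (jO N) \<Longrightarrow> transpose N k = transpose N k' \<Longrightarrow> k = k'"
  unfolding Obj_BU BX by (rule transpose_inject)

lemma transpose_onto:
  "W \<in> Obj BX \<Longrightarrow> \<kappa> \<in> Hom BU W N \<Longrightarrow> \<exists>k \<in> Hom BX W (jO N). transpose N k = \<kappa>"
  unfolding Obj_BX unfolding BX BU by (rule transpose_surj)

text \<open>
  \<open>j\<^sub>*\<close> is fully faithful, since the counit \<open>\<epsilon>\<close> is an isomorphism.
\<close>

lemma push_full:
  assumes "A \<in> Obj BU" "N \<in> Obj BU" "k \<in> Hom BX (jO A) (jO N)"
  shows "\<exists>f \<in> Hom BU A N. jA f = k"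
proof -
  obtain e where e: "e \<in> Hom BU A (jO A)" "Comp BU e (\<epsilon> A) = Ident BU (jO A)" using \<epsilon>_inverse[OF assms(1)] .
  note t = transpose_Hom[OF assms(2,3)]
  have f: "Comp BU (transpose N k) e \<in> Hom BU A N" using U.comp_Hom[OF e(1) t] .
  have "transpose N (jA (Comp BU (transpose N k) e)) = transpose N k"
    using transpose_push[OF f] U.comp_assoc[OF \<epsilon>_Hom[OF assms(1)] e(1) t] e(2) U.comp_id[OF t] by simp
  then show ?thesis using transpose_inj[OF assms(2) jA_Hom[OF f] assms(3)] f by blast
qed

lemma push_faithful: "f \<in> Hom BU M N \<Longrightarrow> g \<in> Hom BU M N \<Longrightarrow> jA f = jA g \<Longrightarrow> f = g"
  by (metis \<epsilon>_cancel transpose_push)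

text \<open>
  A right adjoint preserves kernels.
\<close>

lemma push_left_exact: "left_exact BU BX (j_push X \<O> U)"
  unfolding left_exact_def
proof (intro conjI allI impI)
  show "additive_functor BU BX (j_push X \<O> U)" unfolding BX BU by (rule push_additive)
  fix f k assume k: "is_kernel BU f k"
  define M N K where d: "M = Dom BU f" "N = Cod BU f" "K = Dom BU k"
  have f: "f \<in> Hom BU M N" using k U.Arr_Hom unfolding is_kernel_def d by blast
  note kd = U.kernelD[OF k f, folded d]
  have o: "M \<in> Obj BU" "N \<in> Obj BU" "K \<in> Obj BU" using U.HomD[OF f] U.HomD[OF kd(1)] by auto
  show "is_kernel BX (jA f) (jA k)"
  proof (rule X.kernelI[OF jA_Hom[OF f] jA_Hom[OF kd(1)]])
    show "Comp BX (jA f) (jA k) = Zer BX (jO K) (jO N)"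
      using jA_comp[OF kd(1) f] kd(2) jA_zero by simp
  next
    fix W h
    assume h: "h \<in> Hom BX W (jO M)" "Comp BX (jA f) h = Zer BX W (jO N)"
    have W: "W \<in> Obj BX" using X.HomD[OF h(1)] by blast
    have "Comp BU f (transpose M h) = Zer BU W N"
      using transpose_push_comp[OF h(1) f] h(2) rA_zero U.comp_zero[OF _ \<epsilon>_Hom[OF o(2)]]
        U.HomD[OF transpose_Hom[OF o(1) h(1)]] by (simp add: transpose_eq)
    then obtain e where e: "e \<in> Hom BU W K" "Comp BU k e = transpose M h"
      using kd(3)[OF transpose_Hom[OF o(1) h(1)]] by blast
    obtain e' where e': "e' \<in> Hom BX W (jO K)" "transpose K e' = e" using transpose_onto[OF W e(1)] by blast
    have "transpose M (Comp BX (jA k) e') = transpose M h"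
      using transpose_push_comp[OF e'(1) kd(1)] e' e by simp
    then show "\<exists>e \<in> Hom BX W (jO K). Comp BX (jA k) e = h"
      using transpose_inj[OF o(1) X.comp_Hom[OF e'(1) jA_Hom[OF kd(1)]] h(1)] e' by blast
  next
    fix W e e'
    assume e: "e \<in> Hom BX W (jO K)" "e' \<in> Hom BX W (jO K)" "Comp BX (jA k) e = Comp BX (jA k) e'"
    have "Comp BU k (transpose K e) = Comp BU k (transpose K e')"
      using transpose_push_comp[OF e(1) kd(1)] transpose_push_comp[OF e(2) kd(1)] e(3) by simp
    then have "transpose K e = transpose K e'"
      using kd(4) transpose_Hom[OF o(3) e(1)] transpose_Hom[OF o(3) e(2)] by blast
    then show "e = e'" using transpose_inj[OF o(3) e(1,2)] by blast
  qed
qed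

text \<open>
  If \<open>w : j\<^sub>* B \<rightarrow> W\<close> restricts over \<open>U\<close> to a cokernel of \<open>a\<close>, up to the isomorphisms \<open>\<tau>\<close> and \<open>\<epsilon>\<close>, then
  morphisms from \<open>W\<close> to \<open>j\<^sub>* N\<close>, being morphisms from \<open>j\<^sup>* W\<close> to \<open>N\<close>, are the morphisms \<open>B \<rightarrow> N\<close> that vanish on \<open>a\<close>.
  The sheaf \<open>W\<close> may be any extension of \<open>j\<^sup>* W\<close> to \<open>X\<close>. So the same lemma serves for \<open>j\<^sub>* q\<close>, inside the
  complexes, and for \<open>u\<close>, at their end.
\<close>

lemma push_hom_exact:
  assumes a: "a \<in> Hom BU A B" and q: "is_cokernel BU a q"
    and w: "w \<in> Hom BX (jO B) W"
    and \<tau>: "\<tau> \<in> Hom BU (Cod BU q) W" "\<tau>' \<in> Hom BU W (Cod BU q)"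
      "Comp BU \<tau>' \<tau> = Ident BU (Cod BU q)" "Comp BU \<tau> \<tau>' = Ident BU W"
    and rw: "rA w = Comp BU (Comp BU \<tau> q) (\<epsilon> B)"
    and N: "N \<in> Obj BU" and ext: "\<And>\<kappa>. \<kappa> \<in> Hom BU A N \<Longrightarrow> \<exists>s \<in> Hom BU B N. Comp BU s a = \<kappa>"
  shows "hom_exact BX (jA a) w (jO N)"
proof -
  have o: "A \<in> Obj BU" "B \<in> Obj BU" "W \<in> Obj BX" using U.HomD[OF a] X.HomD[OF w] by auto
  have D: "Dom BX (jA a) = jO A" "Cod BX (jA a) = jO B" "Cod BX w = W"
    using X.HomD[OF jA_Hom[OF a]] X.HomD[OF w] by auto
  note qd = U.cokernelD[OF q a]
  note \<tau>q = U.comp_Hom[OF qd(1) \<tau>(1)]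
  have tw: "transpose N (Comp BX k w) = Comp BU (Comp BU (Comp BU (transpose N k) \<tau>) q) (\<epsilon> B)"
    if k: "k \<in> Hom BX W (jO N)" for k
  proof -
    note t = transpose_Hom[OF N k]
    show ?thesis
      using transpose_comp[OF N w k] rw U.comp_assoc[OF \<epsilon>_Hom[OF o(2)] \<tau>q t] U.comp_assoc[OF qd(1) \<tau>(1) t]
      by simp
  qed
  have fac: "Comp BX k w = jA f \<longleftrightarrow> Comp BU (Comp BU (transpose N k) \<tau>) q = f"
    if k: "k \<in> Hom BX W (jO N)" and f: "f \<in> Hom BU B N" for k f
  proof -
    note t = U.comp_Hom[OF qd(1) U.comp_Hom[OF \<tau>(1) transpose_Hom[OF N k]]]
    have "Comp BX k w = jA f \<longleftrightarrow> transpose N (Comp BX k w) = transpose N (jA f)"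
      using transpose_inj[OF N X.comp_Hom[OF w k] jA_Hom[OF f]] by auto
    also have "\<dots> \<longleftrightarrow> Comp BU (Comp BU (transpose N k) \<tau>) q = f"
      unfolding tw[OF k] transpose_push[OF f] using \<epsilon>_cancel[OF t f] by auto
    finally show ?thesis .
  qed
  show ?thesis
    unfolding hom_exact_def D
  proof (intro conjI ballI impI)
    fix k assume "k \<in> Hom BX (jO A) (jO N)"
    then obtain \<kappa> where \<kappa>: "\<kappa> \<in> Hom BU A N" "jA \<kappa> = k" using push_full[OF o(1) N] by blast
    then obtain s where s: "s \<in> Hom BU B N" "Comp BU s a = \<kappa>" using ext by blast
    then show "\<exists>s \<in> Hom BX (jO B) (jO N). Comp BX s (jA a) = k"
      using jA_comp[OF a s(1)] jA_Hom[OF s(1)] \<kappa>(2) by metis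
  next
    fix \<phi> assume \<phi>: "\<phi> \<in> Hom BX (jO B) (jO N)"
    then obtain f where f: "f \<in> Hom BU B N" "jA f = \<phi>" using push_full[OF o(2) N] by blast
    have "Comp BX \<phi> (jA a) = Zer BX (jO A) (jO N) \<longleftrightarrow> jA (Comp BU f a) = jA (Zer BU A N)"
      using jA_comp[OF a f(1)] f(2) jA_zero by simp
    also have "\<dots> \<longleftrightarrow> Comp BU f a = Zer BU A N"
      using push_faithful[OF U.comp_Hom[OF a f(1)] U.zero_Hom[OF o(1) N]] by auto
    also have "\<dots> \<longleftrightarrow> (\<exists>k \<in> Hom BX W (jO N). \<phi> = Comp BX k w)"
    proof
      assume "Comp BU f a = Zer BU A N"
      then obtain e where e: "e \<in> Hom BU (Cod BU q) N" "Comp BU e q = f" using qd(3)[OF f(1)] by blast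
      obtain k where k: "k \<in> Hom BX W (jO N)" "transpose N k = Comp BU e \<tau>'"
        using transpose_onto[OF o(3) U.comp_Hom[OF \<tau>(2) e(1)]] by blast
      have "Comp BU (transpose N k) \<tau> = e"
        using k(2) U.comp_assoc[OF \<tau>(1,2) e(1)] \<tau>(3) U.comp_id[OF e(1)] by simp
      then show "\<exists>k \<in> Hom BX W (jO N). \<phi> = Comp BX k w" using fac[OF k(1) f(1)] e(2) f(2) k(1) by metis
    next
      assume "\<exists>k \<in> Hom BX W (jO N). \<phi> = Comp BX k w"
      then obtain k where k: "k \<in> Hom BX W (jO N)" "\<phi> = Comp BX k w" by blast
      note t = U.comp_Hom[OF \<tau>(1) transpose_Hom[OF N k(1)]]
      have "Comp BU (Comp BU (transpose N k) \<tau>) q = f" using fac[OF k(1) f(1)] k(2) f(2) by simp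
      then show "Comp BU f a = Zer BU A N"
        using U.comp_assoc[OF a qd(1) t] qd(2) U.comp_zero[OF o(1) t] by simp
    qed
    finally show "Comp BX \<phi> (jA a) = Zer BX (jO A) (jO N) \<longleftrightarrow> (\<exists>k \<in> Hom BX W (jO N). \<phi> = Comp BX k w)" .
  next
    fix k k' assume k: "k \<in> Hom BX W (jO N)" "k' \<in> Hom BX W (jO N)" "Comp BX k w = Comp BX k' w"
    have \<tau>c: "t = t'" if "t \<in> Hom BU W N" "t' \<in> Hom BU W N" "Comp BU t \<tau> = Comp BU t' \<tau>" for t t'
      using that U.comp_assoc[OF \<tau>(2,1) that(1)] U.comp_assoc[OF \<tau>(2,1) that(2)] \<tau>(4) U.comp_id by metis
    note t = transpose_Hom[OF N k(1)] transpose_Hom[OF N k(2)]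
    note t\<tau> = U.comp_Hom[OF \<tau>(1) t(1)] U.comp_Hom[OF \<tau>(1) t(2)]
    have "Comp BU (Comp BU (transpose N k) \<tau>) q = Comp BU (Comp BU (transpose N k') \<tau>) q"
      using tw[OF k(1)] tw[OF k(2)] k(3) \<epsilon>_cancel[OF U.comp_Hom[OF qd(1) t\<tau>(1)] U.comp_Hom[OF qd(1) t\<tau>(2)]] by simp
    then have "transpose N k = transpose N k'" using qd(4)[OF t\<tau>] \<tau>c[OF t] by blast
    then show "k = k'" using transpose_inj[OF N k(1,2)] by blast
  qed
qed

end

section \<open>The complexes of gluing data\<close>

context resolving_setting
begin

abbreviation "Qn n L \<equiv> OMap (pow_functor \<Q> n) L"
abbreviation "\<alpha>n n L \<equiv> \<alpha> (Qn n L)"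
abbreviation "qn n L \<equiv> q (Qn n L)"
abbreviation "FO M \<equiv> OMap \<F> M"
abbreviation "\<T> \<equiv> (\<lambda>M. jO (FO M)) ` Obj BU"

lemma \<alpha>_Hom: "M \<in> Obj BU \<Longrightarrow> \<alpha> M \<in> Hom BU M (FO M)"
  and \<alpha>_natural: "f \<in> Hom BU M N \<Longrightarrow> Comp BU (\<alpha> N) f = Comp BU (AMap \<F> f) (\<alpha> M)"
  using adjoint unfolding adjunction_def nat_trans_def \<F> by (simp_all add: id_functor_def)

lemma FO_Obj: "M \<in> Obj BU \<Longrightarrow> FO M \<in> Obj BU"
  using \<alpha>_Hom U.HomD by blast

lemma F_Hom: "f \<in> Hom BU M N \<Longrightarrow> AMap \<F> f \<in> Hom BU (FO M) (FO N)"
  and F_comp: "f \<in> Hom BU L M \<Longrightarrow> g \<in> Hom BU M N \<Longrightarrow>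
    AMap \<F> (Comp BU g f) = Comp BU (AMap \<F> g) (AMap \<F> f)"
  and F_Ident: "M \<in> Obj BU \<Longrightarrow> AMap \<F> (Ident BU M) = Ident BU (FO M)"
proof -
  have G: "is_functor BU A' G" "is_functor A' BU F" using adjoint by (auto simp: adjunction_def)
  have G': "\<And>M N f. f \<in> Hom BU M N \<Longrightarrow> AMap G f \<in> Hom A' (OMap G M) (OMap G N)"
    "\<And>L M N f g. f \<in> Hom BU L M \<and> g \<in> Hom BU M N \<Longrightarrow> AMap G (Comp BU g f) = Comp A' (AMap G g) (AMap G f)"
    "\<And>M. M \<in> Obj BU \<Longrightarrow> OMap G M \<in> Obj A' \<and> AMap G (Ident BU M) = Ident A' (OMap G M)"
    using G(1) unfolding is_functor_def by blast+
  have F': "\<And>M N f. f \<in> Hom A' M N \<Longrightarrow> AMap F f \<in> Hom BU (OMap F M) (OMap F N)"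
    "\<And>L M N f g. f \<in> Hom A' L M \<and> g \<in> Hom A' M N \<Longrightarrow> AMap F (Comp A' g f) = Comp BU (AMap F g) (AMap F f)"
    "\<And>M. M \<in> Obj A' \<Longrightarrow> OMap F M \<in> Obj BU \<and> AMap F (Ident A' M) = Ident BU (OMap F M)"
    using G(2) unfolding is_functor_def by blast+
  show "f \<in> Hom BU M N \<Longrightarrow> AMap \<F> f \<in> Hom BU (FO M) (FO N)"
    using F'(1) G'(1) by (simp add: \<F> comp_functor_def)
  show "f \<in> Hom BU L M \<Longrightarrow> g \<in> Hom BU M N \<Longrightarrow> AMap \<F> (Comp BU g f) = Comp BU (AMap \<F> g) (AMap \<F> f)"
    using F'(2)[OF conjI[OF G'(1) G'(1)]] G'(2) by (simp add: \<F> comp_functor_def)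
  show "M \<in> Obj BU \<Longrightarrow> AMap \<F> (Ident BU M) = Ident BU (FO M)"
    using F'(3) G'(3) by (simp add: \<F> comp_functor_def)
qed

text \<open>
  \<open>\<F> M = F G M\<close> is injective relative to \<open>\<alpha>\<close>: the extension of \<open>\<kappa>\<close> is \<open>F \<beta> \<circ> \<F> \<kappa>\<close>. By naturality of \<open>\<alpha>\<close> it restricts to
  \<open>F \<beta> \<circ> \<alpha> \<circ> \<kappa>\<close>, and \<open>F \<beta> \<circ> \<alpha>\<close> is the identity by a triangle identity.
\<close>

lemma F_extend:
  assumes A: "A \<in> Obj BU" and M: "M \<in> Obj BU" and \<kappa>: "\<kappa> \<in> Hom BU A (FO M)"
  shows "\<exists>s \<in> Hom BU (FO A) (FO M). Comp BU s (\<alpha> A) = \<kappa>"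
proof -
  have G: "is_functor BU A' G" "is_functor A' BU F" using adjoint by (auto simp: adjunction_def)
  have GM: "OMap G M \<in> Obj A'" using G(1) M by (simp add: is_functor_def)
  have "\<beta> (OMap G M) \<in> Hom A' (OMap G (OMap F (OMap G M))) (OMap G M)"
    using adjoint GM by (simp add: adjunction_def nat_trans_def comp_functor_def id_functor_def)
  then have b: "AMap F (\<beta> (OMap G M)) \<in> Hom BU (FO (FO M)) (FO M)"
    using G(2) by (simp add: is_functor_def \<F> comp_functor_def)
  have t: "Comp BU (AMap F (\<beta> (OMap G M))) (\<alpha> (FO M)) = Ident BU (FO M)"
    using adjoint GM by (simp add: adjunction_def \<F> comp_functor_def)
  have "Comp BU (Comp BU (AMap F (\<beta> (OMap G M))) (AMap \<F> \<kappa>)) (\<alpha> A) = \<kappa>"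
    using U.comp_assoc[OF \<alpha>_Hom[OF A] F_Hom[OF \<kappa>] b] \<alpha>_natural[OF \<kappa>]
      U.comp_assoc[OF \<kappa> \<alpha>_Hom[OF FO_Obj[OF M]] b] t U.id_comp[OF \<kappa>] by simp
  then show ?thesis using U.comp_Hom[OF F_Hom[OF \<kappa>] b] by blast
qed

lemma Q_Hom: "f \<in> Hom BU M N \<Longrightarrow> AMap \<Q> f \<in> Hom BU (OMap \<Q> M) (OMap \<Q> N)"
  and Q_comp: "f \<in> Hom BU L M \<Longrightarrow> g \<in> Hom BU M N \<Longrightarrow>
    AMap \<Q> (Comp BU g f) = Comp BU (AMap \<Q> g) (AMap \<Q> f)"
  and Q_Ident: "M \<in> Obj BU \<Longrightarrow> AMap \<Q> (Ident BU M) = Ident BU (OMap \<Q> M)"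
  using \<Q>_functor unfolding is_functor_def by blast+

lemma Qn_simps: "Qn 0 L = L" "Qn (Suc n) L = OMap \<Q> (Qn n L)"
  "AMap (pow_functor \<Q> 0) f = f" "AMap (pow_functor \<Q> (Suc n)) f = AMap \<Q> (AMap (pow_functor \<Q> n) f)"
  by (simp_all add: pow_functor_def)

lemma q_Hom: "M \<in> Obj BU \<Longrightarrow> q M \<in> Hom BU (FO M) (OMap \<Q> M)"
  and q_nat: "f \<in> Hom BU M N \<Longrightarrow> Comp BU (q N) (AMap \<F> f) = Comp BU (AMap \<Q> f) (q M)"
  using q_natural unfolding nat_trans_def by auto

lemma Cod_q: "M \<in> Obj BU \<Longrightarrow> Cod BU (q M) = OMap \<Q> M"
  using U.HomD[OF q_Hom] by blast

lemma Qn_AU: "L \<in> AU \<Longrightarrow> Qn n L \<in> AU"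
proof (induction n)
  case (Suc n)
  have o: "Qn n L \<in> Obj BU" using Suc U.S_Obj by blast
  have "is_cokernel BU (\<alpha>n n L) (qn n L)" using q_cokernel o by blast
  then show ?case
    using U.cokernel_in[OF _ \<alpha>_Hom[OF o]] Suc \<F>_AU Cod_q[OF o] by (metis Qn_simps(2))
qed (simp add: Qn_simps)

lemma Qn_Obj: "L \<in> AU \<Longrightarrow> Qn n L \<in> Obj BU"
  using Qn_AU U.S_Obj by blast

lemma Qn_Hom: "f \<in> Hom BU L M \<Longrightarrow> AMap (pow_functor \<Q> n) f \<in> Hom BU (Qn n L) (Qn n M)"
  by (induction n) (auto simp: Qn_simps intro: Q_Hom)

lemma Qn_comp: "f \<in> Hom BU K L \<Longrightarrow> g \<in> Hom BU L M \<Longrightarrow>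
    AMap (pow_functor \<Q> n) (Comp BU g f) = Comp BU (AMap (pow_functor \<Q> n) g) (AMap (pow_functor \<Q> n) f)"
  by (induction n) (simp_all add: Qn_simps Q_comp[OF Qn_Hom Qn_Hom])

lemma Qn_Ident: "L \<in> AU \<Longrightarrow> AMap (pow_functor \<Q> n) (Ident BU L) = Ident BU (Qn n L)"
  by (induction n) (simp_all add: Qn_simps Q_Ident[OF Qn_Obj])

lemma \<alpha>n_Hom: "L \<in> AU \<Longrightarrow> \<alpha>n n L \<in> Hom BU (Qn n L) (FO (Qn n L))"
  and qn_Hom: "L \<in> AU \<Longrightarrow> qn n L \<in> Hom BU (FO (Qn n L)) (Qn (Suc n) L)"
  and qn_cokernel: "L \<in> AU \<Longrightarrow> is_cokernel BU (\<alpha>n n L) (qn n L)"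
  and qn_\<alpha>n: "L \<in> AU \<Longrightarrow> Comp BU (qn n L) (\<alpha>n n L) = Zer BU (Qn n L) (Qn (Suc n) L)"
  using \<alpha>_Hom[OF Qn_Obj] q_Hom[OF Qn_Obj] q_cokernel Qn_Obj U.cokernelD(2)[OF _ \<alpha>_Hom[OF Qn_Obj]] Cod_q[OF Qn_Obj]
  by (auto simp: Qn_simps)

abbreviation "gd n L \<equiv> gdiff BU \<Q> \<alpha> q n L"

lemma gd: "gd n L = Comp BU (\<alpha>n (Suc n) L) (qn n L)"
  by (simp add: gdiff_def)

lemma gd_Hom: "L \<in> AU \<Longrightarrow> gd n L \<in> Hom BU (FO (Qn n L)) (FO (Qn (Suc n) L))"
  unfolding gd by (rule U.comp_Hom[OF qn_Hom \<alpha>n_Hom])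

lemma gd_gd:
  assumes "L \<in> AU" shows "Comp BU (gd (Suc n) L) (gd n L) = Zer BU (FO (Qn n L)) (FO (Qn (Suc (Suc n)) L))"
proof -
  note a = \<alpha>n_Hom[OF assms] and q = qn_Hom[OF assms]
  have "Comp BU (gd (Suc n) L) (gd n L) =
      Comp BU (\<alpha>n (Suc (Suc n)) L) (Comp BU (Comp BU (qn (Suc n) L) (\<alpha>n (Suc n) L)) (qn n L))"
    unfolding gd using U.comp_assoc[OF U.comp_Hom[OF q a] q a] U.comp_assoc[OF q a q] by simp
  also have "\<dots> = Zer BU (FO (Qn n L)) (FO (Qn (Suc (Suc n)) L))"
    using qn_\<alpha>n[OF assms] U.zero_comp[OF q Qn_Obj[OF assms]] U.comp_zero[OF _ a] U.HomD[OF q] by simp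
  finally show ?thesis .
qed

abbreviation "FQ n f \<equiv> AMap \<F> (AMap (pow_functor \<Q> n) f)"

lemma jFQ: "OMap (jFQ X \<O> U \<F> \<Q> n) L = jO (FO (Qn n L))" "AMap (jFQ X \<O> U \<F> \<Q> n) f = jA (FQ n f)"
  by (simp_all add: jFQ_def comp_functor_def)

lemma FQ_Hom: "f \<in> Hom BU L M \<Longrightarrow> FQ n f \<in> Hom BU (FO (Qn n L)) (FO (Qn n M))"
  using F_Hom[OF Qn_Hom] .

lemma gd_natural:
  assumes "L \<in> AU" "M \<in> AU" "f \<in> Hom BU L M"
  shows "Comp BU (gd n M) (FQ n f) = Comp BU (FQ (Suc n) f) (gd n L)"
proof -
  note f = Qn_Hom[OF assms(3)]
  have "Comp BU (gd n M) (FQ n f) = Comp BU (\<alpha>n (Suc n) M) (Comp BU (AMap (pow_functor \<Q> (Suc n)) f) (qn n L))"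
    unfolding gd using U.comp_assoc[OF FQ_Hom[OF assms(3)] qn_Hom[OF assms(2)] \<alpha>n_Hom[OF assms(2)]] q_nat[OF f]
    by (simp add: Qn_simps)
  also have "\<dots> = Comp BU (FQ (Suc n) f) (gd n L)"
    unfolding gd using U.comp_assoc[OF qn_Hom[OF assms(1)] f \<alpha>n_Hom[OF assms(2)]] \<alpha>_natural[OF f]
      U.comp_assoc[OF qn_Hom[OF assms(1)] \<alpha>n_Hom[OF assms(1)] FQ_Hom[OF assms(3)]] by metis
  finally show ?thesis .
qed

lemma push_F_AX: "A \<in> AU \<Longrightarrow> jO (FO A) \<in> AX"
  using derived_degree_zero[OF abelian_BU AU abelian_BX AX push_left_exact j_push, of "FO A"] \<F>_AU by simp

text \<open>
  The shift \<open>d = N + 1\<close> avoids truncated subtraction in \<open>d - 1\<close> and \<open>d - 2\<close>.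
\<close>

abbreviation "gluing_datum N z \<equiv> is_gdata X \<O> U AX AU \<F> \<Q> \<alpha> q (Suc N) z"
abbreviation "Bz N z \<equiv> B_obj X \<O> U \<F> \<Q> \<alpha> q (Suc N) z"

lemma gluing_datumD:
  assumes "gluing_datum N z"
  shows "GL z \<in> AU" "GF z \<in> AX" "Gu z \<in> Hom BX (jO (FO (Qn N (GL z)))) (GF z)"
    "Gs z \<in> Hom BU (Qn (Suc N) (GL z)) (GF z)" "is_iso BU (Gs z)"
    "\<And>n. Suc n = N \<Longrightarrow> Comp BX (Gu z) (jA (gd n (GL z))) = Zer BX (jO (FO (Qn n (GL z)))) (GF z)"
    "rA (Gu z) = Comp BU (Comp BU (Gs z) (qn N (GL z))) (\<epsilon> (FO (Qn N (GL z))))"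
  using assms unfolding is_gdata_def Let_def BX[symmetric] BU[symmetric] jFQ
  by (auto simp: numeral_2_eq_2)

lemma B_obj_simps:
  "k \<le> N \<Longrightarrow> Cob (Bz N z) (int k) = jO (FO (Qn k (GL z)))"
  "Cob (Bz N z) (int N + 1) = GF z"
  "n < 0 \<or> n > int N + 1 \<Longrightarrow> Cob (Bz N z) n = zero_obj BX"
  "k < N \<Longrightarrow> Cdf (Bz N z) (int k) = jA (gd k (GL z))"
  "Cdf (Bz N z) (int N) = Gu z"
  "n < 0 \<or> n > int N \<Longrightarrow> Cdf (Bz N z) n = Zer BX (Cob (Bz N z) n) (Cob (Bz N z) (n + 1))"
  by (auto simp: B_obj_def Let_def jFQ BX[symmetric] BU[symmetric] add.commute)

lemma B_obj_zero: "n < 0 \<or> n > int N + 1 \<Longrightarrow> is_zero_obj BX (Cob (Bz N z) n)"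
  using X.zero_obj by (simp add: B_obj_simps(3))

lemma degree_cases:
  fixes n :: int
  obtains m where "n = int m" "m \<le> N" | "n = int N + 1" | "n < 0 \<or> n > int N + 1"
  using zero_le_imp_eq_int[of n] by force

lemma B_obj_terms:
  assumes "gluing_datum N z" shows "Cob (Bz N z) n \<in> AX"
proof (cases n rule: degree_cases[where N = N])
  case (1 m)
  then show ?thesis using B_obj_simps(1)[of m N z] push_F_AX[OF Qn_AU[OF gluing_datumD(1)[OF assms]]] by simp
next
  case 2
  then show ?thesis using B_obj_simps(2) gluing_datumD(2)[OF assms] by simp
next
  case 3
  then show ?thesis using B_obj_simps(3) X.zero_obj_in[OF X.zero_obj] by simp
qed

lemma B_obj_complex:
  assumes z: "gluing_datum N z" shows "is_complex BX (Bz N z)"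
proof -
  note L = gluing_datumD(1)[OF z]
  note o = X.S_Obj[OF B_obj_terms[OF z]]
  have d: "Cdf (Bz N z) n \<in> Hom BX (Cob (Bz N z) n) (Cob (Bz N z) (n + 1))" for n
  proof -
    consider m where "n = int m" "m < N" | "n = int N" | "n < 0 \<or> n > int N"
      using zero_le_imp_eq_int[of n] by force
    then show ?thesis
    proof cases
      case 1
      then show ?thesis using jA_Hom[OF gd_Hom[OF L, of m]] B_obj_simps(1)[of m N z] B_obj_simps(1)[of "Suc m" N z] B_obj_simps(4)[of m N z]
        by (simp add: add.commute)
    next
      case 2
      then show ?thesis using gluing_datumD(3)[OF z] B_obj_simps(1)[of N N z] B_obj_simps(2,5)[of N z] by simp
    next
      case 3
      then show ?thesis using B_obj_simps(6)[of n N z] X.zero_Hom[OF o o] by simp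
    qed
  qed
  have "Comp BX (Cdf (Bz N z) (n + 1)) (Cdf (Bz N z) n) = Zer BX (Cob (Bz N z) n) (Cob (Bz N z) (n + 1 + 1))" for n
  proof -
    consider m where "n = int m" "Suc m < N" | m where "n = int m" "Suc m = N" | "n < 0" | "n + 1 > int N"
      using zero_le_imp_eq_int[of n] by force
    then show ?thesis
    proof cases
      case 1
      then show ?thesis
        using jA_comp[OF gd_Hom[OF L] gd_Hom[OF L], of m] gd_gd[OF L, of m] jA_zero
          B_obj_simps(1)[of m N z] B_obj_simps(1)[of "Suc (Suc m)" N z] B_obj_simps(4)[of m N z] B_obj_simps(4)[of "Suc m" N z]
        by (simp add: add.commute)
    next
      case 2
      then have i: "n + 1 + 1 = int N + 1" "n + 1 = int N" by auto
      show ?thesis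
        unfolding i using gluing_datumD(6)[OF z 2(2)] B_obj_simps(1)[of m N z] B_obj_simps(2,5)[of N z] B_obj_simps(4)[of m N z] 2 by simp
    next
      case 3
      then show ?thesis using B_obj_simps(6)[of n N z] X.comp_zero[OF o d] by simp
    next
      case 4
      then show ?thesis using B_obj_simps(6)[of "n + 1" N z] X.zero_comp[OF d o] by simp
    qed
  qed
  then show ?thesis unfolding is_complex_def using d o by blast
qed

lemma B_obj_in_Kb: "gluing_datum N z \<Longrightarrow> Bz N z \<in> Obj (Kb BX AX)"
proof -
  assume z: "gluing_datum N z"
  have "bounded_below BX (Bz N z)" "bounded_above BX (Bz N z)"
    unfolding bounded_below_def bounded_above_def using B_obj_zero by (meson, meson)
  then show "Bz N z \<in> Obj (Kb BX AX)"
    using B_obj_complex[OF z] X.cohomology_in_terms[OF B_obj_complex[OF z] B_obj_terms[OF z]] by (simp add: Kb_def Let_def)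
qed

text \<open>
  The objects and morphisms from which the complex is spliced: \<open>j\<^sub>* \<Q>\<^sup>n L\<close> and \<open>j\<^sub>* q\<^sup>n\<close>, except for the sheaf and the
  morphism \<open>u\<close> of the gluing datum at the end.
\<close>

definition syzygy :: "nat \<Rightarrow> (('p, 'r, 'm) mod_psh, ('p, 'r, 'm) shmod_arrow) gdata \<Rightarrow> nat \<Rightarrow> ('p, 'r, 'm) mod_psh" where
  "syzygy N z n = (if n \<le> N then jO (Qn n (GL z)) else GF z)"

definition syzygy_map :: "nat \<Rightarrow> (('p, 'r, 'm) mod_psh, ('p, 'r, 'm) shmod_arrow) gdata \<Rightarrow> nat \<Rightarrow> ('p, 'r, 'm) shmod_arrow" where
  "syzygy_map N z n = (if n < N then jA (qn n (GL z)) else Gu z)"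

text \<open>
  Here \<open>j\<^sub>* q\<^sup>n\<close> restricts to \<open>q\<^sup>n\<close> up to the counits \<open>\<epsilon>\<close>, so the inverse of a counit serves as \<open>\<tau>\<close>.
\<close>

lemma push_exact_interior:
  assumes L: "L \<in> AU" and T: "T \<in> \<T>"
  shows "hom_exact BX (jA (\<alpha>n n L)) (jA (qn n L)) T"
proof -
  obtain M where M: "M \<in> Obj BU" "T = jO (FO M)" using T by blast
  have o: "Qn (Suc n) L \<in> Obj BU" "FO (Qn n L) \<in> Obj BU" using Qn_Obj[OF L] FO_Obj by auto
  have C: "Cod BU (qn n L) = Qn (Suc n) L" using U.HomD[OF qn_Hom[OF L]] by blast
  obtain e where e: "e \<in> Hom BU (Qn (Suc n) L) (jO (Qn (Suc n) L))"
    "Comp BU (\<epsilon> (Qn (Suc n) L)) e = Ident BU (Qn (Suc n) L)"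
    "Comp BU e (\<epsilon> (Qn (Suc n) L)) = Ident BU (jO (Qn (Suc n) L))" using \<epsilon>_inverse[OF o(1)] .
  note q = qn_Hom[OF L, of n]
  have "rA (jA (qn n L)) = Comp BU (Comp BU e (qn n L)) (\<epsilon> (FO (Qn n L)))"
    using \<epsilon>_natural[OF q] U.comp_assoc[OF \<epsilon>_Hom[OF o(2)] q e(1)] e(3)
      U.comp_assoc[OF rA_Hom[OF jA_Hom[OF q]] \<epsilon>_Hom[OF o(1)] e(1)] U.id_comp[OF rA_Hom[OF jA_Hom[OF q]]] by simp
  then show ?thesis
    unfolding M(2)
    by (intro push_hom_exact[OF \<alpha>n_Hom[OF L] qn_cokernel[OF L] jA_Hom[OF q], where \<tau> = e and \<tau>' = "\<epsilon> (Qn (Suc n) L)"])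
      (simp_all add: C e \<epsilon>_Hom[OF o(1)] FO_Obj M F_extend[OF Qn_Obj[OF L] M(1)])
qed

text \<open>
  Here \<open>\<tau> = \<sigma>\<close>, by the condition \<open>\<sigma> \<circ> q\<^bsup>d-1\<^esup> = j\<^sup>* u\<close> on gluing data.
\<close>

lemma push_exact_top:
  assumes z: "gluing_datum N z" and T: "T \<in> \<T>"
  shows "hom_exact BX (jA (\<alpha>n N (GL z))) (Gu z) T"
proof -
  note L = gluing_datumD(1)[OF z]
  obtain M where M: "M \<in> Obj BU" "T = jO (FO M)" using T by blast
  have C: "Cod BU (qn N (GL z)) = Qn (Suc N) (GL z)" using U.HomD[OF qn_Hom[OF L]] by blast
  obtain e where e: "e \<in> Hom BU (GF z) (Qn (Suc N) (GL z))"
    "Comp BU e (Gs z) = Ident BU (Qn (Suc N) (GL z))" "Comp BU (Gs z) e = Ident BU (GF z)"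
    using gluing_datumD(5)[OF z] U.HomD[OF gluing_datumD(4)[OF z]] unfolding is_iso_def by auto
  show ?thesis
    unfolding M(2)
    by (intro push_hom_exact[OF \<alpha>n_Hom[OF L] qn_cokernel[OF L] gluing_datumD(3)[OF z], where \<tau> = "Gs z" and \<tau>' = e])
      (simp_all add: C e gluing_datumD[OF z] FO_Obj M F_extend[OF Qn_Obj[OF L] M(1)])
qed

lemma B_obj_coresolution:
  assumes z: "gluing_datum N z"
  shows "relative_coresolution BX N (Bz N z) (syzygy N z) (\<lambda>n. jA (\<alpha>n n (GL z))) (syzygy_map N z) \<T>"
  unfolding relative_coresolution_def
proof (intro conjI allI impI ballI B_obj_complex[OF z] B_obj_zero)
  note L = gluing_datumD(1)[OF z]
  fix n assume n: "n \<le> N"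
  show "jA (\<alpha>n n (GL z)) \<in> Hom BX (syzygy N z n) (Cob (Bz N z) (int n))"
    using jA_Hom[OF \<alpha>n_Hom[OF L]] B_obj_simps(1)[OF n] n by (simp add: syzygy_def)
  show "syzygy_map N z n \<in> Hom BX (Cob (Bz N z) (int n)) (syzygy N z (Suc n))"
    using jA_Hom[OF qn_Hom[OF L, of n]] gluing_datumD(3)[OF z] B_obj_simps(1)[OF n, of z] n by (auto simp: syzygy_def syzygy_map_def)
  show "hom_exact BX (jA (\<alpha>n n (GL z))) (syzygy_map N z n) T" if "T \<in> \<T>" for T
    using push_exact_interior[OF L that, of n] push_exact_top[OF z that] n by (auto simp: syzygy_map_def)
next
  note L = gluing_datumD(1)[OF z]
  fix n assume n: "n < N"
  show "Cdf (Bz N z) (int n) = Comp BX (jA (\<alpha>n (Suc n) (GL z))) (syzygy_map N z n)"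
    using B_obj_simps(4)[OF n] n jA_comp[OF qn_Hom[OF L] \<alpha>n_Hom[OF L]] by (simp add: syzygy_map_def gd)
next
  show "syzygy N z (Suc N) = Cob (Bz N z) (int N + 1)" by (simp add: syzygy_def B_obj_simps(2))
  show "Cdf (Bz N z) (int N) = syzygy_map N z N" by (simp add: syzygy_map_def B_obj_simps(5))
qed

text \<open>
  Over \<open>U\<close> the first differential is \<open>q\<close> followed by a monomorphism, hence has the kernel \<open>L\<close>. The monomorphism
  is \<open>\<sigma>\<close> if \<open>d = 1\<close>, and \<open>\<alpha> \<Q>\<close> up to a counit otherwise.
\<close>

lemma first_differential:
  assumes z: "gluing_datum N z"
  obtains m where "m \<in> Hom BU (Qn 1 (GL z)) (Cob (Bz N z) 1)" "is_mono BU m"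
    "rA (Cdf (Bz N z) 0) = Comp BU (Comp BU m (q (GL z))) (\<epsilon> (FO (GL z)))"
proof (cases N)
  case 0
  obtain e where e: "e \<in> Hom BU (GF z) (Qn 1 (GL z))" "Comp BU e (Gs z) = Ident BU (Qn 1 (GL z))"
    using gluing_datumD(5)[OF z] U.HomD[OF gluing_datumD(4)[OF z]] 0 unfolding is_iso_def by auto
  have s: "Gs z \<in> Hom BU (Qn 1 (GL z)) (GF z)" using gluing_datumD(4)[OF z] 0 by simp
  have "is_mono BU (Gs z)"
    unfolding is_mono_def using U.HomD[OF s] U.comp_assoc[OF _ s e(1)] e(2) U.id_comp by metis
  then show ?thesis
    using that[of "Gs z"] s gluing_datumD(7)[OF z] B_obj_simps(2,5)[of 0 z] 0 by (simp add: Qn_simps)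
next
  case (Suc M)
  note L = gluing_datumD(1)[OF z]
  let ?B = "FO (Qn 1 (GL z))"
  have o: "?B \<in> Obj BU" "FO (GL z) \<in> Obj BU" using FO_Obj Qn_Obj[OF L] U.S_Obj[OF L] by auto
  note a = \<alpha>n_Hom[OF L, of 1]
  have q: "q (GL z) \<in> Hom BU (FO (GL z)) (Qn 1 (GL z))" using qn_Hom[OF L, of 0] by (simp add: Qn_simps)
  obtain e where e: "e \<in> Hom BU ?B (jO ?B)" "Comp BU (\<epsilon> ?B) e = Ident BU ?B" "Comp BU e (\<epsilon> ?B) = Ident BU (jO ?B)"
    using \<epsilon>_inverse[OF o(1)] .
  let ?m = "Comp BU e (\<alpha>n 1 (GL z))"
  have m: "?m \<in> Hom BU (Qn 1 (GL z)) (jO ?B)" using U.comp_Hom[OF a e(1)] .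
  have am: "is_mono BU (\<alpha>n 1 (GL z))" using \<alpha>_injective Qn_Obj[OF L] by blast
  have "is_mono BU ?m"
    unfolding is_mono_def
  proof (intro conjI allI ballI impI)
    show "?m \<in> Arr BU" using U.HomD[OF m] by blast
    fix x g h
    assume g: "g \<in> Hom BU x (Dom BU ?m)" "h \<in> Hom BU x (Dom BU ?m)" "Comp BU ?m g = Comp BU ?m h"
    have D: "Dom BU ?m = Qn 1 (GL z)" "Dom BU (\<alpha>n 1 (GL z)) = Qn 1 (GL z)" using U.HomD[OF m] U.HomD[OF a] by auto
    have "Comp BU (\<epsilon> ?B) (Comp BU ?m k) = Comp BU (\<alpha>n 1 (GL z)) k" if "k \<in> Hom BU x (Qn 1 (GL z))" for k
      using U.comp_assoc[OF that a e(1)] U.comp_assoc[OF U.comp_Hom[OF that a] e(1) \<epsilon>_Hom[OF o(1)]] e(2)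
        U.id_comp[OF U.comp_Hom[OF that a]] by simp
    then have "Comp BU (\<alpha>n 1 (GL z)) g = Comp BU (\<alpha>n 1 (GL z)) h" using g D by metis
    then show "g = h" using am g D unfolding is_mono_def by metis
  qed
  moreover have "rA (jA (gd 0 (GL z))) = Comp BU (Comp BU ?m (q (GL z))) (\<epsilon> (FO (GL z)))"
  proof -
    have g: "gd 0 (GL z) \<in> Hom BU (FO (GL z)) ?B" "gd 0 (GL z) = Comp BU (\<alpha>n 1 (GL z)) (q (GL z))"
      using gd_Hom[OF L, of 0] gd[of 0 "GL z"] by (simp_all add: Qn_simps)
    show ?thesis
      using \<epsilon>_natural[OF g(1)] U.comp_assoc[OF \<epsilon>_Hom[OF o(2)] g(1) e(1)] e(3)
        U.comp_assoc[OF rA_Hom[OF jA_Hom[OF g(1)]] \<epsilon>_Hom[OF o(1)] e(1)] U.id_comp[OF rA_Hom[OF jA_Hom[OF g(1)]]]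
        U.comp_assoc[OF q a e(1)] g(2) by simp
  qed
  ultimately show ?thesis
    using that[of ?m] m B_obj_simps(1)[of 1 N z] B_obj_simps(4)[of 0 N z] Suc by simp
qed

definition B_map :: "nat \<Rightarrow> ('p, 'r, 'm) shmod_arrow \<Rightarrow> ('p, 'r, 'm) shmod_arrow \<Rightarrow> int \<Rightarrow> ('p, 'r, 'm) shmod_arrow" where
  "B_map N f g n = (if 0 \<le> n \<and> n < int N + 1 then jA (FQ (nat n) f) else if n = int N + 1 then g
     else Zer BX (zero_obj BX) (zero_obj BX))"

lemma B_map_simps:
  "k \<le> N \<Longrightarrow> B_map N f g (int k) = jA (FQ k f)" "B_map N f g (int N + 1) = g"
  "n < 0 \<or> n > int N + 1 \<Longrightarrow> B_map N f g n = Zer BX (zero_obj BX) (zero_obj BX)"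
  by (auto simp: B_map_def)

definition glue_arrow where
  "glue_arrow N z z' f g \<longleftrightarrow> gluing_datum N z \<and> gluing_datum N z' \<and> f \<in> Hom BU (GL z) (GL z') \<and> g \<in> Hom BX (GF z) (GF z') \<and>
     Comp BX (Gu z') (jA (FQ N f)) = Comp BX g (Gu z)"

abbreviation "Glue N \<equiv> glue_cat X \<O> U AX AU \<F> \<Q> \<alpha> q (Suc N)"
abbreviation "B_fun N \<equiv> B_functor X \<O> U \<F> \<Q> \<alpha> q (Suc N)"

lemma glue_Hom:
  "h \<in> Hom (Glue N) z z' \<longleftrightarrow> (\<exists>f g. h = \<lparr>Src = z, Tgt = z', Fun = (f, g)\<rparr> \<and> glue_arrow N z z' f g)"
  by (auto simp: Hom_def glue_cat_def Let_def BX[symmetric] BU[symmetric] jFQ glue_arrow_def)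

lemma B_functor_simps:
  "OMap (B_fun N) z = Bz N z"
  "AMap (B_fun N) \<lparr>Src = z, Tgt = z', Fun = (f, g)\<rparr> = htpy_class BX (Bz N z) (Bz N z') (B_map N f g)"
proof -
  show "OMap (B_fun N) z = Bz N z" by (simp add: B_functor_def Let_def)
  have "(\<lambda>n. if 0 \<le> n \<and> n < int (Suc N) then AMap (jFQ X \<O> U \<F> \<Q> (nat n)) f
      else if n = int (Suc N) then g else Zer BX (zero_obj BX) (zero_obj BX)) = B_map N f g"
    by (auto simp: B_map_def jFQ)
  then show "AMap (B_fun N) \<lparr>Src = z, Tgt = z', Fun = (f, g)\<rparr> = htpy_class BX (Bz N z) (Bz N z') (B_map N f g)"
    by (simp only: B_functor_def Let_def BX[symmetric] functr.simps arrow.simps fst_conv snd_conv)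
qed

lemma B_map_chain_map:
  assumes p: "glue_arrow N z z' f g" shows "chain_map BX (Bz N z) (Bz N z') (B_map N f g)"
proof -
  have z: "gluing_datum N z" "gluing_datum N z'" and f: "f \<in> Hom BU (GL z) (GL z')" and g: "g \<in> Hom BX (GF z) (GF z')"
    and eq: "Comp BX (Gu z') (jA (FQ N f)) = Comp BX g (Gu z)" using p by (auto simp: glue_arrow_def)
  note L = gluing_datumD(1)[OF z(1)] gluing_datumD(1)[OF z(2)]
  note K = B_obj_complex[OF z(1)] B_obj_complex[OF z(2)]
  have h: "B_map N f g n \<in> Hom BX (Cob (Bz N z) n) (Cob (Bz N z') n)" for n
  proof (cases n rule: degree_cases[where N = N])
    case (1 m)
    then show ?thesis using jA_Hom[OF FQ_Hom[OF f]] by (simp add: B_map_simps(1) B_obj_simps(1))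
  next
    case 2
    then show ?thesis using g by (simp add: B_map_simps(2) B_obj_simps(2))
  next
    case 3
    then show ?thesis using X.zero_obj by (simp add: B_map_simps(3) B_obj_simps(3) is_zero_obj_def)
  qed
  have "Comp BX (B_map N f g (n + 1)) (Cdf (Bz N z) n) = Comp BX (Cdf (Bz N z') n) (B_map N f g n)" for n
  proof -
    note t = X.comp_Hom[OF X.complexD(1)[OF K(1)] h, of n] X.comp_Hom[OF h X.complexD(1)[OF K(2)], of n]
    consider m where "n = int m" "m < N" | "n = int N" | "n < 0" | "n > int N"
      using zero_le_imp_eq_int[of n] by force
    then show ?thesis
    proof cases
      case 1
      have "n + 1 = int (Suc m)" using 1 by simp
      then have "B_map N f g (n + 1) = jA (FQ (Suc m) f)" "B_map N f g n = jA (FQ m f)"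
        using B_map_simps(1)[of "Suc m" N f g] B_map_simps(1)[of m N f g] 1 by (auto simp: add.commute)
      then show ?thesis
        using jA_comp[OF gd_Hom[OF L(1)] FQ_Hom[OF f], of m] jA_comp[OF FQ_Hom[OF f] gd_Hom[OF L(2)], of m]
          gd_natural[OF L f, of m] 1 B_obj_simps(4)[OF 1(2)] by simp
    next
      case 2
      then show ?thesis using eq B_map_simps(1)[of N N f g] B_map_simps(2)[of N f g] B_obj_simps(5)[of N] by simp
    next
      case 3
      then show ?thesis using X.zero_obj_from[OF B_obj_zero t(1)] X.zero_obj_from[OF B_obj_zero t(2)] by simp
    next
      case 4
      then show ?thesis using X.zero_obj_into[OF B_obj_zero t(1)] X.zero_obj_into[OF B_obj_zero t(2)] by simp
    qed
  qed
  then show ?thesis unfolding chain_map_def using h by blast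
qed

lemma glue_arrow_Ident:
  assumes z: "gluing_datum N z"
  shows "glue_arrow N z z (Ident BU (GL z)) (Ident BX (GF z))"
    and "B_map N (Ident BU (GL z)) (Ident BX (GF z)) = (\<lambda>n. Ident BX (Cob (Bz N z) n))"
proof -
  note L = gluing_datumD(1)[OF z]
  have i: "jA (FQ n (Ident BU (GL z))) = Ident BX (jO (FO (Qn n (GL z))))" for n
    using Qn_Ident[OF L] F_Ident[OF Qn_Obj[OF L]] jA_Ident[OF FO_Obj[OF Qn_Obj[OF L]]] by simp
  show "glue_arrow N z z (Ident BU (GL z)) (Ident BX (GF z))"
    unfolding glue_arrow_def i using z U.S_Obj[OF L] X.S_Obj[OF gluing_datumD(2)[OF z]]
      X.comp_id[OF gluing_datumD(3)[OF z]] X.id_comp[OF gluing_datumD(3)[OF z]] by simp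
  show "B_map N (Ident BU (GL z)) (Ident BX (GF z)) = (\<lambda>n. Ident BX (Cob (Bz N z) n))"
  proof
    fix n
    have zo: "zero_obj BX \<in> Obj BX" using X.zero_obj by (simp add: is_zero_obj_def)
    show "B_map N (Ident BU (GL z)) (Ident BX (GF z)) n = Ident BX (Cob (Bz N z) n)"
      by (cases n rule: degree_cases[where N = N])
        (simp_all add: B_map_simps B_obj_simps i X.zero_obj_into[OF X.zero_obj X.Ident_Hom[OF zo]])
  qed
qed

lemma B_map_comp:
  assumes "glue_arrow N z z' f g" "glue_arrow N z' z'' f' g'"
  shows "B_map N (Comp BU f' f) (Comp BX g' g) = (\<lambda>n. Comp BX (B_map N f' g' n) (B_map N f g n))"
proof
  fix n
  have f: "f \<in> Hom BU (GL z) (GL z')" "f' \<in> Hom BU (GL z') (GL z'')" using assms by (auto simp: glue_arrow_def)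
  have zo: "zero_obj BX \<in> Obj BX" using X.zero_obj by (simp add: is_zero_obj_def)
  have c: "jA (FQ m (Comp BU f' f)) = Comp BX (jA (FQ m f')) (jA (FQ m f))" for m
    using Qn_comp[OF f] F_comp[OF Qn_Hom[OF f(1)] Qn_Hom[OF f(2)]] jA_comp[OF FQ_Hom[OF f(1)] FQ_Hom[OF f(2)]]
    by simp
  show "B_map N (Comp BU f' f) (Comp BX g' g) n = Comp BX (B_map N f' g' n) (B_map N f g n)"
    by (cases n rule: degree_cases[where N = N])
      (simp_all add: B_map_simps c X.zero_comp[OF X.zero_Hom[OF zo zo] zo])
qed

lemma B_is_functor: "is_functor (Glue N) (Kb BX AX) (B_fun N)"
  unfolding is_functor_def B_functor_simps(1)
proof (intro conjI ballI allI impI)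
  have gO: "z \<in> Obj (Glue N) \<longleftrightarrow> gluing_datum N z" for z by (simp add: glue_cat_def Let_def)
  fix z assume "z \<in> Obj (Glue N)"
  then have z: "gluing_datum N z" by (simp add: gO)
  show "Bz N z \<in> Obj (Kb BX AX)" using B_obj_in_Kb[OF z] .
  have "Ident (Glue N) z = \<lparr>Src = z, Tgt = z, Fun = (Ident BU (GL z), Ident BX (GF z))\<rparr>"
    by (simp add: glue_cat_def Let_def BX BU del: ShMod_simps)
  then show "AMap (B_fun N) (Ident (Glue N) z) = Ident (Kb BX AX) (Bz N z)"
    by (simp add: B_functor_simps(2) glue_arrow_Ident(2)[OF z] Kb_def Let_def)
next
  fix z z' h assume "h \<in> Hom (Glue N) z z'"
  then obtain f g where h: "h = \<lparr>Src = z, Tgt = z', Fun = (f, g)\<rparr>" and p: "glue_arrow N z z' f g"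
    by (auto simp: glue_Hom)
  have "gluing_datum N z" "gluing_datum N z'" using p by (auto simp: glue_arrow_def)
  then have "Bz N z \<in> Obj (Kb BX AX)" "Bz N z' \<in> Obj (Kb BX AX)" using B_obj_in_Kb by auto
  then show "AMap (B_fun N) h \<in> Hom (Kb BX AX) (Bz N z) (Bz N z')"
    unfolding h B_functor_simps(2) using B_map_chain_map[OF p]
    by (auto simp: Hom_def Kb_def Let_def htpy_class_def)
next
  fix z z' z'' h k assume "h \<in> Hom (Glue N) z z' \<and> k \<in> Hom (Glue N) z' z''"
  then obtain f g f' g' where h: "h = \<lparr>Src = z, Tgt = z', Fun = (f, g)\<rparr>" "glue_arrow N z z' f g"
    and k: "k = \<lparr>Src = z', Tgt = z'', Fun = (f', g')\<rparr>" "glue_arrow N z' z'' f' g'"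
    by (auto simp: glue_Hom)
  have z: "gluing_datum N z" "gluing_datum N z'" "gluing_datum N z''" using h k by (auto simp: glue_arrow_def)
  have "Comp (Glue N) k h = \<lparr>Src = z, Tgt = z'', Fun = (Comp BU f' f, Comp BX g' g)\<rparr>"
    by (simp add: glue_cat_def Let_def BX BU h k del: ShMod_simps)
  then show "AMap (B_fun N) (Comp (Glue N) k h) = Comp (Kb BX AX) (AMap (B_fun N) k) (AMap (B_fun N) h)"
    unfolding h(1) k(1)
    by (simp add: B_functor_simps(2) B_map_comp[OF h(2) k(2)]
        X.Kb_comp_class[OF B_obj_complex[OF z(1)] B_obj_complex[OF z(2)] B_obj_complex[OF z(3)]
          B_map_chain_map[OF h(2)] B_map_chain_map[OF k(2)]])
qed

lemma push_unit_natural: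
  assumes "f \<in> Hom BU L M"
  shows "Comp BX (jA (FQ 0 f)) (jA (\<alpha>n 0 L)) = jA (Comp BU (\<alpha> M) f)"
proof -
  have o: "L \<in> Obj BU" using U.HomD[OF assms] by blast
  show ?thesis
    using jA_comp[OF \<alpha>_Hom[OF o] F_Hom[OF assms]] \<alpha>_natural[OF assms] by (simp add: Qn_simps)
qed

lemma B_obj_targets:
  assumes "gluing_datum N z"
  shows "n \<le> N \<Longrightarrow> Cob (Bz N z) (int n) \<in> \<T>"
  using B_obj_simps(1) Qn_Obj[OF gluing_datumD(1)[OF assms]] by auto

lemma B_faithful:
  assumes p: "glue_arrow N z z' f g" "glue_arrow N z z' f' g'"
    and h: "homotopic BX (Bz N z) (Bz N z') (B_map N f g) (B_map N f' g')"
  shows "f = f' \<and> g = g'"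
proof -
  have z: "gluing_datum N z" "gluing_datum N z'" and f: "f \<in> Hom BU (GL z) (GL z')" "f' \<in> Hom BU (GL z) (GL z')"
    using p by (auto simp: glue_arrow_def)
  note L = gluing_datumD(1)[OF z(1)] and L' = gluing_datumD(1)[OF z(2)]
  note R = B_obj_coresolution[OF z(1)] B_obj_complex[OF z(2)]
  have o: "GL z' \<in> Obj BU" using U.HomD[OF f(1)] by blast
  have "Comp BX (B_map N f g 0) (jA (\<alpha>n 0 (GL z))) = Comp BX (B_map N f' g' 0) (jA (\<alpha>n 0 (GL z)))"
    using X.homotopic_agree[OF R B_obj_zero _ B_map_chain_map[OF p(1)] h] B_obj_targets[OF z(2), of 0] by simp
  then have "jA (Comp BU (\<alpha> (GL z')) f) = jA (Comp BU (\<alpha> (GL z')) f')"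
    using B_map_simps(1)[of 0 N f g] B_map_simps(1)[of 0 N f' g'] push_unit_natural[OF f(1)] push_unit_natural[OF f(2)]
    by simp
  then have "Comp BU (\<alpha> (GL z')) f = Comp BU (\<alpha> (GL z')) f'"
    using push_faithful U.comp_Hom[OF f(1) \<alpha>_Hom[OF o]] U.comp_Hom[OF f(2) \<alpha>_Hom[OF o]] by blast
  then have ff: "f = f'"
    using \<alpha>_injective o f U.HomD[OF \<alpha>_Hom[OF o]] unfolding is_mono_def by metis
  have "B_map N f g (int N + 1) = B_map N f' g' (int N + 1)"
    by (rule X.homotopic_rigid[OF R B_obj_zero B_obj_targets[OF z(2)] B_map_chain_map[OF p(1)] h])
      (simp_all add: ff B_map_simps(1))
  then show ?thesis using ff by (simp add: B_map_simps(2))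
qed

text \<open>
  As \<open>j\<^sub>*\<close> is full, \<open>\<psi>\<^sup>0 = j\<^sub>* \<kappa>\<close>. Over \<open>U\<close> the chain map equation gives \<open>m' q \<kappa> = j\<^sup>* \<psi>\<^sup>1 m q\<close>, with the monomorphisms \<open>m\<close>
  and \<open>m'\<close> of lemma \<open>first_differential\<close>. So \<open>q \<kappa> \<alpha> = 0\<close>, and \<open>\<kappa> \<alpha>\<close> factors through the kernel \<open>\<alpha>\<close>
  of \<open>q\<close>. The factor is \<open>f\<close>.
\<close>

lemma chain_map_induces_arrow:
  assumes z: "gluing_datum N z" "gluing_datum N z'" and \<psi>: "chain_map BX (Bz N z) (Bz N z') \<psi>"
  shows "\<exists>f \<in> Hom BU (GL z) (GL z'). Comp BX (jA (FQ 0 f)) (jA (\<alpha>n 0 (GL z))) = Comp BX (\<psi> 0) (jA (\<alpha>n 0 (GL z)))"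
proof -
  note L = gluing_datumD(1)[OF z(1)] and L' = gluing_datumD(1)[OF z(2)]
  have o: "GL z \<in> Obj BU" "GL z' \<in> Obj BU" using L L' U.S_Obj by auto
  have c0: "Cob (Bz N z) 0 = jO (FO (GL z))" "Cob (Bz N z') 0 = jO (FO (GL z'))"
    using B_obj_simps(1)[of 0 N] by (simp_all add: Qn_simps)
  have \<psi>0: "\<psi> 0 \<in> Hom BX (jO (FO (GL z))) (jO (FO (GL z')))"
    using X.chain_mapD(1)[OF \<psi>, of 0] c0 by simp
  obtain \<kappa> where \<kappa>: "\<kappa> \<in> Hom BU (FO (GL z)) (FO (GL z'))" "jA \<kappa> = \<psi> 0"
    using push_full[OF FO_Obj[OF o(1)] FO_Obj[OF o(2)] \<psi>0] by blast
  obtain m where m: "m \<in> Hom BU (Qn 1 (GL z)) (Cob (Bz N z) 1)"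
    "rA (Cdf (Bz N z) 0) = Comp BU (Comp BU m (q (GL z))) (\<epsilon> (FO (GL z)))" using first_differential[OF z(1)] .
  obtain m' where m': "m' \<in> Hom BU (Qn 1 (GL z')) (Cob (Bz N z') 1)" "is_mono BU m'"
    "rA (Cdf (Bz N z') 0) = Comp BU (Comp BU m' (q (GL z'))) (\<epsilon> (FO (GL z')))" using first_differential[OF z(2)] .
  have q: "q (GL z) \<in> Hom BU (FO (GL z)) (Qn 1 (GL z))" "q (GL z') \<in> Hom BU (FO (GL z')) (Qn 1 (GL z'))"
    using qn_Hom[OF L, of 0] qn_Hom[OF L', of 0] by (simp_all add: Qn_simps)
  note a = \<alpha>_Hom[OF o(1)] and e = \<epsilon>_Hom[OF FO_Obj[OF o(1)]] and e' = \<epsilon>_Hom[OF FO_Obj[OF o(2)]]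
  have \<psi>1: "\<psi> 1 \<in> Hom BX (Cob (Bz N z) 1) (Cob (Bz N z') 1)" using X.chain_mapD(1)[OF \<psi>, of 1] .
  have d: "Cdf (Bz N z) 0 \<in> Hom BX (jO (FO (GL z))) (Cob (Bz N z) 1)"
    "Cdf (Bz N z') 0 \<in> Hom BX (jO (FO (GL z'))) (Cob (Bz N z') 1)"
    using X.complexD(1)[OF B_obj_complex[OF z(1)], of 0] X.complexD(1)[OF B_obj_complex[OF z(2)], of 0] c0 by simp_all
  note mq = U.comp_Hom[OF q(1) m(1)] and mq' = U.comp_Hom[OF q(2) m'(1)] and r\<psi> = rA_Hom[OF \<psi>1]
  have "Comp BX (\<psi> 1) (Cdf (Bz N z) 0) = Comp BX (Cdf (Bz N z') 0) (jA \<kappa>)"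
    using X.chain_mapD(2)[OF \<psi>, of 0] \<kappa>(2) by simp
  then have "Comp BU (rA (\<psi> 1)) (rA (Cdf (Bz N z) 0)) = Comp BU (rA (Cdf (Bz N z') 0)) (rA (jA \<kappa>))"
    using rA_comp[OF d(1) \<psi>1] rA_comp[OF jA_Hom[OF \<kappa>(1)] d(2)] by simp
  then have "Comp BU (Comp BU (rA (\<psi> 1)) (Comp BU m (q (GL z)))) (\<epsilon> (FO (GL z))) =
      Comp BU (Comp BU (Comp BU m' (q (GL z'))) \<kappa>) (\<epsilon> (FO (GL z)))"
    unfolding m(2) m'(3) using U.comp_assoc[OF e mq r\<psi>] U.comp_assoc[OF rA_Hom[OF jA_Hom[OF \<kappa>(1)]] e' mq']
      \<epsilon>_natural[OF \<kappa>(1)] U.comp_assoc[OF e \<kappa>(1) mq'] by simp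
  then have "Comp BU (rA (\<psi> 1)) (Comp BU m (q (GL z))) = Comp BU (Comp BU m' (q (GL z'))) \<kappa>"
    using \<epsilon>_cancel U.comp_Hom[OF mq r\<psi>] U.comp_Hom[OF \<kappa>(1) mq'] by blast
  then have *: "Comp BU (Comp BU (rA (\<psi> 1)) (Comp BU m (q (GL z)))) (\<alpha> (GL z)) =
    Comp BU (Comp BU (Comp BU m' (q (GL z'))) \<kappa>) (\<alpha> (GL z))" by simp
  have q1: "Qn 1 (GL z) \<in> Obj BU" "Qn 1 (GL z') \<in> Obj BU" using Qn_Obj L L' by auto
  have "Comp BU (q (GL z)) (\<alpha> (GL z)) = Zer BU (GL z) (Qn 1 (GL z))"
    using qn_\<alpha>n[OF L, of 0] by (simp add: Qn_simps)
  then have "Comp BU (Comp BU (rA (\<psi> 1)) (Comp BU m (q (GL z)))) (\<alpha> (GL z)) = Zer BU (GL z) (Cob (Bz N z') 1)"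
    using U.comp_assoc[OF a mq r\<psi>] U.comp_assoc[OF a q(1) m(1)] U.comp_zero[OF o(1) m(1)] U.comp_zero[OF o(1) r\<psi>] by simp
  moreover define \<kappa>\<alpha> where "\<kappa>\<alpha> = Comp BU \<kappa> (\<alpha> (GL z))"
  have \<kappa>\<alpha>: "\<kappa>\<alpha> \<in> Hom BU (GL z) (FO (GL z'))" unfolding \<kappa>\<alpha>_def using U.comp_Hom[OF a \<kappa>(1)] .
  ultimately have "Comp BU m' (Comp BU (q (GL z')) \<kappa>\<alpha>) = Comp BU m' (Zer BU (GL z) (Qn 1 (GL z')))"
    using * U.comp_assoc[OF a \<kappa>(1) mq'] U.comp_assoc[OF \<kappa>\<alpha> q(2) m'(1)] U.comp_zero[OF o(1) m'(1)]
    by (simp add: \<kappa>\<alpha>_def)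
  then have "Comp BU (q (GL z')) \<kappa>\<alpha> = Zer BU (GL z) (Qn 1 (GL z'))"
    using m'(2) U.HomD[OF m'(1)] U.comp_Hom[OF \<kappa>\<alpha> q(2)] U.zero_Hom[OF o(1) q1(2)] unfolding is_mono_def by metis
  moreover have "is_kernel BU (q (GL z')) (\<alpha> (GL z'))"
    using U.mono_kernel_of_cokernel[OF _ \<alpha>_Hom[OF o(2)]] \<alpha>_injective q_cokernel o(2) by blast
  ultimately obtain f where f: "f \<in> Hom BU (GL z) (GL z')" "Comp BU (\<alpha> (GL z')) f = \<kappa>\<alpha>"
    using U.kernel_lift[OF _ q(2) \<kappa>\<alpha>] U.HomD[OF \<alpha>_Hom[OF o(2)]] by metis
  have "Comp BX (\<psi> 0) (jA (\<alpha>n 0 (GL z))) = jA \<kappa>\<alpha>"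
    using jA_comp[OF a \<kappa>(1)] \<kappa>(2) by (simp add: \<kappa>\<alpha>_def Qn_simps)
  then show ?thesis using f push_unit_natural[OF f(1)] by auto
qed

lemma B_full:
  assumes z: "gluing_datum N z" "gluing_datum N z'" and \<psi>: "chain_map BX (Bz N z) (Bz N z') \<psi>"
  shows "\<exists>f g. glue_arrow N z z' f g \<and> homotopic BX (Bz N z) (Bz N z') (B_map N f g) \<psi>"
proof -
  note L = gluing_datumD(1)[OF z(1)] and L' = gluing_datumD(1)[OF z(2)]
  obtain f where f: "f \<in> Hom BU (GL z) (GL z')"
    "Comp BX (jA (FQ 0 f)) (jA (\<alpha>n 0 (GL z))) = Comp BX (\<psi> 0) (jA (\<alpha>n 0 (GL z)))"
    using chain_map_induces_arrow[OF z \<psi>] by blast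
  have h: "jA (FQ n f) \<in> Hom BX (Cob (Bz N z) (int n)) (Cob (Bz N z') (int n))" if "n \<le> N" for n
    using jA_Hom[OF FQ_Hom[OF f(1)]] B_obj_simps(1)[OF that] by simp
  have d: "Comp BX (jA (FQ (Suc n) f)) (Cdf (Bz N z) (int n)) = Comp BX (Cdf (Bz N z') (int n)) (jA (FQ n f))"
    if "n < N" for n
    using B_obj_simps(4)[OF that] gd_natural[OF L L' f(1)] jA_comp[OF gd_Hom[OF L] FQ_Hom[OF f(1)], of n]
      jA_comp[OF FQ_Hom[OF f(1)] gd_Hom[OF L'], of n] by simp
  obtain g where g: "g \<in> Hom BX (Cob (Bz N z) (int N + 1)) (Cob (Bz N z') (int N + 1))"
    "Comp BX g (Cdf (Bz N z) (int N)) = Comp BX (Cdf (Bz N z') (int N)) (jA (FQ N f))"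
    "homotopic BX (Bz N z) (Bz N z') (\<lambda>n. if 0 \<le> n \<and> n < int N + 1 then jA (FQ (nat n) f) else
       if n = int N + 1 then g else Zer BX (Cob (Bz N z) n) (Cob (Bz N z') n)) \<psi>"
    by (rule X.chain_map_extension[OF B_obj_coresolution[OF z(1)] B_obj_complex[OF z(2)]
        B_obj_targets[OF z(2)] \<psi> h d f(2)]) auto
  have "glue_arrow N z z' f g"
    using g(1,2) f(1) z by (simp add: glue_arrow_def B_obj_simps(2,5))
  moreover have "(\<lambda>n. if 0 \<le> n \<and> n < int N + 1 then jA (FQ (nat n) f) else
       if n = int N + 1 then g else Zer BX (Cob (Bz N z) n) (Cob (Bz N z') n)) = B_map N f g"
  proof
    fix n show "(if 0 \<le> n \<and> n < int N + 1 then jA (FQ (nat n) f) else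
       if n = int N + 1 then g else Zer BX (Cob (Bz N z) n) (Cob (Bz N z') n)) = B_map N f g n"
      by (cases "n < 0 \<or> n > int N + 1") (auto simp: B_map_def B_obj_simps(3))
  qed
  ultimately show ?thesis using g(3) by auto
qed

lemma B_fully_faithful: "fully_faithful (Glue N) (Kb BX AX) (B_fun N)"
  unfolding fully_faithful_def B_functor_simps(1)
proof (intro ballI)
  fix z z' assume "z \<in> Obj (Glue N)" "z' \<in> Obj (Glue N)"
  then have z: "gluing_datum N z" "gluing_datum N z'" by (auto simp: glue_cat_def Let_def)
  note K = B_obj_complex[OF z(1)] B_obj_complex[OF z(2)]
  show "bij_betw (AMap (B_fun N)) (Hom (Glue N) z z') (Hom (Kb BX AX) (Bz N z) (Bz N z'))"
    unfolding bij_betw_def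
  proof
    show "inj_on (AMap (B_fun N)) (Hom (Glue N) z z')"
    proof (rule inj_onI)
      fix h k assume "h \<in> Hom (Glue N) z z'" "k \<in> Hom (Glue N) z z'" and eq: "AMap (B_fun N) h = AMap (B_fun N) k"
      then obtain f g f' g' where h: "h = \<lparr>Src = z, Tgt = z', Fun = (f, g)\<rparr>" "glue_arrow N z z' f g"
        and k: "k = \<lparr>Src = z, Tgt = z', Fun = (f', g')\<rparr>" "glue_arrow N z z' f' g'"
        by (auto simp: glue_Hom)
      have "homotopic BX (Bz N z) (Bz N z') (B_map N f g) (B_map N f' g')"
        using eq X.htpy_class_eq_iff[OF K B_map_chain_map[OF h(2)] B_map_chain_map[OF k(2)]]
        unfolding h(1) k(1) B_functor_simps(2) by blast
      then show "h = k" using B_faithful[OF h(2) k(2)] h(1) k(1) by simp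
    qed
    show "AMap (B_fun N) ` Hom (Glue N) z z' = Hom (Kb BX AX) (Bz N z) (Bz N z')"
    proof
      show "AMap (B_fun N) ` Hom (Glue N) z z' \<subseteq> Hom (Kb BX AX) (Bz N z) (Bz N z')"
        using B_is_functor[of N] unfolding is_functor_def B_functor_simps(1) by blast
      show "Hom (Kb BX AX) (Bz N z) (Bz N z') \<subseteq> AMap (B_fun N) ` Hom (Glue N) z z'"
      proof
        fix \<Psi> assume "\<Psi> \<in> Hom (Kb BX AX) (Bz N z) (Bz N z')"
        then obtain \<psi> where \<psi>: "\<Psi> = htpy_class BX (Bz N z) (Bz N z') \<psi>" "chain_map BX (Bz N z) (Bz N z') \<psi>"
          by (auto simp: Hom_def Kb_def Let_def htpy_class_def)
        obtain f g where fg: "glue_arrow N z z' f g" "homotopic BX (Bz N z) (Bz N z') (B_map N f g) \<psi>"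
          using B_full[OF z \<psi>(2)] by blast
        have "\<Psi> = AMap (B_fun N) \<lparr>Src = z, Tgt = z', Fun = (f, g)\<rparr>"
          using X.htpy_class_eq_iff[OF K B_map_chain_map[OF fg(1)] \<psi>(2)] fg(2) \<psi>(1) by (simp add: B_functor_simps(2))
        moreover have "\<lparr>Src = z, Tgt = z', Fun = (f, g)\<rparr> \<in> Hom (Glue N) z z'" using fg(1) by (auto simp: glue_Hom)
        ultimately show "\<Psi> \<in> AMap (B_fun N) ` Hom (Glue N) z z'" by blast
      qed
    qed
  qed
qed

end

theorem mainTheorem3:
  fixes X :: "'p topology" and C U :: "'p set" and \<O> :: "('p, 'r) ring_psh"
    and BX BU :: "(('p, 'r, 'm) mod_psh, ('p, 'r, 'm) shmod_arrow) add_cat"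
    and BC :: "(('p, ('p, 'r) germ_fun, 'm) mod_psh, ('p, ('p, 'r) germ_fun, 'm) shmod_arrow) add_cat"
    and AX AU :: "('p, 'r, 'm) mod_psh set"
    and AC :: "('p, ('p, 'r) germ_fun, 'm) mod_psh set"
    and A' :: "('o, 'a) add_cat"
    and d :: nat
  assumes "resolving_setting X C U \<O> BX BU BC AX AU AC A' G F \<alpha> \<beta> \<F> \<Q> q"
    and "1 \<le> d"
  shows "is_functor (glue_cat X \<O> U AX AU \<F> \<Q> \<alpha> q d) (Kb BX AX) (B_functor X \<O> U \<F> \<Q> \<alpha> q d) \<and>
    fully_faithful (glue_cat X \<O> U AX AU \<F> \<Q> \<alpha> q d) (Kb BX AX) (B_functor X \<O> U \<F> \<Q> \<alpha> q d)"
proof -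
  obtain N where d: "d = Suc N" using assms(2) by (cases d) auto
  show ?thesis
    unfolding d
    using resolving_setting.B_is_functor[OF assms(1)] resolving_setting.B_fully_faithful[OF assms(1)] by blast
qed

end
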